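(* Let $n=2r+1$ be odd ($r\ge1$) and $\ell\in\{1,r+1,n\}$. The $\mathcal U_q(sl_{n+1}^{tor})$-module $V(e^{\varpi_\ell}Y_{\ell,0}Y_{0,d_\ell}^{-1})$ is irreducible. Furthermore it is simple as a $\mathcal U_q^h(sl_{n+1}^{tor})$-module, and its restriction $\mathrm{Res}(V(e^{\varpi_\ell}Y_{\ell,0}Y_{0,d_\ell}^{-1}))$ to $\mathcal U_q(\widehat{sl}_{n+1})$ is isomorphic to the extremal weight module $V(\varpi_\ell)$.
   Context: Root data. Let $n=2r+1$, $r\ge1$, $I=\{0,\dots,n\}$ identified with $\mathbb Z/(n+1)\mathbb Z$, $C=(C_{i,j})_{i,j\in I}$ the Cartan matrix of type $A_n^{(1)}$ ($C_{i,i}=2$, $C_{i,i\pm1}=-1$, other entries $0$), $\mathfrak h=\bigoplus_{i\in I}\mathbb Q h_i\oplus\mathbb Q d$; $\alpha_i(h_j)=C_{j,i}$, $\alpha_i(d)=\delta_{0,i}$, $\Lambda_i(h_j)=\delta_{i,j}$, $\Lambda_i(d)=0$; $P=\{\lambda\in\mathfrak h^*:\lambda(h_i)\in\mathbb Z\ \forall i\}$, $\varpi_\ell=\Lambda_\ell-\Lambda_0$, $d_\ell=\min(\ell,n+1-\ell)$. $W$ is the affine Weyl group generated by $s_i(\lambda)=\lambda-\lambda(h_i)\alpha_i$, $i\in I$. Fix $q=e^t\in\mathbb C^*$ not a root of unity, $q^x=e^{tx}$ for $x\in\mathbb Q$, $[l]_q=\frac{q^l-q^{-l}}{q-q^{-1}}$.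 Monomial crystal. Consider monomials $m=e^{\omega(m)}\prod_{i\in I,l\in\mathbb Z}Y_{i,l}^{u_{i,l}(m)}$ with $u_{i,l}(m)\in\mathbb Z$ (finitely many non-zero), $\omega(m)\in P$, $\sum_l u_{i,l}(m)=\omega(m)(h_i)$. Put $A_{i,l}=e^{\alpha_i}Y_{i,l-1}Y_{i,l+1}Y_{i-1,l}^{-1}Y_{i+1,l}^{-1}$. Fix $s:I\to\{0,1\}$ with $s_i+s_j=1$ whenever $C_{i,j}=-1$ (chosen so that the monomials considered lie in $\mathcal M$); $\mathcal M$ is the group of monomials with $u_{i,l}(m)=0$ whenever $l\equiv s_i+1\bmod 2$. Set $\mathrm{wt}(m)=\omega(m)$, $\varphi_{i,L}(m)=\sum_{l\le L}u_{i,l}(m)$, $\varphi_i(m)=\max_L\varphi_{i,L}(m)$, $\varepsilon_{i,L}(m)=-\sum_{l\ge L}u_{i,l}(m)$, $\varepsilon_i(m)=\max_L\varepsilon_{i,L}(m)$, $p_i(m)=\max\{L:\varepsilon_{i,L}(m)=\varepsilon_i(m)\}$, $q_i(m)=\min\{L:\varphi_{i,L}(m)=\varphi_i(m)\}$; $\tilde e_i\cdot m=0$ if $\varepsilon_i(m)=0$, else $\tilde e_i\cdot m=mA_{i,p_i(m)-1}$; $\tilde f_i\cdot m=0$ if $\varphi_i(m)=0$, else $\tilde f_i\cdot m=mA_{i,q_i(m)+1}^{-1}$. $\mathcal M(m)$ is the connected subcrystal generated by $m$. Quantum toroidal algebra. $\mathcal U_q(sl_{n+1}^{tor})$ is the $\mathbb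 C$-algebra with generators $x_{i,r}^\pm$ ($i\in I,r\in\mathbb Z$), $k_h$ ($h\in\mathfrak h$), $h_{i,m}$ ($i\in I,m\in\mathbb Z\setminus\{0\}$) and relations: $k_hk_{h'}=k_{h+h'}$, $k_0=1$, $[k_h,h_{j,m}]=0$, $[h_{i,m},h_{j,m'}]=0$; $k_hx_{j,r}^\pm k_{-h}=q^{\pm\alpha_j(h)}x_{j,r}^\pm$; $[h_{i,m},x_{j,r}^\pm]=\pm\frac1m[mC_{i,j}]_qx_{j,m+r}^\pm$; $[x_{i,r}^+,x_{j,r'}^-]=\delta_{ij}\frac{\phi^+_{i,r+r'}-\phi^-_{i,r+r'}}{q-q^{-1}}$; $x_{i,r+1}^\pm x_{j,r'}^\pm-q^{\pm C_{ij}}x_{j,r'}^\pm x_{i,r+1}^\pm=q^{\pm C_{ij}}x_{i,r}^\pm x_{j,r'+1}^\pm-x_{j,r'+1}^\pm x_{i,r}^\pm$; for $j=i+1$ and $j=i-1$ the expression $x_{i,r_1}^\pm x_{i,r_2}^\pm x_{j,r'}^\pm-(q+q^{-1})x_{i,r_1}^\pm x_{j,r'}^\pm x_{i,r_2}^\pm+x_{j,r'}^\pm x_{i,r_1}^\pm x_{i,r_2}^\pm$ plus the same expression with $r_1,r_2$ exchanged is $0$; $[x_{i,r_1}^\pm,x_{j,r_2}^\pm]=0$ if $i\ne j,j\pm1$. Here $\phi_i^\pm(z)=\sum_{m\ge0}\phi^\pm_{i,\pm m}z^{\pm m}=k_{h_i}^{\pm1}\exp\big(\pm(q-q^{-1})\sum_{m'\ge1}h_{i,\pm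 m'}z^{\pm m'}\big)$ and $\phi^+_{i,m}=0$ for $m<0$, $\phi^-_{i,m}=0$ for $m>0$. $\mathcal U_q(\widehat{sl}_{n+1})$ is the Drinfeld--Jimbo quantum affine algebra with generators $x_i^\pm$ ($i\in I$), $k_h$ ($h\in\mathfrak h$); it maps to $\mathcal U_q(sl_{n+1}^{tor})$ by $k_h\mapsto k_h$, $x_i^\pm\mapsto x_{i,0}^\pm$, with image the horizontal subalgebra $\mathcal U_q^h(sl_{n+1}^{tor})$; $\mathrm{Res}$ denotes pull-back along this map. The module. For $\ell\in\{1,r+1,n\}$, $V(e^{\varpi_\ell}Y_{\ell,0}Y_{0,d_\ell}^{-1})$ is the $\mathcal U_q(sl_{n+1}^{tor})$-module with basis $(v_m)$ indexed by the monomials $m$ of $\mathcal M(e^{\varpi_\ell}Y_{\ell,0}Y_{0,d_\ell}^{-1})$ determined by: $k_hv_m=q^{\mathrm{wt}(m)(h)}v_m$; $\phi_i^\pm(z)$ acts on $v_m$ by the expansion in $z^{\pm1}$ of $\prod_l\big(q\frac{1-zq^{l-1}}{1-zq^{l+1}}\big)^{u_{i,l}(m)}$; $x_{i,0}^+v_m=v_{\tilde e_i\cdot m}$ and $x_{i,0}^-v_m=v_{\tilde f_i\cdot m}$, with $v_0:=0$. (These data determine the action of all $x_{i,r}^\pm$ through the relation for $[h_{i,m},x_{i,0}^\pm]$; such a module exists for these $\ell$.) Extremal weight module. A $\mathcal U_q(\widehat{sl}_{n+1})$-module is integrable if it is the direct sum of its weight spaces (weights in $P$) and all $x_i^\pm$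 are locally nilpotent. A vector $v$ of weight $\lambda$ in an integrable module is extremal if there are vectors $(v_w)_{w\in W}$ with $v_{\mathrm{Id}}=v$ and, whenever $\pm w(\lambda)(h_i)\ge0$, $x_i^\pm v_w=0$ and $(x_i^\mp)^{(\pm w(\lambda)(h_i))}v_w=v_{s_iw}$, where $x^{(k)}=x^k/([k]_q\cdots[1]_q)$. $V(\lambda)$ is the $\mathcal U_q(\widehat{sl}_{n+1})$-module generated by a vector $v_\lambda$ with the defining relations that $v_\lambda$ is extremal of weight $\lambda$. *)

theory Defs
  imports
    Complex_Main
    "HOL-Library.Poly_Mapping"
    "HOL-Library.Product_Plus"
    "HOL-Computational_Algebra.Formal_Power_Series"
    "HOL-Algebra.QuotRing"
    "HOL-Algebra.Module"
begin

section \<open>Left modules over a (non-commutative) ring\<close>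

text \<open>
  The axioms are those of the locale \<open>module\<close> of HOL-Algebra, which is restricted to
  commutative rings; its record type of modules is reused. A module over a complex algebra is a
  module over the underlying ring, the complex scalars acting through the scalars of the algebra.
\<close>

locale left_module = R?: ring + M?: abelian_group M for M (structure) +
  assumes smult_closed:
      "\<lbrakk>a \<in> carrier R; x \<in> carrier M\<rbrakk> \<Longrightarrow> a \<odot>\<^bsub>M\<^esub> x \<in> carrier M"
    and smult_l_distr:
      "\<lbrakk>a \<in> carrier R; b \<in> carrier R; x \<in> carrier M\<rbrakk> \<Longrightarrow>
        (a \<oplus> b) \<odot>\<^bsub>M\<^esub> x = (a \<odot>\<^bsub>M\<^esub> x) \<oplus>\<^bsub>M\<^esub> (b \<odot>\<^bsub>M\<^esub> x)"
    and smult_r_distr: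
      "\<lbrakk>a \<in> carrier R; x \<in> carrier M; y \<in> carrier M\<rbrakk> \<Longrightarrow>
        a \<odot>\<^bsub>M\<^esub> (x \<oplus>\<^bsub>M\<^esub> y) = (a \<odot>\<^bsub>M\<^esub> x) \<oplus>\<^bsub>M\<^esub> (a \<odot>\<^bsub>M\<^esub> y)"
    and smult_assoc1:
      "\<lbrakk>a \<in> carrier R; b \<in> carrier R; x \<in> carrier M\<rbrakk> \<Longrightarrow>
        (a \<otimes> b) \<odot>\<^bsub>M\<^esub> x = a \<odot>\<^bsub>M\<^esub> (b \<odot>\<^bsub>M\<^esub> x)"
    and smult_one: "x \<in> carrier M \<Longrightarrow> \<one> \<odot>\<^bsub>M\<^esub> x = x"

definition left_submodule ::
    "('a, 'c) ring_scheme \<Rightarrow> ('a, 'b, 'd) module_scheme \<Rightarrow> 'b set \<Rightarrow> bool" where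
  "left_submodule A M N \<longleftrightarrow>
     additive_subgroup N M \<and> (\<forall>a\<in>carrier A. \<forall>x\<in>N. a \<odot>\<^bsub>M\<^esub> x \<in> N)"

definition simple_left_module ::
    "('a, 'c) ring_scheme \<Rightarrow> ('a, 'b, 'd) module_scheme \<Rightarrow> bool" where
  "simple_left_module A M \<longleftrightarrow>
     left_module A M \<and> carrier M \<noteq> {\<zero>\<^bsub>M\<^esub>} \<and>
     (\<forall>N. left_submodule A M N \<longrightarrow> N = {\<zero>\<^bsub>M\<^esub>} \<or> N = carrier M)"

definition left_module_iso ::
    "('a, 'c) ring_scheme \<Rightarrow> ('a, 'b, 'd) module_scheme \<Rightarrow> ('a, 'e, 'f) module_scheme
      \<Rightarrow> ('b \<Rightarrow> 'e) set" where
  "left_module_iso A M N = {f.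
     bij_betw f (carrier M) (carrier N) \<and>
     (\<forall>x\<in>carrier M. \<forall>y\<in>carrier M. f (x \<oplus>\<^bsub>M\<^esub> y) = f x \<oplus>\<^bsub>N\<^esub> f y) \<and>
     (\<forall>a\<in>carrier A. \<forall>x\<in>carrier M. f (a \<odot>\<^bsub>M\<^esub> x) = a \<odot>\<^bsub>N\<^esub> f x)}"

definition isomorphic_left_modules ::
    "('a, 'c) ring_scheme \<Rightarrow> ('a, 'b, 'd) module_scheme \<Rightarrow> ('a, 'e, 'f) module_scheme
      \<Rightarrow> bool" where
  "isomorphic_left_modules A M N \<longleftrightarrow>
     left_module A M \<and> left_module A N \<and> left_module_iso A M N \<noteq> {}"

definition pullback_module :: "('c \<Rightarrow> 'a) \<Rightarrow> ('a, 'b) module \<Rightarrow> ('c, 'b) module" where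
  "pullback_module f M =
     \<lparr>carrier = carrier M, mult = mult M, one = one M, zero = zero M, add = add M,
      smult = (\<lambda>a x. f a \<odot>\<^bsub>M\<^esub> x)\<rparr>"

definition left_ideal :: "('a, 'c) ring_scheme \<Rightarrow> 'a set \<Rightarrow> bool" where
  "left_ideal A J \<longleftrightarrow>
     additive_subgroup J A \<and> (\<forall>a\<in>carrier A. \<forall>x\<in>J. a \<otimes>\<^bsub>A\<^esub> x \<in> J)"

definition quotient_left_module ::
    "('a, 'c) ring_scheme \<Rightarrow> 'a set \<Rightarrow> ('a, 'a set) module" where
  "quotient_left_module A J =
     \<lparr>carrier = a_rcosets\<^bsub>A\<^esub> J, mult = undefined, one = undefined, zero = J,
      add = set_add A, smult = (\<lambda>a X. \<Union>x\<in>X. J +>\<^bsub>A\<^esub> (a \<otimes>\<^bsub>A\<^esub> x))\<rparr>"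


section \<open>Complex algebras presented by generators and relations\<close>

text \<open>
  The free complex algebra is the monoid algebra of the free monoid; its multiplication is the
  convolution product of the type of finitely supported functions.
\<close>

datatype 'g free_word = Word (letters: "'g list")

instantiation free_word :: (type) monoid_add
begin
definition zero_free_word :: "'a free_word" where "0 = Word []"
definition plus_free_word :: "'a free_word \<Rightarrow> 'a free_word \<Rightarrow> 'a free_word" where
  "u + w = Word (letters u @ letters w)"
instance
  by standard (simp_all add: zero_free_word_def plus_free_word_def)
end

type_synonym 'g falg = "'g free_word \<Rightarrow>\<^sub>0 complex"

definition fvar :: "'g \<Rightarrow> 'g falg" where
  "fvar g = Poly_Mapping.single (Word [g]) 1"

definition fscal :: "complex \<Rightarrow> 'g falg" where
  "fscal c = Poly_Mapping.single 0 c"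

definition free_algebra :: "'g set \<Rightarrow> 'g falg ring" where
  "free_algebra G =
     \<lparr>carrier = {f. \<forall>w\<in>Poly_Mapping.keys f. set (letters w) \<subseteq> G},
      mult = (*), one = 1, zero = 0, add = (+)\<rparr>"

definition relation_ideal :: "'g set \<Rightarrow> 'g falg set \<Rightarrow> 'g falg set" where
  "relation_ideal G S = genideal (free_algebra G) S"

definition presented_algebra :: "'g set \<Rightarrow> 'g falg set \<Rightarrow> 'g falg set ring" where
  "presented_algebra G S = free_algebra G Quot relation_ideal G S"

definition presented_class :: "'g set \<Rightarrow> 'g falg set \<Rightarrow> 'g falg \<Rightarrow> 'g falg set" where
  "presented_class G S f = relation_ideal G S +>\<^bsub>free_algebra G\<^esub> f"

definition falg_map :: "('g \<Rightarrow> 'k) \<Rightarrow> 'g falg \<Rightarrow> 'k falg" where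
  "falg_map g f =
     (\<Sum>w\<in>Poly_Mapping.keys f.
        Poly_Mapping.single (Word (map g (letters w))) (Poly_Mapping.lookup f w))"


section \<open>Root data of type \<open>A\<^sub>n\<close> affine\<close>

text \<open>
  The index set \<open>I\<close> is \<open>{0..n}\<close>, with neighbours taken modulo \<open>n + 1\<close>. Elements of the
  Cartan algebra are given by their coordinates in the basis \<open>h\<^sub>i\<close>, \<open>d\<close>, linear forms on it by
  their coordinates in the dual basis, i.e. by their values on \<open>h\<^sub>i\<close> and \<open>d\<close>.
\<close>

definition cartan_matrix :: "nat \<Rightarrow> nat \<Rightarrow> nat \<Rightarrow> int" where
  "cartan_matrix n i j =
     (if i = j then 2
      else if j = (i + 1) mod (n + 1) \<or> i = (j + 1) mod (n + 1) then -1
      else 0)"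

datatype cartan_index = Hidx nat | Didx

type_synonym cartan = "cartan_index \<Rightarrow>\<^sub>0 rat"
type_synonym weight = "cartan_index \<Rightarrow>\<^sub>0 rat"

definition cartan_indices :: "nat \<Rightarrow> cartan_index set" where
  "cartan_indices n = insert Didx (Hidx ` {0..n})"

definition cartan_space :: "nat \<Rightarrow> cartan set" where
  "cartan_space n = {h. Poly_Mapping.keys h \<subseteq> cartan_indices n}"

definition coroot :: "nat \<Rightarrow> cartan" where
  "coroot i = Poly_Mapping.single (Hidx i) 1"

definition pairing :: "weight \<Rightarrow> cartan \<Rightarrow> rat" where
  "pairing \<mu> h =
     (\<Sum>b\<in>Poly_Mapping.keys h. Poly_Mapping.lookup h b * Poly_Mapping.lookup \<mu> b)"

definition simple_root :: "nat \<Rightarrow> nat \<Rightarrow> weight" where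
  "simple_root n i =
     (\<Sum>j\<in>{0..n}. Poly_Mapping.single (Hidx j) (of_int (cartan_matrix n j i)))
      + Poly_Mapping.single Didx (if i = 0 then 1 else 0)"

definition fund_weight :: "nat \<Rightarrow> weight" where
  "fund_weight i = Poly_Mapping.single (Hidx i) 1"

definition varpi :: "nat \<Rightarrow> weight" where
  "varpi l = fund_weight l - fund_weight 0"

definition weight_lattice :: "nat \<Rightarrow> weight set" where
  "weight_lattice n =
     {\<mu>. Poly_Mapping.keys \<mu> \<subseteq> cartan_indices n \<and> (\<forall>i\<le>n. pairing \<mu> (coroot i) \<in> \<int>)}"

definition simple_reflection :: "nat \<Rightarrow> nat \<Rightarrow> weight \<Rightarrow> weight" where
  "simple_reflection n i \<mu> =
     \<mu> - Poly_Mapping.map (\<lambda>c. pairing \<mu> (coroot i) * c) (simple_root n i)"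

text \<open>The simple reflections are involutions, so the monoid they generate is the group.\<close>

inductive_set weyl_group :: "nat \<Rightarrow> (weight \<Rightarrow> weight) set" for n :: nat where
  weyl_id: "id \<in> weyl_group n"
| weyl_refl: "\<lbrakk>w \<in> weyl_group n; i \<le> n\<rbrakk> \<Longrightarrow> simple_reflection n i \<circ> w \<in> weyl_group n"


section \<open>Quantum numbers\<close>

definition qpow :: "complex \<Rightarrow> rat \<Rightarrow> complex" where
  "qpow t x = exp (t * of_rat x)"

definition qint :: "complex \<Rightarrow> int \<Rightarrow> complex" where
  "qint t k = (qpow t (of_int k) - qpow t (- of_int k)) / (qpow t 1 - qpow t (-1))"

definition qfact :: "complex \<Rightarrow> nat \<Rightarrow> complex" where
  "qfact t k = (\<Prod>j\<in>{1..k}. qint t (int j))"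


section \<open>The monomial crystal\<close>

text \<open>
  The commutative group of monomials is written additively: the pair \<open>(\<omega>, u)\<close> stands for
  \<open>e\<^sup>\<omega>\<close> times the product of the \<open>Y\<^sub>i\<^sub>,\<^sub>k\<close> with exponent \<open>u (i, k)\<close>.
\<close>

type_synonym ymonomial = "weight \<times> ((nat \<times> int) \<Rightarrow>\<^sub>0 int)"

definition yexp :: "ymonomial \<Rightarrow> nat \<Rightarrow> int \<Rightarrow> int" where
  "yexp m i k = Poly_Mapping.lookup (snd m) (i, k)"

definition ysupp :: "ymonomial \<Rightarrow> nat \<Rightarrow> int set" where
  "ysupp m i = {k. yexp m i k \<noteq> 0}"

definition ywt :: "ymonomial \<Rightarrow> weight" where
  "ywt m = fst m"

definition is_ymonomial :: "nat \<Rightarrow> ymonomial \<Rightarrow> bool" where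
  "is_ymonomial n m \<longleftrightarrow>
     Poly_Mapping.keys (snd m) \<subseteq> {0..n} \<times> UNIV \<and> ywt m \<in> weight_lattice n \<and>
     (\<forall>i\<le>n. of_int (\<Sum>k\<in>ysupp m i. yexp m i k) = pairing (ywt m) (coroot i))"

definition Amon :: "nat \<Rightarrow> nat \<Rightarrow> int \<Rightarrow> ymonomial" where
  "Amon n i k =
     (simple_root n i,
      Poly_Mapping.single (i, k - 1) 1 + Poly_Mapping.single (i, k + 1) 1
      - Poly_Mapping.single ((i + n) mod (n + 1), k) 1
      - Poly_Mapping.single ((i + 1) mod (n + 1), k) 1)"

definition parity_function :: "nat \<Rightarrow> (nat \<Rightarrow> int) \<Rightarrow> bool" where
  "parity_function n s \<longleftrightarrow>
     (\<forall>i\<le>n. s i \<in> {0, 1}) \<and>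
     (\<forall>i\<le>n. \<forall>j\<le>n. cartan_matrix n i j = -1 \<longrightarrow> s i + s j = 1)"

definition monomial_group :: "nat \<Rightarrow> (nat \<Rightarrow> int) \<Rightarrow> ymonomial set" where
  "monomial_group n s =
     {m. is_ymonomial n m \<and>
         (\<forall>i\<le>n. \<forall>k. k mod 2 = (s i + 1) mod 2 \<longrightarrow> yexp m i k = 0)}"

definition phi_upto :: "nat \<Rightarrow> int \<Rightarrow> ymonomial \<Rightarrow> int" where
  "phi_upto i L m = (\<Sum>k | k \<in> ysupp m i \<and> k \<le> L. yexp m i k)"

definition eps_from :: "nat \<Rightarrow> int \<Rightarrow> ymonomial \<Rightarrow> int" where
  "eps_from i L m = - (\<Sum>k | k \<in> ysupp m i \<and> k \<ge> L. yexp m i k)"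

text \<open>The ranges below are finite, as only finitely many exponents are non-zero.\<close>

definition crystal_phi :: "nat \<Rightarrow> ymonomial \<Rightarrow> int" where
  "crystal_phi i m = Max (range (\<lambda>L. phi_upto i L m))"

definition crystal_eps :: "nat \<Rightarrow> ymonomial \<Rightarrow> int" where
  "crystal_eps i m = Max (range (\<lambda>L. eps_from i L m))"

text \<open>
  The extremal positions exist when \<open>crystal_eps i m > 0\<close>, respectively
  \<open>crystal_phi i m > 0\<close>; they are used only in these cases.
\<close>

definition crystal_p :: "nat \<Rightarrow> ymonomial \<Rightarrow> int" where
  "crystal_p i m = (GREATEST L. eps_from i L m = crystal_eps i m)"

definition crystal_q :: "nat \<Rightarrow> ymonomial \<Rightarrow> int" where
  "crystal_q i m = (LEAST L. phi_upto i L m = crystal_phi i m)"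

text \<open>\<open>None\<close> plays the role of the element \<open>0\<close> adjoined to the crystal.\<close>

definition crystal_e :: "nat \<Rightarrow> nat \<Rightarrow> ymonomial \<Rightarrow> ymonomial option" where
  "crystal_e n i m =
     (if crystal_eps i m = 0 then None else Some (m + Amon n i (crystal_p i m - 1)))"

definition crystal_f :: "nat \<Rightarrow> nat \<Rightarrow> ymonomial \<Rightarrow> ymonomial option" where
  "crystal_f n i m =
     (if crystal_phi i m = 0 then None else Some (m - Amon n i (crystal_q i m + 1)))"

inductive_set subcrystal :: "nat \<Rightarrow> ymonomial \<Rightarrow> ymonomial set"
  for n :: nat and m0 :: ymonomial where
  subcrystal_base: "m0 \<in> subcrystal n m0"
| subcrystal_e: "\<lbrakk>m \<in> subcrystal n m0; i \<le> n; crystal_e n i m = Some m'\<rbrakk>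
    \<Longrightarrow> m' \<in> subcrystal n m0"
| subcrystal_f: "\<lbrakk>m \<in> subcrystal n m0; i \<le> n; crystal_f n i m = Some m'\<rbrakk>
    \<Longrightarrow> m' \<in> subcrystal n m0"

definition fund_monomial :: "nat \<Rightarrow> nat \<Rightarrow> ymonomial" where
  "fund_monomial n l =
     (varpi l,
      Poly_Mapping.single (l, 0) 1 - Poly_Mapping.single (0, int (min l (n + 1 - l))) 1)"


section \<open>The quantum toroidal algebra\<close>

datatype direction = Raising | Lowering

fun dsgn :: "direction \<Rightarrow> int" where
  "dsgn Raising = 1"
| "dsgn Lowering = -1"

datatype tor_gen = TX direction nat int | TK cartan | TH nat int

definition tor_gens :: "nat \<Rightarrow> tor_gen set" where
  "tor_gens n =
     {TX p i a | p i a. i \<le> n} \<union> {TK h | h. h \<in> cartan_space n} \<union>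
     {TH i m | i m. i \<le> n \<and> m \<noteq> 0}"

abbreviation fX :: "direction \<Rightarrow> nat \<Rightarrow> int \<Rightarrow> tor_gen falg" where
  "fX p i a \<equiv> fvar (TX p i a)"

abbreviation fK :: "cartan \<Rightarrow> tor_gen falg" where
  "fK h \<equiv> fvar (TK h)"

abbreviation fH :: "nat \<Rightarrow> int \<Rightarrow> tor_gen falg" where
  "fH i m \<equiv> fvar (TH i m)"

text \<open>
  Exponential of a power series without constant term. The series \<open>fps_exp\<close> of the library is
  the exponential of a scalar multiple of the variable only. The coefficient of degree \<open>m\<close>
  involves only the first \<open>m\<close> powers.
\<close>

definition fps_exponential :: "'g falg fps \<Rightarrow> 'g falg fps" where
  "fps_exponential a = Abs_fps (\<lambda>m. \<Sum>k\<le>m. fscal (1 / fact k) * fps_nth (a ^ k) m)"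

definition tor_phi :: "complex \<Rightarrow> direction \<Rightarrow> nat \<Rightarrow> int \<Rightarrow> tor_gen falg" where
  "tor_phi t p i m =
     (if dsgn p * m < 0 then 0
      else fvar (TK (if p = Raising then coroot i else - coroot i)) *
        fps_nth
          (fps_exponential (Abs_fps (\<lambda>k.
             if k = 0 then 0
             else fscal (of_int (dsgn p) * (qpow t 1 - qpow t (-1))) * fH i (dsgn p * int k))))
          (nat \<bar>m\<bar>))"

definition tor_serre :: "complex \<Rightarrow> direction \<Rightarrow> nat \<Rightarrow> nat \<Rightarrow> int \<Rightarrow> int \<Rightarrow> int \<Rightarrow> tor_gen falg" where
  "tor_serre t p i j a1 a2 b =
     fX p i a1 * fX p i a2 * fX p j b
     - fscal (qpow t 1 + qpow t (-1)) * fX p i a1 * fX p j b * fX p i a2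
     + fX p j b * fX p i a1 * fX p i a2"

inductive_set tor_relations :: "nat \<Rightarrow> complex \<Rightarrow> tor_gen falg set"
  for n :: nat and t :: complex where
  tor_k_add: "\<lbrakk>h \<in> cartan_space n; h' \<in> cartan_space n\<rbrakk> \<Longrightarrow>
    fK h * fK h' - fK (h + h') \<in> tor_relations n t"
| tor_k_zero: "fK 0 - 1 \<in> tor_relations n t"
| tor_kh: "\<lbrakk>h \<in> cartan_space n; j \<le> n; m \<noteq> 0\<rbrakk> \<Longrightarrow>
    fK h * fH j m - fH j m * fK h \<in> tor_relations n t"
| tor_hh: "\<lbrakk>i \<le> n; j \<le> n; m \<noteq> 0; m' \<noteq> 0\<rbrakk> \<Longrightarrow>
    fH i m * fH j m' - fH j m' * fH i m \<in> tor_relations n t"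
| tor_kx: "\<lbrakk>h \<in> cartan_space n; j \<le> n\<rbrakk> \<Longrightarrow>
    fK h * fX p j a * fK (- h)
    - fscal (qpow t (of_int (dsgn p) * pairing (simple_root n j) h)) * fX p j a
    \<in> tor_relations n t"
| tor_hx: "\<lbrakk>i \<le> n; j \<le> n; m \<noteq> 0\<rbrakk> \<Longrightarrow>
    fH i m * fX p j a - fX p j a * fH i m
    - fscal (of_int (dsgn p) / of_int m * qint t (m * cartan_matrix n i j)) * fX p j (m + a)
    \<in> tor_relations n t"
| tor_xx: "\<lbrakk>i \<le> n; j \<le> n\<rbrakk> \<Longrightarrow>
    fX Raising i a * fX Lowering j b - fX Lowering j b * fX Raising i a
    - (if i = j
       then fscal (1 / (qpow t 1 - qpow t (-1))) *
              (tor_phi t Raising i (a + b) - tor_phi t Lowering i (a + b))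
       else 0)
    \<in> tor_relations n t"
| tor_quadratic: "\<lbrakk>i \<le> n; j \<le> n; c = qpow t (of_int (dsgn p * cartan_matrix n i j))\<rbrakk> \<Longrightarrow>
    (fX p i (a + 1) * fX p j b - fscal c * fX p j b * fX p i (a + 1))
    - (fscal c * fX p i a * fX p j (b + 1) - fX p j (b + 1) * fX p i a)
    \<in> tor_relations n t"
| tor_serre: "\<lbrakk>i \<le> n; j \<le> n; j = (i + 1) mod (n + 1) \<or> j = (i + n) mod (n + 1)\<rbrakk> \<Longrightarrow>
    tor_serre t p i j a1 a2 b + tor_serre t p i j a2 a1 b \<in> tor_relations n t"
| tor_far: "\<lbrakk>i \<le> n; j \<le> n; i \<noteq> j; i \<noteq> (j + 1) mod (n + 1); i \<noteq> (j + n) mod (n + 1)\<rbrakk> \<Longrightarrow>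
    fX p i a * fX p j b - fX p j b * fX p i a \<in> tor_relations n t"

definition Utor :: "nat \<Rightarrow> complex \<Rightarrow> tor_gen falg set ring" where
  "Utor n t = presented_algebra (tor_gens n) (tor_relations n t)"

definition tor_class :: "nat \<Rightarrow> complex \<Rightarrow> tor_gen falg \<Rightarrow> tor_gen falg set" where
  "tor_class n t = presented_class (tor_gens n) (tor_relations n t)"


section \<open>The quantum affine algebra\<close>

datatype aff_gen = AX direction nat | AK cartan

definition aff_gens :: "nat \<Rightarrow> aff_gen set" where
  "aff_gens n = {AX p i | p i. i \<le> n} \<union> {AK h | h. h \<in> cartan_space n}"

inductive_set aff_relations :: "nat \<Rightarrow> complex \<Rightarrow> aff_gen falg set"
  for n :: nat and t :: complex where
  aff_k_add: "\<lbrakk>h \<in> cartan_space n; h' \<in> cartan_space n\<rbrakk> \<Longrightarrow>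
    fvar (AK h) * fvar (AK h') - fvar (AK (h + h')) \<in> aff_relations n t"
| aff_k_zero: "fvar (AK 0) - 1 \<in> aff_relations n t"
| aff_kx: "\<lbrakk>h \<in> cartan_space n; j \<le> n\<rbrakk> \<Longrightarrow>
    fvar (AK h) * fvar (AX p j) * fvar (AK (- h))
    - fscal (qpow t (of_int (dsgn p) * pairing (simple_root n j) h)) * fvar (AX p j)
    \<in> aff_relations n t"
| aff_xx: "\<lbrakk>i \<le> n; j \<le> n\<rbrakk> \<Longrightarrow>
    fvar (AX Raising i) * fvar (AX Lowering j) - fvar (AX Lowering j) * fvar (AX Raising i)
    - (if i = j
       then fscal (1 / (qpow t 1 - qpow t (-1))) *
              (fvar (AK (coroot i)) - fvar (AK (- coroot i)))
       else 0)
    \<in> aff_relations n t"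
| aff_serre: "\<lbrakk>i \<le> n; j \<le> n; i \<noteq> j; N = nat (1 - cartan_matrix n i j)\<rbrakk> \<Longrightarrow>
    (\<Sum>k\<le>N. fscal ((-1) ^ k / (qfact t (N - k) * qfact t k)) *
       fvar (AX p i) ^ (N - k) * fvar (AX p j) * fvar (AX p i) ^ k)
    \<in> aff_relations n t"

definition Uaff :: "nat \<Rightarrow> complex \<Rightarrow> aff_gen falg set ring" where
  "Uaff n t = presented_algebra (aff_gens n) (aff_relations n t)"

definition aff_class :: "nat \<Rightarrow> complex \<Rightarrow> aff_gen falg \<Rightarrow> aff_gen falg set" where
  "aff_class n t = presented_class (aff_gens n) (aff_relations n t)"

fun horizontal_gen :: "aff_gen \<Rightarrow> tor_gen" where
  "horizontal_gen (AX p i) = TX p i 0"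
| "horizontal_gen (AK h) = TK h"

text \<open>
  The map on classes induced by \<open>horizontal_gen\<close>. It is independent of representatives, so that
  the union below consists of a single class.
\<close>

definition horizontal_map ::
    "nat \<Rightarrow> complex \<Rightarrow> aff_gen falg set \<Rightarrow> tor_gen falg set" where
  "horizontal_map n t a = (\<Union>f\<in>a. tor_class n t (falg_map horizontal_gen f))"

definition Uhor :: "nat \<Rightarrow> complex \<Rightarrow> tor_gen falg set ring" where
  "Uhor n t = (Utor n t)\<lparr>carrier := horizontal_map n t ` carrier (Uaff n t)\<rparr>"


section \<open>The module with basis the monomial crystal\<close>

definition is_basis ::
    "nat \<Rightarrow> complex \<Rightarrow> (tor_gen falg set, 'v) module \<Rightarrow> 'm set \<Rightarrow> ('m \<Rightarrow> 'v) \<Rightarrow> bool" where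
  "is_basis n t M B v \<longleftrightarrow>
     v ` B \<subseteq> carrier M \<and>
     (\<forall>x\<in>carrier M. \<exists>!c :: 'm \<Rightarrow>\<^sub>0 complex. Poly_Mapping.keys c \<subseteq> B \<and>
        x = (\<Oplus>\<^bsub>M\<^esub>m\<in>Poly_Mapping.keys c.
               tor_class n t (fscal (Poly_Mapping.lookup c m)) \<odot>\<^bsub>M\<^esub> v m))"

text \<open>
  Expansion of \<open>q (1 - z q\<^sup>k\<^sup>-\<^sup>1) / (1 - z q\<^sup>k\<^sup>+\<^sup>1)\<close> in powers of \<open>z\<close> (raising direction) and in
  powers of \<open>w = z\<^sup>-\<^sup>1\<close> (lowering direction); in terms of \<open>w\<close> the fraction is
  \<open>q (w - q\<^sup>k\<^sup>-\<^sup>1) / (w - q\<^sup>k\<^sup>+\<^sup>1)\<close>.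
\<close>

definition phi_factor :: "complex \<Rightarrow> direction \<Rightarrow> int \<Rightarrow> complex fps" where
  "phi_factor t p k =
     (case p of
        Raising \<Rightarrow> fps_const (qpow t 1) * (1 - fps_const (qpow t (of_int (k - 1))) * fps_X)
                     * inverse (1 - fps_const (qpow t (of_int (k + 1))) * fps_X)
      | Lowering \<Rightarrow> fps_const (qpow t 1) * (fps_X - fps_const (qpow t (of_int (k - 1))))
                     * inverse (fps_X - fps_const (qpow t (of_int (k + 1)))))"

definition phi_eigenvalue :: "complex \<Rightarrow> direction \<Rightarrow> nat \<Rightarrow> ymonomial \<Rightarrow> complex fps" where
  "phi_eigenvalue t p i m = (\<Prod>k\<in>ysupp m i. phi_factor t p k powi yexp m i k)"

definition crystal_vector ::
    "(tor_gen falg set, 'v) module \<Rightarrow> (ymonomial \<Rightarrow> 'v) \<Rightarrow> ymonomial option \<Rightarrow> 'v" where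
  "crystal_vector M v x = (case x of None \<Rightarrow> \<zero>\<^bsub>M\<^esub> | Some m \<Rightarrow> v m)"

text \<open>
  \<open>M\<close> is the module attached to the monomial \<open>m0\<close>, with distinguished basis \<open>v\<close>. By the
  relations of the algebra these data determine the action of all generators.
\<close>

definition is_monomial_module ::
    "nat \<Rightarrow> complex \<Rightarrow> ymonomial \<Rightarrow> (tor_gen falg set, 'v) module \<Rightarrow> (ymonomial \<Rightarrow> 'v) \<Rightarrow> bool"
  where
  "is_monomial_module n t m0 M v \<longleftrightarrow>
     left_module (Utor n t) M \<and>
     is_basis n t M (subcrystal n m0) v \<and>
     (\<forall>m\<in>subcrystal n m0.
        (\<forall>h\<in>cartan_space n.
           tor_class n t (fK h) \<odot>\<^bsub>M\<^esub> v m =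
           tor_class n t (fscal (qpow t (pairing (ywt m) h))) \<odot>\<^bsub>M\<^esub> v m) \<and>
        (\<forall>i\<le>n.
           (\<forall>p k. tor_class n t (tor_phi t p i (dsgn p * int k)) \<odot>\<^bsub>M\<^esub> v m =
              tor_class n t (fscal (fps_nth (phi_eigenvalue t p i m) k)) \<odot>\<^bsub>M\<^esub> v m) \<and>
           tor_class n t (fX Raising i 0) \<odot>\<^bsub>M\<^esub> v m = crystal_vector M v (crystal_e n i m) \<and>
           tor_class n t (fX Lowering i 0) \<odot>\<^bsub>M\<^esub> v m = crystal_vector M v (crystal_f n i m)))"


section \<open>Extremal weight modules\<close>

definition weight_space ::
    "nat \<Rightarrow> complex \<Rightarrow> (aff_gen falg set, 'v) module \<Rightarrow> weight \<Rightarrow> 'v set" where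
  "weight_space n t M \<mu> =
     {x \<in> carrier M. \<forall>h\<in>cartan_space n.
        aff_class n t (fvar (AK h)) \<odot>\<^bsub>M\<^esub> x =
        aff_class n t (fscal (qpow t (pairing \<mu> h))) \<odot>\<^bsub>M\<^esub> x}"

text \<open>
  The first clause expresses that the module is the direct sum of its weight spaces: the function
  \<open>c\<close> gives the components of \<open>x\<close>.
\<close>

definition integrable_module ::
    "nat \<Rightarrow> complex \<Rightarrow> (aff_gen falg set, 'v) module \<Rightarrow> bool" where
  "integrable_module n t M \<longleftrightarrow>
     (\<forall>x\<in>carrier M. \<exists>!c :: weight \<Rightarrow> 'v.
        (\<forall>\<mu>\<in>weight_lattice n. c \<mu> \<in> weight_space n t M \<mu>) \<and>
        (\<forall>\<mu>. \<mu> \<notin> weight_lattice n \<longrightarrow> c \<mu> = \<zero>\<^bsub>M\<^esub>) \<and>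
        finite {\<mu>. c \<mu> \<noteq> \<zero>\<^bsub>M\<^esub>} \<and>
        x = (\<Oplus>\<^bsub>M\<^esub>\<mu>\<in>{\<mu>. c \<mu> \<noteq> \<zero>\<^bsub>M\<^esub>}. c \<mu>)) \<and>
     (\<forall>p. \<forall>i\<le>n. \<forall>x\<in>carrier M. \<exists>N::nat.
        (aff_class n t (fvar (AX p i)) [^]\<^bsub>Uaff n t\<^esub> N) \<odot>\<^bsub>M\<^esub> x = \<zero>\<^bsub>M\<^esub>)"

definition divided_power ::
    "nat \<Rightarrow> complex \<Rightarrow> direction \<Rightarrow> nat \<Rightarrow> nat \<Rightarrow> aff_gen falg set" where
  "divided_power n t p i k =
     aff_class n t (fscal (1 / qfact t k)) \<otimes>\<^bsub>Uaff n t\<^esub>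
     (aff_class n t (fvar (AX p i)) [^]\<^bsub>Uaff n t\<^esub> k)"

definition extremal_vector ::
    "nat \<Rightarrow> complex \<Rightarrow> (aff_gen falg set, 'v) module \<Rightarrow> weight \<Rightarrow> 'v \<Rightarrow> bool" where
  "extremal_vector n t M \<mu> x \<longleftrightarrow>
     left_module (Uaff n t) M \<and> integrable_module n t M \<and> x \<in> weight_space n t M \<mu> \<and>
     (\<exists>v :: (weight \<Rightarrow> weight) \<Rightarrow> 'v.
        (\<forall>w\<in>weyl_group n. v w \<in> carrier M) \<and> v id = x \<and>
        (\<forall>w\<in>weyl_group n. \<forall>i\<le>n.
           (pairing (w \<mu>) (coroot i) \<ge> 0 \<longrightarrow>
              aff_class n t (fvar (AX Raising i)) \<odot>\<^bsub>M\<^esub> v w = \<zero>\<^bsub>M\<^esub> \<and>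
              divided_power n t Lowering i (nat \<lfloor>pairing (w \<mu>) (coroot i)\<rfloor>) \<odot>\<^bsub>M\<^esub> v w
                = v (simple_reflection n i \<circ> w)) \<and>
           (pairing (w \<mu>) (coroot i) \<le> 0 \<longrightarrow>
              aff_class n t (fvar (AX Lowering i)) \<odot>\<^bsub>M\<^esub> v w = \<zero>\<^bsub>M\<^esub> \<and>
              divided_power n t Raising i (nat \<lfloor>- pairing (w \<mu>) (coroot i)\<rfloor>) \<odot>\<^bsub>M\<^esub> v w
                = v (simple_reflection n i \<circ> w))))"

text \<open>
  The module generated by one vector subject to the relations saying that it is extremal of weight
  \<open>\<mu>\<close> is the quotient of the algebra by the smallest left ideal \<open>J\<close> such that the class of \<open>1\<close> is
  an extremal vector of weight \<open>\<mu>\<close> modulo \<open>J\<close>. The vectors attached to the Weyl group elements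
  being determined by the generator, extremality amounts to a set of linear relations on the
  generator (which force integrability), hence the intersection below has the required property.
\<close>

definition extremal_left_ideal :: "nat \<Rightarrow> complex \<Rightarrow> weight \<Rightarrow> aff_gen falg set set" where
  "extremal_left_ideal n t \<mu> =
     \<Inter>{J. left_ideal (Uaff n t) J \<and>
          extremal_vector n t (quotient_left_module (Uaff n t) J) \<mu>
            (J +>\<^bsub>Uaff n t\<^esub> \<one>\<^bsub>Uaff n t\<^esub>)}"

definition extremal_weight_module ::
    "nat \<Rightarrow> complex \<Rightarrow> weight \<Rightarrow> (aff_gen falg set, aff_gen falg set set) module" where
  "extremal_weight_module n t \<mu> =
     quotient_left_module (Uaff n t) (extremal_left_ideal n t \<mu>)"

end

theory Submission
  imports Defs "HOL-Algebra.Subrings"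
begin

text \<open>
  The crystal of the given monomial \<open>m\<^sub>0\<close> is minuscule: in each of its monomials every vertex of
  the Dynkin diagram carries at most one variable, with exponent 1 or -1, so that
  strings have length at most one. Moreover the weights of the crystal are pairwise distinct, and they
  form a single orbit of the Weyl group. For the two extreme fundamental weights the crystal is a chain indexed by the
  integers (\<open>chain_minuscule\<close>). For the middle one it consists of the functions \<open>H\<close> on the cycle
  with \<open>n + 1\<close> vertices whose consecutive values differ by 1: a local minimum of \<open>H\<close> at \<open>i\<close> stands
  for \<open>Y\<close> at \<open>(i, H i)\<close>, a local maximum for its inverse, and the Kashiwara operators turn a
  local minimum into a local maximum and back (\<open>height_minuscule\<close>). Such a function
  has as many ascents as descents, and the descents correspond to the boxes of a column; this is
  where \<open>n + 1 = 2 l\<close> enters.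

  Simplicity is a consequence of the distinctness of the weights: as \<open>q\<close> is not a root of unity, the
  Cartan elements separate them, so a non-zero submodule contains a basis vector
  (\<open>submodule_contains_basis_vector\<close>), and the crystal is connected. Only the horizontal generators
  are used, which gives simplicity over the horizontal subalgebra and over the whole algebra at once.

  It remains to identify the annihilator of the vector \<open>v\<close> at \<open>m\<^sub>0\<close> with the left ideal defining the
  extremal weight module. The vector \<open>v\<close> is extremal, the vectors attached to Weyl group elements
  being basis vectors (\<open>extremal\<close>). Conversely, let \<open>x\<close> be an extremal vector of the same weight in
  another module, with companions \<open>x\<^sub>w\<close>. They are permuted by the Chevalley generators as
  prescribed by the crystal as soon as \<open>x\<^sub>w\<close> depends only on the weight \<open>w \<lambda>\<close>. This is a statement
  about monodromy: the pairs of a crystal element and a companion of the same weight form a covering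
  of the crystal graph, which has to be trivial. Two arrows of different colours leaving the same
  vertex have non-adjacent colours, so they complete to a square, and the lowering operators of
  these colours commute by the Serre relations. By moving through such squares every path becomes an
  ascending path followed by a descending one (\<open>reached_cospan\<close>), and two ascending paths with the
  same ends have the same colours, since the simple roots are linearly independent, and therefore act
  by the same operator (\<open>fold_eq_if_same_content\<close>). So loops act trivially
  (\<open>reached_base_unique\<close>), every element of the algebra acts on \<open>v\<close> and on \<open>x\<close> with the same
  coefficients (\<open>crystal_families_parallel\<close>), and what annihilates \<open>v\<close> annihilates \<open>x\<close>.
\<close>

section \<open>Words in a locally confluent coloured graph\<close>

fun run :: "('c \<Rightarrow> 'b \<Rightarrow> 'b option) \<Rightarrow> 'c list \<Rightarrow> 'b \<Rightarrow> 'b option" where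
  "run f [] b = Some b"
| "run f (i # w) b = (case f i b of None \<Rightarrow> None | Some b' \<Rightarrow> run f w b')"

lemma run_append:
  "run f (u @ w) b = (case run f u b of None \<Rightarrow> None | Some b' \<Rightarrow> run f w b')"
  by (induction u arbitrary: b) (auto split: option.splits)

text \<open>
  Arrows of different colours with the same source complete to a square, and the operators attached
  to the two colours commute. Commutation is demanded only where such a square exists, because the
  operators of adjacent colours do not commute.
\<close>

locale coloured_diamonds =
  fixes f :: "'c \<Rightarrow> 'b \<Rightarrow> 'b option"
    and F :: "'c \<Rightarrow> 'm \<Rightarrow> 'm"
    and Y :: "'m set"
  assumes diamond: "\<lbrakk>f i b = Some b1; f j b = Some b2; i \<noteq> j\<rbrakk> \<Longrightarrow>
      \<exists>c. f j b1 = Some c \<and> f i b2 = Some c"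
    and F_commute: "\<lbrakk>f i b = Some b1; f j b = Some b2; i \<noteq> j; y \<in> Y\<rbrakk> \<Longrightarrow> F i (F j y) = F j (F i y)"
    and F_closed: "\<lbrakk>f i b = Some b1; y \<in> Y\<rbrakk> \<Longrightarrow> F i y \<in> Y"
begin

text \<open>
  An arrow at the start of a path is pushed along the path through the squares. Either it meets an
  arrow of its own colour, which it cancels, or it survives to the end; in both cases the colours
  of the path are otherwise unchanged. The case distinction is decided by the word alone.
\<close>

lemma residual_run:
  assumes "run f w p = Some q" "f j p = Some p1" "y \<in> Y"
  shows "if j \<in> set w
    then run f (remove1 j w) p1 = Some q \<and> fold F w y = fold F (remove1 j w) (F j y)
    else \<exists>q1. f j q = Some q1 \<and> run f w p1 = Some q1 \<and> F j (fold F w y) = fold F w (F j y)"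
  using assms
proof (induction w arbitrary: p p1 y)
  case Nil
  then show ?case by simp
next
  case (Cons i w)
  then obtain p' where p': "f i p = Some p'" "run f w p' = Some q"
    by (auto split: option.splits)
  show ?case
  proof (cases "i = j")
    case True
    then show ?thesis using Cons.prems p' by simp
  next
    case False
    obtain c where c: "f j p' = Some c" "f i p1 = Some c"
      using diamond[OF p'(1) Cons.prems(2) False] by blast
    have FF: "F i (F j y) = F j (F i y)"
      using F_commute[OF p'(1) Cons.prems(2) False Cons.prems(3)] .
    have "F i y \<in> Y" using F_closed[OF p'(1) Cons.prems(3)] .
    from Cons.IH[OF p'(2) c(1) this] show ?thesis
      using False c(2) FF by (auto split: if_splits)
  qed
qed

text \<open>
  The first letter of one word is pulled to the front of the other one.
\<close>

lemma fold_eq_if_same_content: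
  assumes "run f u p = Some q" "run f w p = Some q'" "mset u = mset w" "y \<in> Y"
  shows "fold F u y = fold F w y"
  using assms
proof (induction w arbitrary: u p y)
  case Nil
  then show ?case by simp
next
  case (Cons j w)
  then obtain p1 where p1: "f j p = Some p1" "run f w p1 = Some q'"
    by (auto split: option.splits)
  have j: "j \<in> set u" using Cons.prems(3) by (metis list.set_intros(1) set_mset_mset)
  have "mset (remove1 j u) = mset w"
    using Cons.prems(3) by simp
  with Cons.IH[OF _ p1(2), of "remove1 j u" "F j y"] residual_run[OF Cons.prems(1) p1(1) Cons.prems(4)]
    F_closed[OF p1(1) Cons.prems(4)] j
  show ?case by simp
qed

end

text \<open>
  A family of pairs \<open>(b, y)\<close> lying over the graph like a covering: every edge lifts uniquely in both
  directions.
\<close>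

locale coloured_covering = coloured_diamonds f F Y
  for f :: "'c \<Rightarrow> 'b \<Rightarrow> 'b option" and F :: "'c \<Rightarrow> 'm \<Rightarrow> 'm" and Y :: "'m set" +
  fixes E :: "'c \<Rightarrow> 'm \<Rightarrow> 'm" and b0 :: 'b and x0 :: 'm and X :: "('b \<times> 'm) set"
  assumes base: "(b0, x0) \<in> X"
    and X_sub: "(b, y) \<in> X \<Longrightarrow> y \<in> Y"
    and up: "\<lbrakk>(b, y) \<in> X; f i b = Some b'\<rbrakk> \<Longrightarrow> (b', F i y) \<in> X \<and> E i (F i y) = y"
    and down: "\<lbrakk>(b', y) \<in> X; f i b = Some b'\<rbrakk> \<Longrightarrow> (b, E i y) \<in> X \<and> F i (E i y) = y"
    and same_content:
      "\<lbrakk>run f u b0 = Some q; run f w b0 = Some q\<rbrakk> \<Longrightarrow> mset u = mset w"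
begin

inductive reached :: "'b \<Rightarrow> 'm \<Rightarrow> bool" where
  reached_base: "reached b0 x0"
| reached_up: "\<lbrakk>reached b y; f i b = Some b'\<rbrakk> \<Longrightarrow> reached b' (F i y)"
| reached_down: "\<lbrakk>reached b' y; f i b = Some b'\<rbrakk> \<Longrightarrow> reached b (E i y)"

lemma reached_in_X: "reached b y \<Longrightarrow> (b, y) \<in> X"
  by (induction rule: reached.induct) (auto simp: base up down)

text \<open>
  A descent followed by an ascent from the same lower vertex is the span of a square, so ascents can
  be moved in front of descents.
\<close>

lemma reached_cospan:
  "reached p y \<Longrightarrow> \<exists>u w q. run f u b0 = Some q \<and> run f w p = Some q \<and> fold F u x0 = fold F w y"
proof (induction rule: reached.induct)
  case reached_base
  have "run f [] b0 = Some b0 \<and> run f [] b0 = Some b0 \<and> fold F [] x0 = fold F [] x0" by simp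
  then show ?case by blast
next
  case (reached_up b y i b')
  then obtain u w q where uw: "run f u b0 = Some q" "run f w b = Some q"
    "fold F u x0 = fold F w y" by blast
  have y: "y \<in> Y" using reached_up.hyps(1) reached_in_X X_sub by blast
  show ?case
  proof (cases "i \<in> set w")
    case True
    then show ?thesis using residual_run[OF uw(2) reached_up.hyps(2) y] uw by auto
  next
    case False
    then obtain q1 where q1: "f i q = Some q1" "run f w b' = Some q1"
      "F i (fold F w y) = fold F w (F i y)"
      using residual_run[OF uw(2) reached_up.hyps(2) y] by auto
    have "run f (u @ [i]) b0 = Some q1" using uw(1) q1(1) by (simp add: run_append)
    moreover have "fold F (u @ [i]) x0 = fold F w (F i y)" using uw(3) q1(3) by simp
    ultimately show ?thesis using q1(2) by blast
  qed
next
  case (reached_down b' y i b)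
  then obtain u w q where uw: "run f u b0 = Some q" "run f w b' = Some q"
    "fold F u x0 = fold F w y" by blast
  have "F i (E i y) = y" using down[OF reached_in_X[OF reached_down.hyps(1)] reached_down.hyps(2)] by simp
  then have "run f (i # w) b = Some q \<and> fold F u x0 = fold F (i # w) (E i y)"
    using uw reached_down.hyps(2) by simp
  then show ?case using uw(1) by blast
qed

lemma fold_inj:
  "\<lbrakk>run f w p = Some q; (p, y) \<in> X; (p, y') \<in> X; fold F w y = fold F w y'\<rbrakk> \<Longrightarrow> y = y'"
proof (induction w arbitrary: p y y')
  case (Cons i w)
  then obtain p' where p': "f i p = Some p'" "run f w p' = Some q"
    by (auto split: option.splits)
  have "F i y = F i y'" using Cons.IH[OF p'(2)] up[OF _ p'(1)] Cons.prems by auto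
  then show ?case using up[OF _ p'(1)] Cons.prems by metis
qed simp

text \<open>
  For a loop, the ascending and the descending half start and end at the same vertices, so they have
  the same colours and act by the same operator, which is injective on the covering.
\<close>

lemma reached_base_unique:
  assumes "reached b0 y" shows "y = x0"
proof -
  obtain u w q where uw: "run f u b0 = Some q" "run f w b0 = Some q"
    "fold F u x0 = fold F w y" using reached_cospan[OF assms] by blast
  have "fold F u x0 = fold F w x0"
    using fold_eq_if_same_content[OF uw(1,2) same_content[OF uw(1,2)] X_sub[OF base]] .
  then show ?thesis using fold_inj[OF uw(2)] reached_in_X[OF assms] base uw(3) by metis
qed

lemma reached_unique: "\<lbrakk>reached b y; reached b y'\<rbrakk> \<Longrightarrow> y' = y"
proof (induction arbitrary: y' rule: reached.induct)
  case reached_base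
  then show ?case by (rule reached_base_unique)
next
  case (reached_up b y i b')
  have "reached b (E i y')" using reached.reached_down[OF reached_up.prems reached_up.hyps(2)] .
  then have "E i y' = y" by (rule reached_up.IH)
  then show ?case using down[OF reached_in_X[OF reached_up.prems] reached_up.hyps(2)] by auto
next
  case (reached_down b' y i b)
  have "reached b' (F i y')" using reached.reached_up[OF reached_down.prems reached_down.hyps(2)] .
  then have "F i y' = y" by (rule reached_down.IH)
  then show ?case using up[OF reached_in_X[OF reached_down.prems] reached_down.hyps(2)] by auto
qed

end

section \<open>Harmonic functions on a cycle\<close>

text \<open>
  The differences of a harmonic function are constant along the cycle and add up to zero. The
  characteristic must not divide the length of the cycle.
\<close>

lemma cyclic_harmonic_const:
  fixes c :: "nat \<Rightarrow> 'a::{field_char_0}"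
  assumes "\<And>i. i \<le> n \<Longrightarrow> 2 * c i = c ((i + 1) mod (n + 1)) + c ((i + n) mod (n + 1))"
    and "i \<le> n"
  shows "c i = c 0"
proof -
  define g where "g k = c (k mod (n + 1))" for k
  have step: "g (k + 2) - g (k + 1) = g (k + 1) - g k" for k
  proof -
    have "(k + 1) mod (n + 1) \<le> n" by (simp add: less_Suc_eq_le[symmetric])
    from assms(1)[OF this] have "2 * g (k + 1) = g (k + 2) + c (((k + 1) mod (n + 1) + n) mod (n + 1))"
      by (simp add: g_def mod_simps)
    moreover have "((k + 1) mod (n + 1) + n) mod (n + 1) = k mod (n + 1)"
    proof -
      have "((k + 1) mod (n + 1) + n) mod (n + 1) = (k + 1 + n) mod (n + 1)" by (simp add: mod_simps)
      also have "\<dots> = k mod (n + 1)" using mod_add_self2[of k "n+1"] by (simp add: add.assoc add.commute)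
      finally show ?thesis .
    qed
    ultimately have "2 * g (k + 1) = g (k + 2) + g k" by (simp add: g_def)
    then show ?thesis by (simp add: algebra_simps)
  qed
  have d: "g (k + 1) - g k = g 1 - g 0" for k
    by (induction k) (use step in \<open>auto simp: numeral_2_eq_2\<close>)
  have lin: "g k = g 0 + of_nat k * (g 1 - g 0)" for k
  proof (induction k)
    case (Suc k)
    have "g (Suc k) = g k + (g 1 - g 0)" using d[of k] by (simp add: algebra_simps)
    also have "\<dots> = g 0 + of_nat k * (g 1 - g 0) + (g 1 - g 0)" by (simp only: Suc)
    finally show ?case by (simp add: algebra_simps)
  qed simp
  have "g (n + 1) = g 0" by (simp add: g_def)
  with lin[of "n + 1"] have "of_nat (n + 1) * (g 1 - g 0) = 0" by simp
  then have "g 1 - g 0 = 0" by (metis mult_eq_0_iff of_nat_eq_0_iff add_is_0 one_neq_zero)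
  then have "g i = g 0" using lin[of i] by simp
  then show ?thesis using assms(2) by (simp add: g_def)
qed

section \<open>Free algebras and presented algebras\<close>

lemma free_algebra_simps [simp]:
  "mult (free_algebra G) = (*)" "one (free_algebra G) = 1"
  "zero (free_algebra G) = 0" "add (free_algebra G) = (+)"
  by (simp_all add: free_algebra_def)

lemma free_algebra_carrier:
  "f \<in> carrier (free_algebra G) \<longleftrightarrow> (\<forall>w\<in>Poly_Mapping.keys f. set (letters w) \<subseteq> G)"
  by (simp add: free_algebra_def)

lemma letters_zero [simp]: "letters 0 = []"
  by (simp add: zero_free_word_def)

lemma letters_plus [simp]: "letters (u + w) = letters u @ letters w"
  by (simp add: plus_free_word_def)

lemma fa_zero [simp, intro]: "0 \<in> carrier (free_algebra G)"
  by (simp add: free_algebra_carrier)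

lemma fa_one [simp, intro]: "1 \<in> carrier (free_algebra G)"
  by (simp add: free_algebra_carrier)

lemma fa_add [simp, intro]:
  "\<lbrakk>f \<in> carrier (free_algebra G); g \<in> carrier (free_algebra G)\<rbrakk> \<Longrightarrow> f + g \<in> carrier (free_algebra G)"
  using keys_add[of f g] by (fastforce simp: free_algebra_carrier)

lemma fa_uminus [simp, intro]:
  "f \<in> carrier (free_algebra G) \<Longrightarrow> - f \<in> carrier (free_algebra G)"
  by (simp add: free_algebra_carrier in_keys_iff)

lemma fa_diff [simp, intro]:
  "\<lbrakk>f \<in> carrier (free_algebra G); g \<in> carrier (free_algebra G)\<rbrakk> \<Longrightarrow> f - g \<in> carrier (free_algebra G)"
  using fa_add[of f G "- g"] fa_uminus[of g G] by simp

lemma fa_mult [simp, intro]: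
  assumes "f \<in> carrier (free_algebra G)" "g \<in> carrier (free_algebra G)"
  shows "f * g \<in> carrier (free_algebra G)"
  unfolding free_algebra_carrier
proof
  fix w assume "w \<in> Poly_Mapping.keys (f * g)"
  then obtain a b where "w = a + b" "a \<in> Poly_Mapping.keys f" "b \<in> Poly_Mapping.keys g"
    using keys_mult[of f g] by blast
  then show "set (letters w) \<subseteq> G" using assms by (auto simp: free_algebra_carrier)
qed

lemma fa_fscal [simp, intro]: "fscal c \<in> carrier (free_algebra G)"
  by (auto simp: free_algebra_carrier fscal_def)

lemma fa_fvar [simp, intro]: "x \<in> G \<Longrightarrow> fvar x \<in> carrier (free_algebra G)"
  by (auto simp: free_algebra_carrier fvar_def)

lemma fa_power [simp, intro]: "f \<in> carrier (free_algebra G) \<Longrightarrow> f ^ k \<in> carrier (free_algebra G)"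
  by (induction k) auto

lemma fa_sum [intro]:
  "(\<And>i. i \<in> A \<Longrightarrow> f i \<in> carrier (free_algebra G)) \<Longrightarrow> sum f A \<in> carrier (free_algebra G)"
  by (induction A rule: infinite_finite_induct) auto

lemma free_algebra_ring: "ring (free_algebra G)"
proof (rule ringI)
  show "abelian_group (free_algebra G)"
  proof (rule abelian_groupI)
    fix x assume "x \<in> carrier (free_algebra G)"
    then show "\<exists>y\<in>carrier (free_algebra G). y \<oplus>\<^bsub>free_algebra G\<^esub> x = \<zero>\<^bsub>free_algebra G\<^esub>"
      by (intro bexI[of _ "- x"]) auto
  qed (auto simp: add.assoc add.commute)
  show "Group.monoid (free_algebra G)"
    by (rule monoidI) (auto simp: mult.assoc)
qed (auto simp: distrib_left distrib_right)

lemma fscal_add: "fscal (a + b) = fscal a + fscal b"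
  by (simp add: fscal_def single_add)

lemma fscal_mult: "fscal (a * b) = fscal a * fscal b"
  by (simp add: fscal_def mult_single)

lemma fscal_one [simp]: "fscal 1 = 1" by (simp add: fscal_def)
lemma fscal_zero [simp]: "fscal 0 = 0" by (simp add: fscal_def)

lemma fscal_uminus: "fscal (- a) = - fscal a"
  by (simp add: fscal_def single_uminus)

abbreviation supp :: "('a \<Rightarrow>\<^sub>0 'b::zero) \<Rightarrow> 'a set" where "supp \<equiv> Poly_Mapping.keys"
abbreviation coef :: "('a \<Rightarrow>\<^sub>0 'b::zero) \<Rightarrow> 'a \<Rightarrow> 'b" where "coef \<equiv> Poly_Mapping.lookup"

text \<open>
  Finitely supported functions are sums of functions supported at one point; in contrast to the
  induction by updating values, the sums here may overlap.
\<close>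

lemma poly_mapping_add_induct [case_names zero single add]:
  assumes "P 0" "\<And>w c. w \<in> A \<Longrightarrow> P (Poly_Mapping.single w c)"
    "\<And>f g. \<lbrakk>P f; P g\<rbrakk> \<Longrightarrow> P (f + g)"
    and "supp (f :: 'a \<Rightarrow>\<^sub>0 'b::comm_monoid_add) \<subseteq> A"
  shows "P f"
proof -
  have "P (\<Sum>w\<in>K. Poly_Mapping.single w (coef f w))" if "finite K" "K \<subseteq> A" for K
    using that by (induction K rule: finite_induct) (auto intro: assms)
  then have "P (\<Sum>w\<in>supp f. Poly_Mapping.single w (coef f w))"
    using assms(4) by simp
  moreover have "(\<Sum>w\<in>supp f. Poly_Mapping.single w (coef f w)) = f"
    by (rule poly_mapping_eqI)
       (simp add: lookup_sum lookup_single when_def in_keys_iff)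
  ultimately show ?thesis by simp
qed

text \<open>
  Generators are multiplied from the left only: this is the form of induction that suits the action
  on a left module.
\<close>

lemma free_algebra_induct [consumes 1, case_names zero one scal var add]:
  assumes "f \<in> carrier (free_algebra G)"
    and "P 0" "P 1" "\<And>c f. \<lbrakk>f \<in> carrier (free_algebra G); P f\<rbrakk> \<Longrightarrow> P (fscal c * f)"
    and "\<And>x f. \<lbrakk>x \<in> G; f \<in> carrier (free_algebra G); P f\<rbrakk> \<Longrightarrow> P (fvar x * f)"
    and "\<And>f g. \<lbrakk>f \<in> carrier (free_algebra G); g \<in> carrier (free_algebra G); P f; P g\<rbrakk> \<Longrightarrow> P (f + g)"
  shows "P f"
proof -
  have word: "P (Poly_Mapping.single (Word xs) 1) \<and> Poly_Mapping.single (Word xs) 1 \<in> carrier (free_algebra G)"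
    if "set xs \<subseteq> G" for xs
    using that
  proof (induction xs)
    case Nil
    have "(Poly_Mapping.single (Word []) 1 :: 'a falg) = 1"
      by (simp add: zero_free_word_def[symmetric])
    then show ?case using assms(3) by simp
  next
    case (Cons x xs)
    have "Poly_Mapping.single (Word (x # xs)) (1::complex) = fvar x * Poly_Mapping.single (Word xs) 1"
      by (simp add: fvar_def mult_single plus_free_word_def)
    then show ?case using Cons assms(5) by simp
  qed
  have "P f \<and> f \<in> carrier (free_algebra G)"
  proof (rule poly_mapping_add_induct[where A = "{w. set (letters w) \<subseteq> G}" and f = f])
    fix w :: "'a free_word" and c assume w: "w \<in> {w. set (letters w) \<subseteq> G}"
    have eq: "Poly_Mapping.single w c = fscal c * Poly_Mapping.single w 1"
      by (simp add: fscal_def mult_single)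
    show "P (Poly_Mapping.single w c) \<and> Poly_Mapping.single w c \<in> carrier (free_algebra G)"
      unfolding eq using word[of "letters w"] w assms(4) by simp
  next
    show "supp f \<subseteq> {w. set (letters w) \<subseteq> G}"
      using assms(1) by (auto simp: free_algebra_carrier)
  qed (use assms(2,6) in auto)
  then show ?thesis by simp
qed

locale presentation =
  fixes G :: "'g set" and S :: "'g falg set"
  assumes relations_closed: "S \<subseteq> carrier (free_algebra G)"
begin

abbreviation "A \<equiv> presented_algebra G S"
abbreviation "cls \<equiv> presented_class G S"

sublocale fa: ring "free_algebra G" by (rule free_algebra_ring)

lemma relation_ideal: "ideal (relation_ideal G S) (free_algebra G)"
  unfolding relation_ideal_def by (rule fa.genideal_ideal[OF relations_closed])

lemma A_ring: "ring A"
  unfolding presented_algebra_def by (rule ideal.quotient_is_ring[OF relation_ideal])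

lemma cls_hom: "ring_hom_ring (free_algebra G) A cls"
proof -
  have "cls = (+>\<^bsub>free_algebra G\<^esub>) (relation_ideal G S)"
    by (rule ext) (simp add: presented_class_def)
  then show ?thesis
    unfolding presented_algebra_def by (simp add: ideal.rcos_ring_hom_ring[OF relation_ideal])
qed

lemma carrier_A: "carrier A = cls ` carrier (free_algebra G)"
  unfolding presented_algebra_def FactRing_def presented_class_def A_RCOSETS_def RCOSETS_def
    a_r_coset_def by auto

lemma cls_closed [simp, intro]: "f \<in> carrier (free_algebra G) \<Longrightarrow> cls f \<in> carrier A"
  by (simp add: carrier_A)

lemma cls_add: "\<lbrakk>f \<in> carrier (free_algebra G); g \<in> carrier (free_algebra G)\<rbrakk>
    \<Longrightarrow> cls (f + g) = cls f \<oplus>\<^bsub>A\<^esub> cls g"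
  using ring_hom_add[OF ring_hom_ring.homh[OF cls_hom]] by simp

lemma cls_mult: "\<lbrakk>f \<in> carrier (free_algebra G); g \<in> carrier (free_algebra G)\<rbrakk>
    \<Longrightarrow> cls (f * g) = cls f \<otimes>\<^bsub>A\<^esub> cls g"
  using ring_hom_mult[OF ring_hom_ring.homh[OF cls_hom]] by simp

lemma cls_one: "cls 1 = one A"
  using ring_hom_one[OF ring_hom_ring.homh[OF cls_hom]] by simp

lemma cls_zero: "cls 0 = zero A"
  using ring_hom_zero[OF ring_hom_ring.homh[OF cls_hom] fa.ring_axioms A_ring] by simp

lemma cls_power: "f \<in> carrier (free_algebra G) \<Longrightarrow> cls (f ^ k) = cls f [^]\<^bsub>A\<^esub> k"
proof (induction k)
  case 0
  then show ?case by (simp add: cls_one)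
next
  case (Suc k)
  interpret ring A by (rule A_ring)
  from Suc show ?case by (simp add: cls_mult power_Suc2 del: power_Suc)
qed

lemma cls_cong:
  assumes "f \<in> carrier (free_algebra G)" "g \<in> carrier (free_algebra G)" "f - g \<in> relation_ideal G S"
  shows "cls f = cls g"
proof -
  interpret I: ideal "relation_ideal G S" "free_algebra G" by (rule relation_ideal)
  have "f \<in> relation_ideal G S +>\<^bsub>free_algebra G\<^esub> g"
    using assms(3) unfolding a_r_coset_def r_coset_def by (simp add: bexI[of _ "f - g"])
  then show ?thesis
    using fa.a_repr_independence[OF _ assms(2) I.a_subgroup] unfolding presented_class_def by metis
qed

lemma cls_relation: "\<lbrakk>f - g \<in> S; f \<in> carrier (free_algebra G); g \<in> carrier (free_algebra G)\<rbrakk> \<Longrightarrow> cls f = cls g"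
  by (rule cls_cong) (use fa.genideal_self[OF relations_closed] in \<open>auto simp: relation_ideal_def\<close>)

lemma mem_cls: "f \<in> carrier (free_algebra G) \<Longrightarrow> f \<in> cls f"
proof -
  interpret I: ideal "relation_ideal G S" "free_algebra G" by (rule relation_ideal)
  assume "f \<in> carrier (free_algebra G)"
  then show ?thesis unfolding presented_class_def by (simp add: I.a_rcos_self)
qed

lemma cls_elim:
  assumes "f \<in> carrier (free_algebra G)" "g \<in> cls f"
  shows "g \<in> carrier (free_algebra G)" "g - f \<in> relation_ideal G S"
proof -
  obtain j where j: "j \<in> relation_ideal G S" "g = j + f"
    using assms(2) unfolding presented_class_def a_r_coset_def r_coset_def by auto
  then show "g - f \<in> relation_ideal G S" by simp
  have "j \<in> carrier (free_algebra G)" using j(1) ideal.Icarr[OF relation_ideal] by blast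
  then show "g \<in> carrier (free_algebra G)" using j(2) assms(1) by simp
qed

lemma cls_fscal_commute:
  "\<lbrakk>f \<in> carrier (free_algebra G)\<rbrakk> \<Longrightarrow> fscal c * f = f * fscal c"
proof (induction rule: free_algebra_induct)
  case (scal d f)
  have "fscal c * (fscal d * f) = fscal d * (fscal c * f)"
    by (simp add: mult.assoc[symmetric] fscal_mult[symmetric] mult.commute)
  then show ?case using scal by (simp add: mult.assoc)
next
  case (var x f)
  have "fscal c * fvar x = fvar x * fscal c"
    by (simp add: fscal_def fvar_def mult_single)
  then have "fscal c * (fvar x * f) = fvar x * (fscal c * f)"
    by (simp add: mult.assoc[symmetric])
  then show ?case using var by (simp add: mult.assoc)
qed (auto simp: distrib_left distrib_right)

end

section \<open>Left modules\<close>

lemma (in left_module) smult_l_null [simp]: "x \<in> carrier M \<Longrightarrow> \<zero>\<^bsub>R\<^esub> \<odot>\<^bsub>M\<^esub> x = \<zero>\<^bsub>M\<^esub>"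
proof -
  assume x: "x \<in> carrier M"
  have "\<zero>\<^bsub>R\<^esub> \<odot>\<^bsub>M\<^esub> x \<oplus>\<^bsub>M\<^esub> \<zero>\<^bsub>R\<^esub> \<odot>\<^bsub>M\<^esub> x = \<zero>\<^bsub>R\<^esub> \<odot>\<^bsub>M\<^esub> x"
    using smult_l_distr[OF R.zero_closed R.zero_closed x] by simp
  then show ?thesis using M.add.r_cancel_one smult_closed[OF R.zero_closed x] by metis
qed

lemma (in left_module) smult_r_null [simp]: "a \<in> carrier R \<Longrightarrow> a \<odot>\<^bsub>M\<^esub> \<zero>\<^bsub>M\<^esub> = \<zero>\<^bsub>M\<^esub>"
proof -
  assume a: "a \<in> carrier R"
  have "a \<odot>\<^bsub>M\<^esub> \<zero>\<^bsub>M\<^esub> \<oplus>\<^bsub>M\<^esub> a \<odot>\<^bsub>M\<^esub> \<zero>\<^bsub>M\<^esub> = a \<odot>\<^bsub>M\<^esub> \<zero>\<^bsub>M\<^esub>"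
    using smult_r_distr[OF a M.zero_closed M.zero_closed] by simp
  then show ?thesis using M.add.r_cancel_one smult_closed[OF a M.zero_closed] by metis
qed

lemma (in left_module) smult_finsum:
  assumes "a \<in> carrier R" "g \<in> K \<rightarrow> carrier M"
  shows "a \<odot>\<^bsub>M\<^esub> (\<Oplus>\<^bsub>M\<^esub>k\<in>K. g k) = (\<Oplus>\<^bsub>M\<^esub>k\<in>K. a \<odot>\<^bsub>M\<^esub> g k)"
  using assms(2)
proof (induction K rule: infinite_finite_induct)
  case (insert k K)
  then have "g \<in> K \<rightarrow> carrier M" "g k \<in> carrier M" by auto
  then show ?case
    using insert assms(1)
    by (subst (1 2) M.finsum_insert) (auto simp: smult_closed smult_r_distr M.finsum_closed Pi_iff)
qed (simp_all add: assms(1) M.finsum_infinite)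

section \<open>The horizontal homomorphism\<close>

lemma falg_map_superset:
  assumes "finite K" "supp f \<subseteq> K"
  shows "falg_map g f =
    (\<Sum>w\<in>K. Poly_Mapping.single (Word (map g (letters w))) (coef f w))"
  unfolding falg_map_def by (rule sum.mono_neutral_left) (use assms in \<open>auto simp: in_keys_iff\<close>)

lemma falg_map_add: "falg_map g (f + h) = falg_map g f + falg_map g h"
proof -
  let ?K = "supp f \<union> supp h"
  have "falg_map g (f + h) = (\<Sum>w\<in>?K. Poly_Mapping.single (Word (map g (letters w)))
      (coef (f + h) w))"
    by (rule falg_map_superset) (use keys_add[of f h] in auto)
  then show ?thesis
    by (simp add: falg_map_superset[of ?K f] falg_map_superset[of ?K h] lookup_add single_add
        sum.distrib)
qed

lemma falg_map_zero [simp]: "falg_map g 0 = 0"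
  by (simp add: falg_map_def)

lemma falg_map_uminus: "falg_map g (- f) = - falg_map g f"
  using falg_map_add[of g "- f" f] by (simp add: eq_neg_iff_add_eq_0)

lemma falg_map_diff: "falg_map g (f - h) = falg_map g f - falg_map g h"
  using falg_map_add[of g f "- h"] by (simp add: falg_map_uminus)

lemma falg_map_sum: "falg_map g (sum f K) = (\<Sum>k\<in>K. falg_map g (f k))"
  by (induction K rule: infinite_finite_induct) (auto simp: falg_map_add)

lemma falg_map_single:
  "falg_map g (Poly_Mapping.single w c) = Poly_Mapping.single (Word (map g (letters w))) c"
  by (simp add: falg_map_def)

lemma falg_map_mult:
  fixes f h :: "'a falg"
  shows "falg_map g (f * h) = falg_map g f * falg_map g h"
proof (rule poly_mapping_add_induct[where A = UNIV and f = f])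
  fix w :: "'a free_word" and c :: complex
  show "falg_map g (Poly_Mapping.single w c * h) = falg_map g (Poly_Mapping.single w c) * falg_map g h"
  proof (rule poly_mapping_add_induct[where A = UNIV and f = h])
    fix w' :: "'a free_word" and c' :: complex
    show "falg_map g (Poly_Mapping.single w c * Poly_Mapping.single w' c') =
        falg_map g (Poly_Mapping.single w c) * falg_map g (Poly_Mapping.single w' c')"
      by (simp add: mult_single falg_map_single plus_free_word_def)
  qed (simp_all add: distrib_left falg_map_add)
qed (simp_all add: distrib_right falg_map_add)

lemma falg_map_fscal [simp]: "falg_map g (fscal c) = fscal c"
  by (simp add: fscal_def falg_map_single zero_free_word_def[symmetric])

lemma falg_map_fvar [simp]: "falg_map g (fvar x) = fvar (g x)"
  by (simp add: fvar_def falg_map_single)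

lemma falg_map_one [simp]: "falg_map g 1 = 1"
  using falg_map_fscal[of g 1] by simp

lemma falg_map_power: "falg_map g (f ^ k) = falg_map g f ^ k"
  by (induction k) (auto simp: falg_map_mult)

lemmas falg_map_hom = falg_map_add falg_map_diff falg_map_sum falg_map_mult falg_map_power
  falg_map_uminus

lemma falg_map_closed:
  assumes "f \<in> carrier (free_algebra G)" "g ` G \<subseteq> G'"
  shows "falg_map g f \<in> carrier (free_algebra G')"
  using assms(1) by (induction rule: free_algebra_induct) (use assms(2) in \<open>auto simp: falg_map_hom\<close>)

lemma cartan_space_simps [simp, intro]:
  "0 \<in> cartan_space n"
  "i \<le> n \<Longrightarrow> coroot i \<in> cartan_space n"
  "\<lbrakk>h \<in> cartan_space n; h' \<in> cartan_space n\<rbrakk> \<Longrightarrow> h + h' \<in> cartan_space n"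
  "h \<in> cartan_space n \<Longrightarrow> - h \<in> cartan_space n"
  using keys_add[of h h']
  by (auto simp: cartan_space_def coroot_def cartan_indices_def in_keys_iff)

lemma tor_gens_simps [simp]:
  "TX p i a \<in> tor_gens n \<longleftrightarrow> i \<le> n" "TK h \<in> tor_gens n \<longleftrightarrow> h \<in> cartan_space n"
  "TH i m \<in> tor_gens n \<longleftrightarrow> i \<le> n \<and> m \<noteq> 0"
  by (auto simp: tor_gens_def)

lemma aff_gens_simps [simp]:
  "AX p i \<in> aff_gens n \<longleftrightarrow> i \<le> n" "AK h \<in> aff_gens n \<longleftrightarrow> h \<in> cartan_space n"
  by (auto simp: aff_gens_def)

lemma aff_relations_closed: "aff_relations n t \<subseteq> carrier (free_algebra (aff_gens n))"
proof
  fix x assume "x \<in> aff_relations n t"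
  then show "x \<in> carrier (free_algebra (aff_gens n))"
    by cases (auto intro!: fa_sum fa_mult fa_power fa_diff)
qed

lemma fps_power_closed:
  fixes a :: "'g falg fps"
  assumes "\<And>m. fps_nth a m \<in> carrier (free_algebra G)"
  shows "fps_nth (a ^ k) m \<in> carrier (free_algebra G)"
  by (induction k arbitrary: m) (auto simp: fps_mult_nth assms intro!: fa_sum)

lemma tor_phi_closed [simp, intro]:
  assumes "i \<le> n" shows "tor_phi t p i m \<in> carrier (free_algebra (tor_gens n))"
proof -
  have "fps_nth (fps_exponential a) k \<in> carrier (free_algebra G)"
    if "\<And>m. fps_nth a m \<in> carrier (free_algebra G)" for a :: "tor_gen falg fps" and G k
    unfolding fps_exponential_def by (auto intro!: fa_sum fa_mult fps_power_closed that)
  moreover have "dsgn p \<noteq> 0" by (cases p) auto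
  ultimately show ?thesis
    unfolding tor_phi_def using assms by auto
qed

lemma tor_serre_closed [simp, intro]:
  "\<lbrakk>i \<le> n; j \<le> n\<rbrakk> \<Longrightarrow> tor_serre t p i j a b c \<in> carrier (free_algebra (tor_gens n))"
  unfolding tor_serre_def by auto

lemma tor_relations_closed: "tor_relations n t \<subseteq> carrier (free_algebra (tor_gens n))"
proof
  fix x assume "x \<in> tor_relations n t"
  then show "x \<in> carrier (free_algebra (tor_gens n))"
    by cases (auto intro!: fa_sum fa_mult fa_power fa_diff)
qed

lemma tor_phi_0:
  "tor_phi t p i 0 = fvar (TK (if p = Raising then coroot i else - coroot i))"
  by (simp add: tor_phi_def fps_exponential_def)

lemma mod_succ: "(i::nat) \<le> n \<Longrightarrow> (i + 1) mod (n + 1) = (if i = n then 0 else i + 1)"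
  by (cases "i = n") (simp_all add: mod_less)

lemma mod_pred:
  assumes "(i::nat) \<le> n" shows "(i + n) mod (n + 1) = (if i = 0 then n else i - 1)"
proof (cases "i = 0")
  case False
  with assms have "i + n = (i - 1) + (n + 1)" "i - 1 < n + 1" by linarith+
  then show ?thesis using False by (metis mod_add_self2 mod_less)
qed auto

lemma cartan_matrix_cases:
  assumes "i \<le> n" "j \<le> n"
  shows "cartan_matrix n i j = (if i = j then 2
     else if j = (i + 1) mod (n + 1) \<or> j = (i + n) mod (n + 1) then -1 else 0)"
  unfolding cartan_matrix_def mod_succ[OF assms(1)] mod_succ[OF assms(2)] mod_pred[OF assms(1)]
  using assms by auto

locale affine_data =
  fixes n :: nat and t :: complex
  assumes n3: "3 \<le> n" and generic: "\<And>k::nat. k > 0 \<Longrightarrow> exp t ^ k \<noteq> 1"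
begin

sublocale aff: presentation "aff_gens n" "aff_relations n t"
  by standard (rule aff_relations_closed)

sublocale tor: presentation "tor_gens n" "tor_relations n t"
  by standard (rule tor_relations_closed)

abbreviation "TA \<equiv> presented_algebra (tor_gens n) (tor_relations n t)"

lemma qpow_add: "qpow t (x + y) = qpow t x * qpow t y"
  by (simp add: qpow_def of_rat_add distrib_left exp_add)

lemma qpow_0 [simp]: "qpow t 0 = 1" by (simp add: qpow_def)

lemma qpow_nonzero [simp]: "qpow t x \<noteq> 0" by (simp add: qpow_def)

text \<open>
  If \<open>q\<close> to the power \<open>a / b\<close> equals 1, then so does \<open>q\<close> to the integral power \<open>a\<close>.
\<close>

lemma qpow_eq_1_iff: "qpow t x = 1 \<longleftrightarrow> x = 0"
proof
  assume "qpow t x = 1"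
  obtain a b where ab: "quotient_of x = (a, b)" by (cases "quotient_of x")
  have b: "b > 0" and x: "x = of_int a / of_int b"
    using quotient_of_denom_pos[OF ab] quotient_of_div[OF ab] by auto
  have "(of_rat x :: complex) * of_int b = of_int a" using b x by (simp add: of_rat_divide)
  then have "exp t powi a = qpow t x ^ nat b"
    using b unfolding qpow_def
    by (simp add: exp_of_nat_mult[symmetric] exp_power_int mult.commute mult.left_commute)
  then have e: "exp t powi a = 1" using \<open>qpow t x = 1\<close> by simp
  have "exp t ^ nat \<bar>a\<bar> = 1"
    using e by (cases "a \<ge> 0") (auto simp: power_int_def power_inverse)
  then have "a = 0" using generic[of "nat \<bar>a\<bar>"] by fastforce
  then show "x = 0" using x by simp
qed simp

lemma qpow_inj: "qpow t x = qpow t y \<longleftrightarrow> x = y"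
proof -
  have "qpow t x = qpow t (x - y) * qpow t y" by (simp add: qpow_add[symmetric])
  then show ?thesis using qpow_eq_1_iff[of "x - y"] by auto
qed

lemma qint_1 [simp]: "qint t 1 = 1"
  using qpow_inj[of 1 "-1"] by (simp add: qint_def)

lemma qint_2: "qint t 2 = qpow t 1 + qpow t (- 1)"
proof -
  have "qpow t 2 = qpow t 1 * qpow t 1" "qpow t (-2) = qpow t (-1) * qpow t (-1)"
    by (simp_all add: qpow_add[symmetric])
  then have "qpow t 2 - qpow t (-2) = (qpow t 1 + qpow t (- 1)) * (qpow t 1 - qpow t (- 1))"
    by (simp add: algebra_simps)
  then show ?thesis using qpow_inj[of 1 "-1"] by (simp add: qint_def)
qed

lemma qint_2_nonzero: "qpow t 1 + qpow t (- 1) \<noteq> 0"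
proof
  assume "qpow t 1 + qpow t (- 1) = 0"
  then have "qpow t 1 * (qpow t 1 + qpow t (- 1)) = 0" by simp
  then have "qpow t 2 = -1" by (simp add: distrib_left qpow_add[symmetric] eq_neg_iff_add_eq_0)
  then have "qpow t 4 = 1" using qpow_add[of 2 2] by simp
  then show False using qpow_eq_1_iff[of 4] by simp
qed

lemma qfact_simps [simp]: "qfact t 0 = 1" "qfact t (Suc 0) = 1"
  "qfact t 2 = qpow t 1 + qpow t (- 1)"
proof -
  have "{1..2::nat} = {1, 2}" by auto
  then show "qfact t 2 = qpow t 1 + qpow t (- 1)" by (simp add: qfact_def qint_2)
qed (simp_all add: qfact_def)

abbreviation "hor \<equiv> falg_map horizontal_gen"

lemma hor_closed: "f \<in> carrier (free_algebra (aff_gens n)) \<Longrightarrow> hor f \<in> carrier (free_algebra (tor_gens n))"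
  by (erule falg_map_closed) (auto simp: aff_gens_def)

lemma tor_relation_zero: "x \<in> tor_relations n t \<Longrightarrow> tor.cls x = zero TA"
  using tor.cls_relation[of x 0] tor_relations_closed by (auto simp: tor.cls_zero)

text \<open>
  The Serre relation with divided powers is the symmetrised one at \<open>r\<^sub>1 = r\<^sub>2 = 0\<close>, divided by twice
  the quantum number of 2. The latter does not vanish, since a zero would make \<open>q\<close> a fourth root of
  unity.
\<close>

lemma hor_serre_2:
  "(\<Sum>k\<le>2. fscal ((-1) ^ k / (qfact t (2 - k) * qfact t k)) *
       fvar (TX p i 0) ^ (2 - k) * fvar (TX p j 0) * fvar (TX p i 0) ^ k)
   = fscal (1 / (2 * (qpow t 1 + qpow t (- 1)))) *
     (tor_serre t p i j 0 0 0 + tor_serre t p i j 0 0 0)"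
proof -
  let ?c = "qpow t 1 + qpow t (- 1)"
  let ?x = "fvar (TX p i 0)" and ?y = "fvar (TX p j 0)"
  have set: "{..2::nat} = {0, 1, 2}" by auto
  have two: "tor_serre t p i j 0 0 0 + tor_serre t p i j 0 0 0 = fscal 2 * tor_serre t p i j 0 0 0"
  proof -
    have "fscal 2 = (2 :: tor_gen falg)" using fscal_add[of 1 1] by simp
    then show ?thesis by (simp only: mult_2)
  qed
  have "fscal (1 / (2 * ?c)) * (fscal 2 * tor_serre t p i j 0 0 0) = fscal (1 / ?c) * tor_serre t p i j 0 0 0"
  proof -
    have "1 / (2 * z) * 2 = 1 / z" for z :: complex by simp
    then have "1 / (2 * ?c) * 2 = 1 / ?c" .
    then show ?thesis by (simp only: mult.assoc[symmetric] fscal_mult[symmetric])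
  qed
  also have "\<dots> = fscal (1 / ?c) * (?x * ?x * ?y) - fscal (1 / ?c) * fscal ?c * (?x * ?y * ?x)
      + fscal (1 / ?c) * (?y * ?x * ?x)"
    unfolding tor_serre_def by (simp add: distrib_left right_diff_distrib mult.assoc)
  also have "fscal (1 / ?c) * fscal ?c = 1"
    using qint_2_nonzero by (simp add: fscal_mult[symmetric])
  finally show ?thesis
    unfolding two set by (simp add: power2_eq_square mult.assoc fscal_uminus)
qed

lemma hor_relation:
  assumes "x \<in> aff_relations n t"
  shows "tor.cls (hor x) = zero TA"
  using assms
proof cases
  case (aff_k_add h h')
  then have "hor x \<in> tor_relations n t" by (simp add: falg_map_hom tor_k_add)
  then show ?thesis by (rule tor_relation_zero)
next
  case aff_k_zero
  then have "hor x \<in> tor_relations n t" by (simp add: falg_map_hom tor_k_zero)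
  then show ?thesis by (rule tor_relation_zero)
next
  case (aff_kx h j p)
  then have "hor x \<in> tor_relations n t" by (simp add: falg_map_hom tor_kx)
  then show ?thesis by (rule tor_relation_zero)
next
  case (aff_xx i j)
  then have "hor x \<in> tor_relations n t"
    using tor_xx[where t = t and i = i and n = n and j = j and a = 0 and b = 0] by (auto simp: falg_map_hom tor_phi_0)
  then show ?thesis by (rule tor_relation_zero)
next
  case (aff_serre i j N p)
  interpret T: ring TA by (rule tor.A_ring)
  show ?thesis
  proof (cases "j = (i + 1) mod (n + 1) \<or> j = (i + n) mod (n + 1)")
    case True
    then have N: "N = 2" using aff_serre by (simp add: cartan_matrix_cases)
    have "tor.cls (tor_serre t p i j 0 0 0 + tor_serre t p i j 0 0 0) = zero TA"
      using tor_relation_zero[OF tor_relations.tor_serre[OF aff_serre(2,3) True]] .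
    moreover have "hor x = fscal (1 / (2 * (qpow t 1 + qpow t (- 1)))) *
     (tor_serre t p i j 0 0 0 + tor_serre t p i j 0 0 0)"
      unfolding aff_serre(1) N hor_serre_2[symmetric] by (simp add: falg_map_hom)
    ultimately show ?thesis
      using aff_serre(2,3) T.r_null[OF tor.cls_closed[OF fa_fscal]]
      by (simp add: tor.cls_mult)
  next
    case False
    then have N: "N = 1" using aff_serre by (simp add: cartan_matrix_cases)
    have "i \<noteq> (j + 1) mod (n + 1)" "i \<noteq> (j + n) mod (n + 1)"
      using False aff_serre(2,3)
      unfolding mod_succ[OF aff_serre(2)] mod_succ[OF aff_serre(3)] mod_pred[OF aff_serre(2)]
        mod_pred[OF aff_serre(3)]
      by (auto split: if_splits)
    then have "tor.cls (fX p i 0 * fX p j 0 - fX p j 0 * fX p i 0) = zero TA"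
      using tor_relation_zero[OF tor_far[OF aff_serre(2,3,4)]] by blast
    moreover have "hor x = fX p i 0 * fX p j 0 - fX p j 0 * fX p i 0"
      unfolding aff_serre(1) N by (simp add: falg_map_hom fscal_uminus)
    ultimately show ?thesis by simp
  qed
qed

lemma hor_hom: "ring_hom_ring (free_algebra (aff_gens n)) TA
    (\<lambda>f. tor.cls (hor f))"
  by (rule ring_hom_ringI2[OF aff.fa.ring_axioms tor.A_ring], rule ring_hom_memI)
     (auto simp: hor_closed falg_map_hom tor.cls_add tor.cls_mult tor.cls_one)

lemma hor_ideal:
  assumes "f \<in> relation_ideal (aff_gens n) (aff_relations n t)"
  shows "tor.cls (hor f) = zero TA"
proof -
  interpret h: ring_hom_ring "free_algebra (aff_gens n)" TA
    "\<lambda>f. tor.cls (hor f)" by (rule hor_hom)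
  let ?K = "a_kernel (free_algebra (aff_gens n)) TA (\<lambda>f. tor.cls (hor f))"
  have "x \<in> ?K" if "x \<in> aff_relations n t" for x
    unfolding a_kernel_def' using hor_relation[OF that] that aff_relations_closed[of n t] by blast
  then have "relation_ideal (aff_gens n) (aff_relations n t) \<subseteq> ?K"
    unfolding relation_ideal_def by (intro aff.fa.genideal_minimal[OF h.kernel_is_ideal] subsetI)
  then have "f \<in> ?K" using assms by blast
  then show ?thesis unfolding a_kernel_def' by blast
qed

lemma horizontal_map_class:
  assumes f: "f \<in> carrier (free_algebra (aff_gens n))"
  shows "horizontal_map n t (aff_class n t f) = tor_class n t (hor f)"
proof -
  interpret T: ring TA by (rule tor.A_ring)
  have "tor_class n t (hor g) = tor_class n t (hor f)" if "g \<in> aff_class n t f" for g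
  proof -
    have g: "g \<in> carrier (free_algebra (aff_gens n))" "g - f \<in> relation_ideal (aff_gens n) (aff_relations n t)"
      using aff.cls_elim[OF f] that by (auto simp: aff_class_def)
    have "tor.cls (hor g) = tor.cls (hor (g - f) + hor f)" by (simp add: falg_map_hom)
    also have "\<dots> = tor.cls (hor f)"
      using hor_ideal[OF g(2)] g(1) f T.l_zero[OF tor.cls_closed[OF hor_closed[OF f]]]
      by (simp add: tor.cls_add hor_closed)
    finally show ?thesis by (simp add: tor_class_def)
  qed
  moreover have "f \<in> aff_class n t f" using aff.mem_cls[OF f] by (simp add: aff_class_def)
  ultimately show ?thesis unfolding horizontal_map_def by blast
qed

lemma horizontal_hom: "ring_hom_ring (Uaff n t) (Utor n t) (horizontal_map n t)"
proof (rule ring_hom_ringI2)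
  show "ring (Uaff n t)" "ring (Utor n t)"
    unfolding Uaff_def Utor_def by (rule aff.A_ring tor.A_ring)+
  have rep: "\<exists>f\<in>carrier (free_algebra (aff_gens n)). a = aff_class n t f" if "a \<in> carrier (Uaff n t)" for a
    using that unfolding Uaff_def aff.carrier_A aff_class_def by auto
  note c = aff.cls_add aff.cls_mult tor.cls_add tor.cls_mult aff.cls_one tor.cls_one
  note c' = c[folded Uaff_def Utor_def aff_class_def tor_class_def]
  show "horizontal_map n t \<in> ring_hom (Uaff n t) (Utor n t)"
  proof (rule ring_hom_memI)
    show "horizontal_map n t x \<in> carrier (Utor n t)" if "x \<in> carrier (Uaff n t)" for x
      using rep[OF that] by (auto simp: horizontal_map_class hor_closed Utor_def tor_class_def)
    show "horizontal_map n t (x \<otimes>\<^bsub>Uaff n t\<^esub> y) = horizontal_map n t x \<otimes>\<^bsub>Utor n t\<^esub> horizontal_map n t y"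
      if "x \<in> carrier (Uaff n t)" "y \<in> carrier (Uaff n t)" for x y
      using rep[OF that(1)] rep[OF that(2)]
      by (auto simp: c'[symmetric] horizontal_map_class hor_closed falg_map_hom)
    show "horizontal_map n t (x \<oplus>\<^bsub>Uaff n t\<^esub> y) = horizontal_map n t x \<oplus>\<^bsub>Utor n t\<^esub> horizontal_map n t y"
      if "x \<in> carrier (Uaff n t)" "y \<in> carrier (Uaff n t)" for x y
      using rep[OF that(1)] rep[OF that(2)]
      by (auto simp: c'[symmetric] horizontal_map_class hor_closed falg_map_hom)
    show "horizontal_map n t \<one>\<^bsub>Uaff n t\<^esub> = \<one>\<^bsub>Utor n t\<^esub>"
      by (simp add: c'[symmetric] horizontal_map_class)
  qed
qed

end

section \<open>Modules over the quantum affine algebra\<close>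

context affine_data
begin

lemma U_ring: "ring (Uaff n t)" unfolding Uaff_def by (rule aff.A_ring)

lemmas U_cls_closed [simp, intro] = aff.cls_closed[folded Uaff_def aff_class_def]
lemmas U_cls_add = aff.cls_add[folded Uaff_def aff_class_def]
lemmas U_cls_mult = aff.cls_mult[folded Uaff_def aff_class_def]
lemmas U_cls_one = aff.cls_one[folded Uaff_def aff_class_def]
lemmas U_cls_zero = aff.cls_zero[folded Uaff_def aff_class_def]
lemmas U_cls_power = aff.cls_power[folded Uaff_def aff_class_def]
lemmas U_relation = aff.cls_relation[folded Uaff_def aff_class_def]
lemmas U_carrier = aff.carrier_A[folded Uaff_def aff_class_def]

abbreviation "FA \<equiv> carrier (free_algebra (aff_gens n))"

end

locale affine_module = affine_data n t + left_module "Uaff n t" M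
  for n t and M :: "(aff_gen falg set, 'v) module"
begin

definition "act f x = aff_class n t f \<odot>\<^bsub>M\<^esub> x"
definition "scal a x = aff_class n t (fscal a) \<odot>\<^bsub>M\<^esub> x"

definition lin :: "('b \<Rightarrow> 'v) \<Rightarrow> ('b \<Rightarrow>\<^sub>0 complex) \<Rightarrow> 'v" where
  "lin y c = (\<Oplus>\<^bsub>M\<^esub>b\<in>supp c. scal (coef c b) (y b))"

lemma act_closed [simp, intro]: "\<lbrakk>f \<in> FA; x \<in> carrier M\<rbrakk> \<Longrightarrow> act f x \<in> carrier M"
  by (simp add: act_def smult_closed)

lemma act_mult: "\<lbrakk>f \<in> FA; g \<in> FA; x \<in> carrier M\<rbrakk> \<Longrightarrow> act (f * g) x = act f (act g x)"
  by (simp add: act_def U_cls_mult smult_assoc1)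

lemma act_add: "\<lbrakk>f \<in> FA; g \<in> FA; x \<in> carrier M\<rbrakk> \<Longrightarrow> act (f + g) x = act f x \<oplus>\<^bsub>M\<^esub> act g x"
  by (simp add: act_def U_cls_add smult_l_distr)

lemma act_distr: "\<lbrakk>f \<in> FA; x \<in> carrier M; y \<in> carrier M\<rbrakk> \<Longrightarrow> act f (x \<oplus>\<^bsub>M\<^esub> y) = act f x \<oplus>\<^bsub>M\<^esub> act f y"
  by (simp add: act_def smult_r_distr)

lemma act_one [simp]: "x \<in> carrier M \<Longrightarrow> act 1 x = x"
  by (simp add: act_def U_cls_one smult_one)

lemma act_zero [simp]: "x \<in> carrier M \<Longrightarrow> act 0 x = \<zero>\<^bsub>M\<^esub>"
  by (simp add: act_def U_cls_zero)

lemma act_null [simp]: "f \<in> FA \<Longrightarrow> act f \<zero>\<^bsub>M\<^esub> = \<zero>\<^bsub>M\<^esub>"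
  by (simp add: act_def)

lemma act_scal: "act (fscal a) x = scal a x"
  by (simp add: act_def scal_def)

lemma scal_closed [simp, intro]: "x \<in> carrier M \<Longrightarrow> scal a x \<in> carrier M"
  using act_closed[OF fa_fscal] by (simp add: act_scal)

lemma scal_add: "x \<in> carrier M \<Longrightarrow> scal (a + b) x = scal a x \<oplus>\<^bsub>M\<^esub> scal b x"
  using act_add[OF fa_fscal fa_fscal] by (simp add: act_scal[symmetric] fscal_add)

lemma scal_mult: "x \<in> carrier M \<Longrightarrow> scal (a * b) x = scal a (scal b x)"
  using act_mult[OF fa_fscal fa_fscal] by (simp add: act_scal[symmetric] fscal_mult)

lemma scal_one [simp]: "x \<in> carrier M \<Longrightarrow> scal 1 x = x"
  by (simp add: act_scal[symmetric])

lemma scal_0 [simp]: "x \<in> carrier M \<Longrightarrow> scal 0 x = \<zero>\<^bsub>M\<^esub>"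
  by (simp add: act_scal[symmetric])

lemma scal_null [simp]: "scal a \<zero>\<^bsub>M\<^esub> = \<zero>\<^bsub>M\<^esub>"
  by (simp add: act_scal[symmetric])

lemma act_scal_commute: "\<lbrakk>f \<in> FA; x \<in> carrier M\<rbrakk> \<Longrightarrow> act f (scal a x) = scal a (act f x)"
  using aff.cls_fscal_commute[of f a] by (simp add: act_scal[symmetric] act_mult[symmetric])

lemma act_finsum:
  "\<lbrakk>f \<in> FA; g \<in> K \<rightarrow> carrier M\<rbrakk> \<Longrightarrow> act f (\<Oplus>\<^bsub>M\<^esub>k\<in>K. g k) = (\<Oplus>\<^bsub>M\<^esub>k\<in>K. act f (g k))"
  by (simp add: act_def smult_finsum)

lemma lin_superset:
  assumes "finite K" "supp c \<subseteq> K" "y ` K \<subseteq> carrier M"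
  shows "lin y c = (\<Oplus>\<^bsub>M\<^esub>b\<in>K. scal (coef c b) (y b))"
  unfolding lin_def
  by (rule M.add.finprod_mono_neutral_cong_left)
    (use assms in \<open>auto simp: in_keys_iff Pi_iff image_subset_iff\<close>)

lemma lin_closed [intro]: "y ` supp c \<subseteq> carrier M \<Longrightarrow> lin y c \<in> carrier M"
  unfolding lin_def by (rule M.finsum_closed) auto

lemma lin_zero [simp]: "lin y 0 = \<zero>\<^bsub>M\<^esub>"
  by (simp add: lin_def)

lemma lin_single [simp]: "y b \<in> carrier M \<Longrightarrow> lin y (Poly_Mapping.single b a) = scal a (y b)"
  using lin_superset[of "{b}" "Poly_Mapping.single b a" y] by (auto simp: M.finsum_singleton)

lemma lin_add:
  assumes "y ` supp c \<subseteq> carrier M" "y ` supp d \<subseteq> carrier M"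
  shows "lin y (c + d) = lin y c \<oplus>\<^bsub>M\<^esub> lin y d"
proof -
  let ?K = "supp c \<union> supp d"
  have K: "finite ?K" "y ` ?K \<subseteq> carrier M" using assms by auto
  have "lin y (c + d) = (\<Oplus>\<^bsub>M\<^esub>b\<in>?K. scal (coef c b) (y b) \<oplus>\<^bsub>M\<^esub> scal (coef d b) (y b))"
    using K keys_add[of c d]
    by (subst lin_superset[of ?K]) (auto simp: lookup_add scal_add intro!: M.finsum_cong')
  also have "\<dots> = (\<Oplus>\<^bsub>M\<^esub>b\<in>?K. scal (coef c b) (y b)) \<oplus>\<^bsub>M\<^esub> (\<Oplus>\<^bsub>M\<^esub>b\<in>?K. scal (coef d b) (y b))"
    using K by (intro M.finsum_addf) auto
  also have "\<dots> = lin y c \<oplus>\<^bsub>M\<^esub> lin y d"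
    using K by (subst (1 2) lin_superset[of ?K, symmetric]) auto
  finally show ?thesis .
qed

text \<open>
  Used for the Cartan elements and for scalars, and, with vanishing eigenvalues, for nilpotency.
\<close>

lemma act_lin_diagonal:
  assumes "f \<in> FA" "y ` supp c \<subseteq> carrier M"
    and "\<And>b. b \<in> supp c \<Longrightarrow> act f (y b) = scal (g b) (y b)"
  shows "act f (lin y c) = lin y (Poly_Mapping.mapp (\<lambda>b a. g b * a) c)"
proof -
  have y: "y b \<in> carrier M" if "b \<in> supp c" for b using assms(2) that by auto
  have "lin y (Poly_Mapping.mapp (\<lambda>b a. g b * a) c) =
      (\<Oplus>\<^bsub>M\<^esub>b\<in>supp c. scal (coef (Poly_Mapping.mapp (\<lambda>b a. g b * a) c) b) (y b))"
    by (rule lin_superset) (use assms(2) in \<open>auto simp: keys_mapp_subset\<close>)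
  also have "\<dots> = (\<Oplus>\<^bsub>M\<^esub>b\<in>supp c. act f (scal (coef c b) (y b)))"
    by (rule M.finsum_cong')
      (auto simp: lookup_mapp y assms act_scal_commute scal_mult[symmetric] mult.commute
        intro!: act_closed)
  also have "\<dots> = act f (lin y c)"
    unfolding lin_def using assms(1) y by (subst act_finsum) auto
  finally show ?thesis by simp
qed

end

definition opt_vec :: "('a, 'v) module \<Rightarrow> ('b \<Rightarrow> 'v) \<Rightarrow> 'b option \<Rightarrow> 'v" where
  "opt_vec M y x = (case x of None \<Rightarrow> \<zero>\<^bsub>M\<^esub> | Some b \<Rightarrow> y b)"

lemma opt_vec_simps [simp]: "opt_vec M y None = \<zero>\<^bsub>M\<^esub>" "opt_vec M y (Some b) = y b"
  by (simp_all add: opt_vec_def)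

text \<open>
  Vectors on which the generators act by the crystal operators. They need be neither linearly
  independent nor generating: in an arbitrary module the companions of an extremal vector will form
  such a family.
\<close>

locale crystal_family = affine_module n t M
  for n t and M :: "(aff_gen falg set, 'v) module" +
  fixes B :: "ymonomial set" and y :: "ymonomial \<Rightarrow> 'v"
  assumes y_closed: "b \<in> B \<Longrightarrow> y b \<in> carrier M"
    and K_act: "\<lbrakk>b \<in> B; h \<in> cartan_space n\<rbrakk> \<Longrightarrow>
      act (fvar (AK h)) (y b) = scal (qpow t (pairing (ywt b) h)) (y b)"
    and E_act: "\<lbrakk>b \<in> B; i \<le> n\<rbrakk> \<Longrightarrow> act (fvar (AX Raising i)) (y b) = opt_vec M y (crystal_e n i b)"
    and F_act: "\<lbrakk>b \<in> B; i \<le> n\<rbrakk> \<Longrightarrow> act (fvar (AX Lowering i)) (y b) = opt_vec M y (crystal_f n i b)"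
begin

lemma y_sub: "supp c \<subseteq> B \<Longrightarrow> y ` supp c \<subseteq> carrier M"
  using y_closed by auto

lemma lin_closed_B [simp, intro]: "supp c \<subseteq> B \<Longrightarrow> lin y c \<in> carrier M"
  by (rule lin_closed[OF y_sub])

lemma lin_add_B: "\<lbrakk>supp c \<subseteq> B; supp d \<subseteq> B\<rbrakk> \<Longrightarrow>
    lin y (c + d) = lin y c \<oplus>\<^bsub>M\<^esub> lin y d"
  by (rule lin_add[OF y_sub y_sub])

end

locale crystal_set =
  fixes n :: nat and B :: "ymonomial set"
  assumes e_closed: "\<lbrakk>b \<in> B; i \<le> n; crystal_e n i b = Some b'\<rbrakk> \<Longrightarrow> b' \<in> B"
    and f_closed: "\<lbrakk>b \<in> B; i \<le> n; crystal_f n i b = Some b'\<rbrakk> \<Longrightarrow> b' \<in> B"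

lemma keys_add_subset: "\<lbrakk>supp c \<subseteq> B; supp d \<subseteq> B\<rbrakk> \<Longrightarrow> supp (c + d) \<subseteq> B"
  using keys_add[of c d] by auto

lemma keys_single_subset: "b \<in> B \<Longrightarrow> supp (Poly_Mapping.single b a) \<subseteq> B"
  by auto

text \<open>
  The pairs of combinations with equal coefficients form a submodule of the direct sum of the two
  modules, because the matrices of the generators coincide; it contains the pair of base vectors.
\<close>

lemma crystal_families_parallel:
  assumes "crystal_set n B" "crystal_family n t M B y" "crystal_family n t M' B y'"
    and b0: "b0 \<in> B" and f: "f \<in> carrier (free_algebra (aff_gens n))"
  shows "\<exists>c. supp c \<subseteq> B \<and>
    aff_class n t f \<odot>\<^bsub>M\<^esub> y b0 = affine_module.lin n t M y c \<and>
    aff_class n t f \<odot>\<^bsub>M'\<^esub> y' b0 = affine_module.lin n t M' y' c"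
proof -
  interpret crystal_set n B by fact
  interpret V: crystal_family n t M B y by fact
  interpret W: crystal_family n t M' B y' by fact
  let ?par = "\<lambda>x x'. \<exists>c. supp c \<subseteq> B \<and> x = V.lin y c \<and> x' = W.lin y' c"
  have par_add: "?par (x \<oplus>\<^bsub>M\<^esub> z) (x' \<oplus>\<^bsub>M'\<^esub> z')" if p: "?par x x'" "?par z z'" for x x' z z'
  proof -
    obtain c d where "supp c \<subseteq> B" "supp d \<subseteq> B" "x = V.lin y c"
      "x' = W.lin y' c" "z = V.lin y d" "z' = W.lin y' d" using p by blast
    then show ?thesis
      by (intro exI[of _ "c + d"]) (simp add: V.lin_add_B W.lin_add_B keys_add_subset)
  qed
  have par_zero: "?par \<zero>\<^bsub>M\<^esub> \<zero>\<^bsub>M'\<^esub>" by (rule exI[of _ 0]) simp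
  have par_single: "?par (V.scal a (y b)) (W.scal a (y' b))" if "b \<in> B" for a b
    using that by (intro exI[of _ "Poly_Mapping.single b a"]) (auto simp: V.y_closed W.y_closed)
  have par_basis: "?par (y b) (y' b)" if "b \<in> B" for b
    using par_single[OF that, of 1] that by (simp add: V.y_closed W.y_closed)
  have par_opt: "?par (opt_vec M y x) (opt_vec M' y' x)" if "\<And>b. x = Some b \<Longrightarrow> b \<in> B" for x
  proof (cases x)
    case None
    then show ?thesis using par_zero by (simp only: opt_vec_simps)
  next
    case (Some b)
    then show ?thesis using par_basis[OF that[OF Some]] by (simp only: opt_vec_simps)
  qed
  have par_gen: "?par (V.act g (y b)) (W.act g (y' b))"
    if g: "(\<exists>x\<in>aff_gens n. g = fvar x) \<or> (\<exists>a. g = fscal a)" and b: "b \<in> B" for g b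
  proof (cases "\<exists>a. g = fscal a")
    case True
    then show ?thesis using par_single[OF b] V.act_scal W.act_scal by fastforce
  next
    case False
    then obtain x where x: "x \<in> aff_gens n" "g = fvar x" using g by blast
    show ?thesis
    proof (cases x)
      case (AX p i)
      then have i: "i \<le> n" using x by simp
      show ?thesis
      proof (cases p)
        case Raising
        show ?thesis unfolding x(2) AX Raising V.E_act[OF b i] W.E_act[OF b i]
          by (rule par_opt) (rule e_closed[OF b i])
      next
        case Lowering
        show ?thesis unfolding x(2) AX Lowering V.F_act[OF b i] W.F_act[OF b i]
          by (rule par_opt) (rule f_closed[OF b i])
      qed
    next
      case (AK h)
      then have h: "h \<in> cartan_space n" using x by simp
      show ?thesis unfolding x(2) AK V.K_act[OF b h] W.K_act[OF b h] by (rule par_single[OF b])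
    qed
  qed
  have par_act: "?par (V.act g x) (W.act g x')"
    if g: "(\<exists>x\<in>aff_gens n. g = fvar x) \<or> (\<exists>a. g = fscal a)" and p: "?par x x'" for g x x'
  proof -
    have gF: "g \<in> V.FA" using g by auto
    have "supp c \<subseteq> B \<and> ?par (V.act g (V.lin y c)) (W.act g (W.lin y' c))"
      if "supp c \<subseteq> B" for c
    proof (rule poly_mapping_add_induct[OF _ _ _ that])
      have "?par (V.act g (V.lin y 0)) (W.act g (W.lin y' 0))" using gF par_zero by simp
      then show "supp 0 \<subseteq> B \<and> ?par (V.act g (V.lin y 0)) (W.act g (W.lin y' 0))" by simp
    next
      fix b and a :: complex assume b: "b \<in> B"
      obtain d where d: "supp d \<subseteq> B" "V.act g (y b) = V.lin y d"
        "W.act g (y' b) = W.lin y' d" using par_gen[OF g b] by blast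
      let ?d = "Poly_Mapping.mapp (\<lambda>_ z. a * z) d"
      have kd: "supp ?d \<subseteq> B" by (rule subset_trans[OF keys_mapp_subset d(1)])
      have "V.scal a (V.lin y d) = V.lin y ?d"
        using V.act_lin_diagonal[OF fa_fscal V.y_sub[OF d(1)], of a "\<lambda>_. a"] by (simp add: V.act_scal)
      moreover have "W.scal a (W.lin y' d) = W.lin y' ?d"
        using W.act_lin_diagonal[OF fa_fscal W.y_sub[OF d(1)], of a "\<lambda>_. a"] by (simp add: W.act_scal)
      ultimately have "V.act g (V.lin y (Poly_Mapping.single b a)) = V.lin y ?d"
        "W.act g (W.lin y' (Poly_Mapping.single b a)) = W.lin y' ?d"
        using b d gF by (simp_all add: V.y_closed W.y_closed V.act_scal_commute W.act_scal_commute)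
      with kd have "?par (V.act g (V.lin y (Poly_Mapping.single b a)))
          (W.act g (W.lin y' (Poly_Mapping.single b a)))" by blast
      then show "supp (Poly_Mapping.single b a) \<subseteq> B \<and>
        ?par (V.act g (V.lin y (Poly_Mapping.single b a))) (W.act g (W.lin y' (Poly_Mapping.single b a)))"
        using keys_single_subset[OF b] by blast
    next
      fix c d
      assume c: "supp c \<subseteq> B \<and> ?par (V.act g (V.lin y c)) (W.act g (W.lin y' c))"
        and d: "supp d \<subseteq> B \<and> ?par (V.act g (V.lin y d)) (W.act g (W.lin y' d))"
      have eq: "V.act g (V.lin y (c + d)) = V.act g (V.lin y c) \<oplus>\<^bsub>M\<^esub> V.act g (V.lin y d)"
        "W.act g (W.lin y' (c + d)) = W.act g (W.lin y' c) \<oplus>\<^bsub>M'\<^esub> W.act g (W.lin y' d)"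
        using c d gF by (simp_all add: V.lin_add_B W.lin_add_B V.act_distr W.act_distr V.lin_closed_B W.lin_closed_B)
      have "?par (V.act g (V.lin y (c + d))) (W.act g (W.lin y' (c + d)))"
        unfolding eq by (rule par_add) (use c d in blast)+
      then show "supp (c + d) \<subseteq> B \<and>
        ?par (V.act g (V.lin y (c + d))) (W.act g (W.lin y' (c + d)))"
        using c d by (simp add: keys_add_subset)
    qed
    then show ?thesis using p by blast
  qed
  have y0: "y b0 \<in> carrier M" "y' b0 \<in> carrier M'" using b0 V.y_closed W.y_closed by auto
  have "?par (V.act f (y b0)) (W.act f (y' b0))"
    using f
  proof (induction rule: free_algebra_induct)
    case zero
    then show ?case using par_zero y0 by simp
  next
    case one
    then show ?case using par_basis[OF b0] y0 by simp
  next
    case (scal a f)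
    have "?par (V.act (fscal a) (V.act f (y b0))) (W.act (fscal a) (W.act f (y' b0)))"
      by (rule par_act[OF _ scal(2)]) blast
    then show ?case using scal(1) y0 by (simp add: V.act_mult W.act_mult)
  next
    case (var x f)
    have "?par (V.act (fvar x) (V.act f (y b0))) (W.act (fvar x) (W.act f (y' b0)))"
      by (rule par_act[OF _ var(3)]) (use var(1) in blast)
    then show ?case using var(1,2) y0 by (simp add: V.act_mult W.act_mult)
  next
    case (add f g)
    have "?par (V.act f (y b0) \<oplus>\<^bsub>M\<^esub> V.act g (y b0)) (W.act f (y' b0) \<oplus>\<^bsub>M'\<^esub> W.act g (y' b0))"
      by (rule par_add[OF add(3,4)])
    then show ?case using add(1,2) y0 by (simp add: V.act_add W.act_add)
  qed
  then show ?thesis by (simp add: V.act_def W.act_def)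
qed

section \<open>Weights and simple reflections\<close>

lemma pairing_single: "pairing \<mu> (Poly_Mapping.single b 1) = coef \<mu> b"
  by (simp add: pairing_def)

lemma pairing_coroot: "pairing \<mu> (coroot i) = coef \<mu> (Hidx i)"
  by (simp add: coroot_def pairing_single)

lemma pairing_diff: "pairing (\<mu> - \<nu>) h = pairing \<mu> h - pairing \<nu> h"
  by (simp add: pairing_def lookup_minus right_diff_distrib sum_subtractf)

lemma lookup_simple_root_H:
  "coef (simple_root n i) (Hidx j) = (if j \<le> n then of_int (cartan_matrix n j i) else 0)"
  by (simp add: simple_root_def lookup_add lookup_sum lookup_single when_def)

lemma lookup_simple_root_D:
  "coef (simple_root n i) Didx = (if i = 0 then 1 else 0)"
  by (simp add: simple_root_def lookup_add lookup_sum lookup_single when_def)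

lemma lookup_simple_reflection:
  "coef (simple_reflection n i \<mu>) x =
    coef \<mu> x - coef \<mu> (Hidx i) * coef (simple_root n i) x"
  by (simp add: simple_reflection_def lookup_minus pairing_coroot Poly_Mapping.map.rep_eq when_def)

lemma simple_reflection_involution:
  "i \<le> n \<Longrightarrow> simple_reflection n i (simple_reflection n i \<mu>) = \<mu>"
  by (rule poly_mapping_eqI)
    (simp add: lookup_simple_reflection lookup_simple_root_H cartan_matrix_def algebra_simps)

lemma cartan_row_sum:
  fixes c :: "nat \<Rightarrow> 'a::comm_ring_1"
  assumes "2 \<le> n" "i \<le> n"
  shows "(\<Sum>j\<in>{0..n}. c j * of_int (cartan_matrix n i j)) =
    2 * c i - c ((i + 1) mod (n + 1)) - c ((i + n) mod (n + 1))"
proof -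
  let ?s = "(i + 1) mod (n + 1)" and ?p = "(i + n) mod (n + 1)"
  have le: "?s \<le> n" "?p \<le> n" by (simp_all only: mod_succ[OF assms(2)] mod_pred[OF assms(2)]) (use assms in auto)
  have d: "?s \<noteq> i" "?p \<noteq> i" "?s \<noteq> ?p"
    by (simp_all only: mod_succ[OF assms(2)] mod_pred[OF assms(2)]) (use assms in auto)
  have "(\<Sum>j\<in>{0..n}. c j * of_int (cartan_matrix n i j)) =
      (\<Sum>j\<in>{0..n}. (if j = i then 2 * c j else 0) - (if j = ?s then c j else 0) - (if j = ?p then c j else 0))"
    by (rule sum.cong) (use assms(2) d in \<open>auto simp: cartan_matrix_cases\<close>)
  also have "\<dots> = 2 * c i - c ?s - c ?p"
    using le assms(2) by (simp add: sum_subtractf)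
  finally show ?thesis .
qed

lemma lookup_sum_list_roots:
  assumes "set u \<subseteq> {0..n}"
  shows "coef (\<Sum>i\<leftarrow>u. simple_root n i) x =
    (\<Sum>j\<in>{0..n}. of_nat (count (mset u) j) * coef (simple_root n j) x)"
  using assms
proof (induction u)
  case (Cons i u)
  have "(\<Sum>j\<in>{0..n}. of_nat (count (mset (i # u)) j) * coef (simple_root n j) x) =
    (\<Sum>j\<in>{0..n}. of_nat (count (mset u) j) * coef (simple_root n j) x +
      (if j = i then coef (simple_root n j) x else 0))"
    by (rule sum.cong) (auto simp: algebra_simps)
  also have "\<dots> = (\<Sum>j\<in>{0..n}. of_nat (count (mset u) j) * coef (simple_root n j) x) +
      coef (simple_root n i) x"
    using Cons.prems by (simp add: sum.distrib)
  finally show ?case using Cons by (simp add: lookup_add add.commute)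
qed simp

text \<open>
  The difference of the multiplicities is harmonic on the cycle by the values on the coroots, hence
  constant; the value on \<open>d\<close> sees only the multiplicity of the colour 0.
\<close>

lemma simple_roots_independent:
  assumes n: "2 \<le> n" and u: "set u \<subseteq> {0..n}" "set w \<subseteq> {0..n}"
    and eq: "(\<Sum>i\<leftarrow>u. simple_root n i) = (\<Sum>i\<leftarrow>w. simple_root n i)"
  shows "mset u = mset w"
proof (rule multiset_eqI)
  fix i
  define c :: "nat \<Rightarrow> rat" where "c j = of_nat (count (mset u) j) - of_nat (count (mset w) j)" for j
  have z: "(\<Sum>j\<in>{0..n}. c j * coef (simple_root n j) x) = 0" for x
    using arg_cong[OF eq, of "\<lambda>m. coef m x"]
    by (simp add: lookup_sum_list_roots u c_def left_diff_distrib sum_subtractf)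
  have harm: "2 * c k = c ((k + 1) mod (n + 1)) + c ((k + n) mod (n + 1))" if "k \<le> n" for k
    using z[of "Hidx k"] that cartan_row_sum[OF n that, of c]
    by (simp add: lookup_simple_root_H)
  have "(\<Sum>j\<in>{0..n}. c j * coef (simple_root n j) Didx) = (\<Sum>j\<in>{0..n}. if j = 0 then c j else 0)"
    by (rule sum.cong) (auto simp: lookup_simple_root_D)
  then have "c 0 = 0" using z[of Didx] by simp
  then have "c k = 0" if "k \<le> n" for k using cyclic_harmonic_const[OF harm that] by simp
  then have "i \<le> n \<Longrightarrow> count (mset u) i = count (mset w) i" by (simp add: c_def)
  moreover have "i > n \<Longrightarrow> count (mset u) i = count (mset w) i"
    using u by (metis atLeastAtMost_iff count_mset_0_iff leD subsetD)
  ultimately show "count (mset u) i = count (mset w) i" by linarith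
qed

section \<open>Minuscule crystals\<close>

locale minuscule_crystal = crystal_set n B for n B +
  fixes b0 :: ymonomial
  assumes n_ge_3: "3 \<le> n"
    and b0: "b0 \<in> B" and connected: "B \<subseteq> subcrystal n b0"
    and f_iff_e: "\<lbrakk>b \<in> B; b' \<in> B; i \<le> n\<rbrakk> \<Longrightarrow> crystal_f n i b = Some b' \<longleftrightarrow> crystal_e n i b' = Some b"
    and not_both: "\<lbrakk>b \<in> B; i \<le> n\<rbrakk> \<Longrightarrow> crystal_f n i b = None \<or> crystal_e n i b = None"
    and wt_pairing: "\<lbrakk>b \<in> B; i \<le> n\<rbrakk> \<Longrightarrow> coef (ywt b) (Hidx i) =
      (if crystal_f n i b = None then 0 else 1) - (if crystal_e n i b = None then 0 else 1)"
    and f_diamond: "\<lbrakk>b \<in> B; i \<le> n; j \<le> n; i \<noteq> j; crystal_f n i b = Some b1; crystal_f n j b = Some b2\<rbrakk>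
      \<Longrightarrow> cartan_matrix n i j = 0 \<and> (\<exists>c. crystal_f n j b1 = Some c \<and> crystal_f n i b2 = Some c)"
    and wt_lattice: "b \<in> B \<Longrightarrow> ywt b \<in> weight_lattice n"
    and wt_inj: "inj_on ywt B"
begin

lemma subcrystal_subset: "subcrystal n b0 \<subseteq> B"
proof
  fix b assume "b \<in> subcrystal n b0"
  then show "b \<in> B" by induction (auto intro: b0 e_closed f_closed)
qed

lemma wt_f: "crystal_f n i b = Some b' \<Longrightarrow> ywt b' = ywt b - simple_root n i"
  by (auto simp: crystal_f_def ywt_def Amon_def split: if_splits)

lemma f_pairing:
  assumes "b \<in> B" "i \<le> n" "crystal_f n i b = Some b'"
  shows "coef (ywt b) (Hidx i) = 1" "coef (ywt b') (Hidx i) = -1"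
    "crystal_e n i b' = Some b" "b' \<in> B"
proof -
  show b': "b' \<in> B" using f_closed assms by blast
  show e: "crystal_e n i b' = Some b" using f_iff_e[OF assms(1) b' assms(2)] assms(3) by simp
  show "coef (ywt b) (Hidx i) = 1"
    using wt_pairing[OF assms(1,2)] not_both[OF assms(1,2)] assms(3) by simp
  show "coef (ywt b') (Hidx i) = -1"
    using wt_pairing[OF b' assms(2)] not_both[OF b' assms(2)] e by simp
qed

lemma e_f:
  assumes "b \<in> B" "i \<le> n" "crystal_e n i b = Some b'"
  shows "b' \<in> B" "crystal_f n i b' = Some b"
  using e_closed[OF assms] f_iff_e[of b' b i] assms by auto

lemma wt_trichotomy:
  assumes "b \<in> B" "i \<le> n"
  obtains (up) b' where "crystal_f n i b = Some b'" "crystal_e n i b = None" "coef (ywt b) (Hidx i) = 1"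
  | (down) b' where "crystal_f n i b = None" "crystal_e n i b = Some b'" "coef (ywt b) (Hidx i) = -1"
  | (zero) "crystal_f n i b = None" "crystal_e n i b = None" "coef (ywt b) (Hidx i) = 0"
  using wt_pairing[OF assms] not_both[OF assms]
  by (cases "crystal_f n i b"; cases "crystal_e n i b") auto

lemma reflection_f:
  assumes "b \<in> B" "i \<le> n" "crystal_f n i b = Some b'"
  shows "simple_reflection n i (ywt b) = ywt b'" "simple_reflection n i (ywt b') = ywt b"
  using f_pairing[OF assms] wt_f[OF assms(3)]
  by (auto intro!: poly_mapping_eqI simp: lookup_simple_reflection lookup_minus)

lemma reflection_zero:
  "coef \<mu> (Hidx i) = 0 \<Longrightarrow> simple_reflection n i \<mu> = \<mu>"
  by (auto intro!: poly_mapping_eqI simp: lookup_simple_reflection)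

text \<open>
  A simple reflection moves a weight along the arrow of its colour at the corresponding element, or
  fixes it when there is none.
\<close>

lemma weyl_orbit:
  "w \<in> weyl_group n \<Longrightarrow> \<exists>b\<in>B. ywt b = w (ywt b0)"
proof (induction rule: weyl_group.induct)
  case weyl_id
  then show ?case using b0 by auto
next
  case (weyl_refl w i)
  then obtain b where b: "b \<in> B" "ywt b = w (ywt b0)" by blast
  show ?case
    using b(1) weyl_refl(2)
  proof (cases rule: wt_trichotomy)
    case (up b')
    then show ?thesis using reflection_f(1)[OF b(1) weyl_refl(2)] f_pairing(4)[OF b(1) weyl_refl(2)] b(2)
      by (auto intro!: bexI[of _ b'])
  next
    case (down b')
    then show ?thesis using e_f[OF b(1) weyl_refl(2)] reflection_f(2)[of b' i b] weyl_refl(2) b(2)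
      by (auto intro!: bexI[of _ b'])
  next
    case zero
    then show ?thesis using b by (auto intro!: bexI[of _ b] simp: reflection_zero)
  qed
qed

definition step :: "nat \<Rightarrow> ymonomial \<Rightarrow> ymonomial option" where
  "step i b = (if b \<in> B \<and> i \<le> n then crystal_f n i b else None)"

lemma step_Some: "step i b = Some b' \<longleftrightarrow> b \<in> B \<and> i \<le> n \<and> crystal_f n i b = Some b'"
  by (auto simp: step_def)

lemma run_step_weight:
  "run step u b = Some q \<Longrightarrow> set u \<subseteq> {0..n} \<and> ywt q = ywt b - (\<Sum>i\<leftarrow>u. simple_root n i)"
proof (induction u arbitrary: b)
  case (Cons i u)
  then obtain b' where b': "step i b = Some b'" "run step u b' = Some q"
    by (auto split: option.splits)
  then show ?case using Cons.IH[OF b'(2)] wt_f[of i b b'] by (auto simp: step_Some algebra_simps)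
qed simp

lemma run_step_same_content:
  "\<lbrakk>run step u b = Some q; run step w b = Some q\<rbrakk> \<Longrightarrow> mset u = mset w"
  using run_step_weight[of u b q] run_step_weight[of w b q] n_ge_3
  by (intro simple_roots_independent[of n]) auto

end

context affine_module begin

lemma divided_power_0: "x \<in> carrier M \<Longrightarrow> i \<le> n \<Longrightarrow> divided_power n t p i 0 \<odot>\<^bsub>M\<^esub> x = x"
  by (simp add: divided_power_def U_cls_one smult_one)

lemma divided_power_1:
  assumes "x \<in> carrier M" "i \<le> n"
  shows "divided_power n t p i (Suc 0) \<odot>\<^bsub>M\<^esub> x = act (fvar (AX p i)) x"
  using assms R.nat_pow_eone[of "aff_class n t (fvar (AX p i))"]
  by (simp add: divided_power_def U_cls_one act_def del: R.nat_pow_eone)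

lemma act_eq_zero_relation:
  assumes "f - g \<in> aff_relations n t" "f \<in> FA" "g \<in> FA"
  shows "act f x = act g x"
  using U_relation[OF assms] by (simp add: act_def)

lemma far_commute:
  assumes "i \<le> n" "j \<le> n" "i \<noteq> j" "cartan_matrix n i j = 0" "x \<in> carrier M"
  shows "act (fvar (AX p i)) (act (fvar (AX p j)) x) = act (fvar (AX p j)) (act (fvar (AX p i)) x)"
proof -
  have "fvar (AX p i) * fvar (AX p j) - fvar (AX p j) * fvar (AX p i) \<in> aff_relations n t"
    using aff_serre[OF assms(1,2,3) refl, where t = t and p = p] assms(4) by (simp add: fscal_uminus)
  from act_eq_zero_relation[OF this, of x] show ?thesis
    using assms by (simp add: act_mult)
qed

lemma K_shift:
  assumes "h \<in> cartan_space n" "j \<le> n" "x \<in> carrier M"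
    and "\<And>h. h \<in> cartan_space n \<Longrightarrow> act (fvar (AK h)) x = scal (qpow t (pairing \<mu> h)) x"
  shows "act (fvar (AK h)) (act (fvar (AX p j)) x) =
    scal (qpow t (pairing \<mu> h + of_int (dsgn p) * pairing (simple_root n j) h)) (act (fvar (AX p j)) x)"
proof -
  let ?K = "fvar (AK h)" and ?K' = "fvar (AK (- h))" and ?X = "fvar (AX p j)"
  let ?a = "qpow t (of_int (dsgn p) * pairing (simple_root n j) h)"
  have F: "?K \<in> FA" "?K' \<in> FA" "?X \<in> FA" using assms by auto
  have 0: "act (?K * ?X * ?K') z = act (fscal ?a * ?X) z" for z
    by (rule act_eq_zero_relation[OF aff_kx[OF assms(1,2)]]) (use F in auto)
  have 1: "act ?K (act ?X (act ?K' z)) = scal ?a (act ?X z)" if "z \<in> carrier M" for z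
    using F that 0[of z] by (simp add: act_mult act_scal)
  have "act (?K' * ?K) x = act (fvar (AK (- h + h))) x"
    by (rule act_eq_zero_relation[OF aff_k_add]) (use assms(1) in auto)
  moreover have "act (fvar (AK 0)) x = act 1 x"
    by (rule act_eq_zero_relation[OF aff_k_zero]) auto
  ultimately have "act ?K' (act ?K x) = x" using F assms(3) by (simp add: act_mult)
  then have "act ?K (act ?X x) = scal ?a (act ?X (act ?K x))"
    using 1[of "act ?K x"] F assms(3) by simp
  also have "\<dots> = scal ?a (scal (qpow t (pairing \<mu> h)) (act ?X x))"
    using assms F by (simp add: act_scal_commute)
  also have "\<dots> = scal (qpow t (pairing \<mu> h + of_int (dsgn p) * pairing (simple_root n j) h)) (act ?X x)"
    using assms F by (simp add: scal_mult[symmetric] qpow_add[symmetric] add.commute)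
  finally show ?thesis .
qed

end

section \<open>Extremal vectors generate crystal families\<close>

text \<open>
  Extremality for a weight all of whose Weyl group translates take the values -1, 0 and 1 on the
  coroots; only the first divided powers are then relevant.
\<close>

locale minuscule_extremal = minuscule_crystal n B b0 + affine_module n t M
  for n B b0 t and M :: "(aff_gen falg set, 'v) module" +
  fixes x0 :: 'v and v :: "(weight \<Rightarrow> weight) \<Rightarrow> 'v"
  assumes weight: "h \<in> cartan_space n \<Longrightarrow> act (fvar (AK h)) x0 = scal (qpow t (pairing (ywt b0) h)) x0"
    and v_closed: "w \<in> weyl_group n \<Longrightarrow> v w \<in> carrier M"
    and v_id: "v id = x0"
    and E_zero: "\<lbrakk>w \<in> weyl_group n; i \<le> n; coef (w (ywt b0)) (Hidx i) \<ge> 0\<rbrakk> \<Longrightarrow>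
      act (fvar (AX Raising i)) (v w) = \<zero>\<^bsub>M\<^esub>"
    and F_zero: "\<lbrakk>w \<in> weyl_group n; i \<le> n; coef (w (ywt b0)) (Hidx i) \<le> 0\<rbrakk> \<Longrightarrow>
      act (fvar (AX Lowering i)) (v w) = \<zero>\<^bsub>M\<^esub>"
    and v_F: "\<lbrakk>w \<in> weyl_group n; i \<le> n; coef (w (ywt b0)) (Hidx i) = 1\<rbrakk> \<Longrightarrow>
      act (fvar (AX Lowering i)) (v w) = v (simple_reflection n i \<circ> w)"
    and v_E: "\<lbrakk>w \<in> weyl_group n; i \<le> n; coef (w (ywt b0)) (Hidx i) = -1\<rbrakk> \<Longrightarrow>
      act (fvar (AX Raising i)) (v w) = v (simple_reflection n i \<circ> w)"
begin

abbreviation "raise i \<equiv> act (fvar (AX Raising i))"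
abbreviation "lower i \<equiv> act (fvar (AX Lowering i))"

definition cover :: "(ymonomial \<times> 'v) set" where
  "cover = {(b, y). b \<in> B \<and> (\<exists>w\<in>weyl_group n. ywt b = w (ywt b0) \<and> y = v w)}"

lemma coverI: "\<lbrakk>b \<in> B; w \<in> weyl_group n; ywt b = w (ywt b0)\<rbrakk> \<Longrightarrow> (b, v w) \<in> cover"
  by (auto simp: cover_def)

text \<open>
  That raising undoes lowering follows from extremality alone: the companions are attached to
  elements of the Weyl group, in which simple reflections are involutions.
\<close>

lemma cover_up:
  assumes "(b, y) \<in> cover" "step i b = Some b'"
  shows "(b', lower i y) \<in> cover \<and> raise i (lower i y) = y"
proof -
  obtain w where w: "b \<in> B" "w \<in> weyl_group n" "ywt b = w (ywt b0)" "y = v w"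
    using assms(1) by (auto simp: cover_def)
  have f: "i \<le> n" "crystal_f n i b = Some b'" using assms(2) by (auto simp: step_Some)
  note fp = f_pairing[OF w(1) f] and rf = reflection_f[OF w(1) f]
  have l: "lower i y = v (simple_reflection n i \<circ> w)"
    using v_F[OF w(2) f(1)] fp(1) w by simp
  have sw: "simple_reflection n i \<circ> w \<in> weyl_group n" using weyl_refl[OF w(2) f(1)] .
  have wt': "ywt b' = (simple_reflection n i \<circ> w) (ywt b0)" using rf(1) w(3) by simp
  have "raise i (lower i y) = v (simple_reflection n i \<circ> (simple_reflection n i \<circ> w))"
    unfolding l using v_E[OF sw f(1)] fp(2) wt' by simp
  also have "simple_reflection n i \<circ> (simple_reflection n i \<circ> w) = w"
    using simple_reflection_involution[OF f(1)] by (simp add: fun_eq_iff)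
  finally show ?thesis using coverI[of b' "simple_reflection n i \<circ> w", OF fp(4) sw] wt' l w(4) by simp
qed

lemma cover_down:
  assumes "(b', y) \<in> cover" "step i b = Some b'"
  shows "(b, raise i y) \<in> cover \<and> lower i (raise i y) = y"
proof -
  obtain w where w: "b' \<in> B" "w \<in> weyl_group n" "ywt b' = w (ywt b0)" "y = v w"
    using assms(1) by (auto simp: cover_def)
  have b: "b \<in> B" and f: "i \<le> n" "crystal_f n i b = Some b'" using assms(2) by (auto simp: step_Some)
  note fp = f_pairing[OF b f] and rf = reflection_f[OF b f]
  have l: "raise i y = v (simple_reflection n i \<circ> w)"
    using v_E[OF w(2) f(1)] fp(2) w by simp
  have sw: "simple_reflection n i \<circ> w \<in> weyl_group n" using weyl_refl[OF w(2) f(1)] .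
  have wt': "ywt b = (simple_reflection n i \<circ> w) (ywt b0)" using rf(2) w(3) by simp
  have "lower i (raise i y) = v (simple_reflection n i \<circ> (simple_reflection n i \<circ> w))"
    unfolding l using v_F[OF sw f(1)] fp(1) wt' by simp
  also have "simple_reflection n i \<circ> (simple_reflection n i \<circ> w) = w"
    using simple_reflection_involution[OF f(1)] by (simp add: fun_eq_iff)
  finally show ?thesis using coverI[of b "simple_reflection n i \<circ> w", OF b sw] wt' l w(4) by simp
qed

sublocale cov: coloured_covering step lower "carrier M" raise b0 x0 cover
proof
  show "\<exists>c. step j b1 = Some c \<and> step i b2 = Some c"
    if "step i b = Some b1" "step j b = Some b2" "i \<noteq> j" for i b b1 j b2
    using that f_diamond[of b i j b1 b2] f_closed[of b i b1] f_closed[of b j b2]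
    by (auto simp: step_Some)
  show "lower i (lower j y) = lower j (lower i y)"
    if "step i b = Some b1" "step j b = Some b2" "i \<noteq> j" "y \<in> carrier M" for i b b1 j b2 y
    using that f_diamond[of b i j b1 b2] by (intro far_commute) (auto simp: step_Some)
  show "lower i y \<in> carrier M" if "step i b = Some b1" "y \<in> carrier M" for i b b1 y
    using that by (auto simp: step_Some)
  show "(b0, x0) \<in> cover"
    using coverI[OF b0 weyl_id] v_id by simp
  show "y \<in> carrier M" if "(b, y) \<in> cover" for b y
    using that v_closed by (auto simp: cover_def)
qed (auto dest: cover_up cover_down run_step_same_content)

lemma reached_exists: "b \<in> B \<Longrightarrow> \<exists>y. cov.reached b y"
proof -
  assume "b \<in> B"
  then have "b \<in> subcrystal n b0" using connected by blast
  then show ?thesis using \<open>b \<in> B\<close>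
  proof (induction rule: subcrystal.induct)
    case subcrystal_base
    then show ?case using cov.reached_base by blast
  next
    case (subcrystal_e m i m')
    have m: "m \<in> B" using subcrystal_e(1) subcrystal_subset by blast
    then obtain y where "cov.reached m y" using subcrystal_e by blast
    moreover have "step i m' = Some m"
      using e_f[OF m subcrystal_e(2,3)] subcrystal_e(2) by (auto simp: step_Some)
    ultimately show ?case using cov.reached_down by blast
  next
    case (subcrystal_f m i m')
    have m: "m \<in> B" using subcrystal_f(1) subcrystal_subset by blast
    then obtain y where "cov.reached m y" using subcrystal_f by blast
    moreover have "step i m = Some m'" using subcrystal_f m by (auto simp: step_Some)
    ultimately show ?case using cov.reached_up by blast
  qed
qed

definition vec :: "ymonomial \<Rightarrow> 'v" where "vec b = (SOME y. cov.reached b y)"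

lemma vec_reached: "b \<in> B \<Longrightarrow> cov.reached b (vec b)"
  unfolding vec_def using reached_exists by (rule someI_ex)

lemma vec_eq: "cov.reached b y \<Longrightarrow> y = vec b"
  unfolding vec_def using cov.reached_unique by (metis someI_ex)

lemma reached_weight:
  "cov.reached b y \<Longrightarrow> b \<in> B \<and> y \<in> carrier M \<and> (\<forall>h\<in>cartan_space n. act (fvar (AK h)) y = scal (qpow t (pairing (ywt b) h)) y)"
proof (induction rule: cov.reached.induct)
  case reached_base
  then show ?case using b0 weight v_closed[OF weyl_id] v_id by auto
next
  case (reached_up b y i b')
  have i: "i \<le> n" "crystal_f n i b = Some b'" "b \<in> B" using reached_up by (auto simp: step_Some)
  have "act (fvar (AK h)) (lower i y) = scal (qpow t (pairing (ywt b') h)) (lower i y)"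
    if "h \<in> cartan_space n" for h
    using K_shift[OF that i(1), of y "ywt b" Lowering] reached_up.IH wt_f[OF i(2)] by (simp add: pairing_diff)
  then show ?case using reached_up.IH i f_pairing(4)[OF i(3,1,2)] by auto
next
  case (reached_down b' y i b)
  have i: "i \<le> n" "crystal_f n i b = Some b'" "b \<in> B" using reached_down by (auto simp: step_Some)
  have "act (fvar (AK h)) (raise i y) = scal (qpow t (pairing (ywt b) h)) (raise i y)"
    if "h \<in> cartan_space n" for h
    using K_shift[OF that i(1), of y "ywt b'" Raising] reached_down.IH wt_f[OF i(2)] by (simp add: pairing_diff)
  then show ?case using reached_down.IH i by auto
qed

text \<open>
  Triviality of the covering makes \<open>vec\<close> well-defined along arrows; in the absence of an arrow the
  sign of the pairing makes the operator vanish by extremality.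
\<close>

lemma vec_family: "crystal_family n t M B vec"
proof
  fix b assume b: "b \<in> B"
  note r = vec_reached[OF b]
  show "vec b \<in> carrier M" using reached_weight[OF r] by simp
  show "act (fvar (AK h)) (vec b) = scal (qpow t (pairing (ywt b) h)) (vec b)" if "h \<in> cartan_space n" for h
    using reached_weight[OF r] that by simp
  obtain w where w: "w \<in> weyl_group n" "ywt b = w (ywt b0)" "vec b = v w"
    using cov.reached_in_X[OF r] by (auto simp: cover_def)
  fix i assume i: "i \<le> n"
  show "raise i (vec b) = opt_vec M vec (crystal_e n i b)"
  proof (cases "crystal_e n i b")
    case None
    then have "coef (ywt b) (Hidx i) \<ge> 0" using wt_pairing[OF b i] by simp
    then show ?thesis using E_zero[OF w(1) i] None w by simp
  next
    case (Some b')
    then have "step i b' = Some b" using e_f[OF b i] i by (auto simp: step_Some)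
    then show ?thesis using vec_eq[OF cov.reached_down[OF r]] Some by simp
  qed
  show "lower i (vec b) = opt_vec M vec (crystal_f n i b)"
  proof (cases "crystal_f n i b")
    case None
    then have "coef (ywt b) (Hidx i) \<le> 0" using wt_pairing[OF b i] by simp
    then show ?thesis using F_zero[OF w(1) i] None w by simp
  next
    case (Some b')
    then have "step i b = Some b'" using b i by (auto simp: step_Some)
    then show ?thesis using vec_eq[OF cov.reached_up[OF r]] Some by simp
  qed
qed

lemma vec_b0: "vec b0 = x0"
  using vec_eq[OF cov.reached_base] by simp

end

section \<open>Cyclic modules as quotients by annihilators\<close>

text \<open>
  The isomorphism is taken in the direction from the module to the quotient. It sends a vector to the
  set of all algebra elements that produce it from the generator, which is a coset of the annihilator;
  no choice of representatives is needed.
\<close>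

locale cyclic_module = left_module A M for A (structure) and M (structure) +
  fixes x
  assumes x: "x \<in> carrier M" and generates: "z \<in> carrier M \<Longrightarrow> \<exists>a\<in>carrier A. a \<odot>\<^bsub>M\<^esub> x = z"
begin

definition "ann = {a \<in> carrier A. a \<odot>\<^bsub>M\<^esub> x = \<zero>\<^bsub>M\<^esub>}"
definition "fibre z = {a \<in> carrier A. a \<odot>\<^bsub>M\<^esub> x = z}"

lemma minus_smult:
  assumes "a \<in> carrier A" "b \<in> carrier A"
  shows "(a \<oplus> \<ominus> b) \<odot>\<^bsub>M\<^esub> x = a \<odot>\<^bsub>M\<^esub> x \<oplus>\<^bsub>M\<^esub> (\<ominus>\<^bsub>M\<^esub> (b \<odot>\<^bsub>M\<^esub> x))"
proof -
  have "(\<ominus> b) \<odot>\<^bsub>M\<^esub> x = \<ominus>\<^bsub>M\<^esub> (b \<odot>\<^bsub>M\<^esub> x)"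
    using smult_l_distr[of "\<ominus> b" b x] assms x
    by (intro M.minus_equality[symmetric]) (auto simp: R.l_neg smult_closed)
  then show ?thesis using assms x by (simp add: smult_l_distr)
qed

lemma ann_ideal: "left_ideal A ann"
  unfolding left_ideal_def
proof
  show "additive_subgroup ann A"
  proof (rule additive_subgroup.intro, rule R.add.subgroupI)
    show "ann \<noteq> {}" unfolding ann_def using x by (auto intro!: exI[of _ "\<zero>"])
    show "\<ominus> a \<in> ann" if "a \<in> ann" for a
      using minus_smult[of \<zero> a] that x unfolding ann_def by auto
  qed (use x in \<open>auto simp: ann_def smult_l_distr\<close>)
  show "\<forall>a\<in>carrier A. \<forall>b\<in>ann. a \<otimes> b \<in> ann"
    using x by (auto simp: ann_def smult_assoc1)
qed

lemma coset_fibre: 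
  assumes a: "a \<in> carrier A" shows "ann +>\<^bsub>A\<^esub> a = fibre (a \<odot>\<^bsub>M\<^esub> x)"
proof
  show "ann +>\<^bsub>A\<^esub> a \<subseteq> fibre (a \<odot>\<^bsub>M\<^esub> x)"
    using a x by (auto simp: a_r_coset_def r_coset_def ann_def fibre_def smult_l_distr smult_closed)
  show "fibre (a \<odot>\<^bsub>M\<^esub> x) \<subseteq> ann +>\<^bsub>A\<^esub> a"
  proof
    fix b assume b: "b \<in> fibre (a \<odot>\<^bsub>M\<^esub> x)"
    then have "b \<oplus> \<ominus> a \<in> ann" "b = (b \<oplus> \<ominus> a) \<oplus> a"
      using a minus_smult[of b a] smult_closed[OF a x]
      by (auto simp: ann_def fibre_def M.r_neg R.a_assoc R.l_neg)
    then show "b \<in> ann +>\<^bsub>A\<^esub> a" by (auto simp: a_r_coset_def r_coset_def)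
  qed
qed

abbreviation "Q \<equiv> quotient_left_module A ann"

lemma quotient_carrier: "carrier Q = fibre ` carrier M"
proof -
  have "carrier Q = (\<lambda>a. ann +>\<^bsub>A\<^esub> a) ` carrier A"
    by (auto simp: quotient_left_module_def A_RCOSETS_def RCOSETS_def a_r_coset_def)
  also have "\<dots> = (\<lambda>a. fibre (a \<odot>\<^bsub>M\<^esub> x)) ` carrier A" by (simp add: coset_fibre)
  also have "\<dots> = fibre ` carrier M"
    using generates x by (force simp: smult_closed)
  finally show ?thesis .
qed

lemma fibre_inj: "inj_on fibre (carrier M)"
proof (rule inj_onI)
  fix z z' assume "z \<in> carrier M" "z' \<in> carrier M" and eq: "fibre z = fibre z'"
  then obtain a where "a \<in> fibre z" using generates by (auto simp: fibre_def)
  then show "z = z'" using eq by (auto simp: fibre_def)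
qed

lemma fibre_zero: "fibre \<zero>\<^bsub>M\<^esub> = \<zero>\<^bsub>Q\<^esub>"
  by (simp add: fibre_def ann_def quotient_left_module_def)

lemma fibre_add:
  assumes "y \<in> carrier M" "z \<in> carrier M"
  shows "fibre (y \<oplus>\<^bsub>M\<^esub> z) = fibre y \<oplus>\<^bsub>Q\<^esub> fibre z"
proof
  have sum_eq: "fibre y \<oplus>\<^bsub>Q\<^esub> fibre z = (\<Union>h\<in>fibre y. \<Union>k\<in>fibre z. {h \<oplus> k})"
    by (simp add: quotient_left_module_def set_add_def set_mult_def)
  obtain b where b: "b \<in> carrier A" "b \<odot>\<^bsub>M\<^esub> x = z" using generates assms by blast
  show "fibre (y \<oplus>\<^bsub>M\<^esub> z) \<subseteq> fibre y \<oplus>\<^bsub>Q\<^esub> fibre z"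
  proof
    fix a assume "a \<in> fibre (y \<oplus>\<^bsub>M\<^esub> z)"
    then have a: "a \<in> carrier A" "a \<odot>\<^bsub>M\<^esub> x = y \<oplus>\<^bsub>M\<^esub> z" by (auto simp: fibre_def)
    have "(a \<oplus> \<ominus> b) \<odot>\<^bsub>M\<^esub> x = y" using minus_smult[OF a(1) b(1)] a b assms
      by (simp add: M.a_assoc M.r_neg)
    moreover have "a = (a \<oplus> \<ominus> b) \<oplus> b" using a b by (simp add: R.a_assoc R.l_neg)
    moreover have "a \<oplus> \<ominus> b \<in> carrier A" using a(1) b(1) by simp
    ultimately have "a \<oplus> \<ominus> b \<in> fibre y" "b \<in> fibre z" "a = (a \<oplus> \<ominus> b) \<oplus> b"
      using b by (simp_all add: fibre_def)
    then show "a \<in> fibre y \<oplus>\<^bsub>Q\<^esub> fibre z" unfolding sum_eq by blast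
  qed
  show "fibre y \<oplus>\<^bsub>Q\<^esub> fibre z \<subseteq> fibre (y \<oplus>\<^bsub>M\<^esub> z)"
    using x by (auto simp: quotient_left_module_def set_add_def set_mult_def fibre_def smult_l_distr)
qed

lemma fibre_smult:
  assumes "a \<in> carrier A" "z \<in> carrier M"
  shows "fibre (a \<odot>\<^bsub>M\<^esub> z) = a \<odot>\<^bsub>Q\<^esub> fibre z"
proof -
  have "a \<odot>\<^bsub>Q\<^esub> fibre z = (\<Union>c\<in>fibre z. ann +>\<^bsub>A\<^esub> (a \<otimes> c))"
    by (simp add: quotient_left_module_def)
  also have "\<dots> = (\<Union>c\<in>fibre z. fibre (a \<odot>\<^bsub>M\<^esub> z))"
    using assms x by (intro SUP_cong refl) (auto simp: fibre_def[of z] coset_fibre smult_assoc1)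
  also have "\<dots> = fibre (a \<odot>\<^bsub>M\<^esub> z)"
    using generates[OF assms(2)] by (auto simp: fibre_def[of z])
  finally show ?thesis by simp
qed

lemma fibre_iso: "fibre \<in> left_module_iso A M Q"
  by (simp add: left_module_iso_def bij_betw_def fibre_inj quotient_carrier fibre_add fibre_smult)

lemma quotient_module: "left_module A Q"
proof -
  have add_cl: "\<And>X Y. \<lbrakk>X \<in> carrier Q; Y \<in> carrier Q\<rbrakk> \<Longrightarrow> X \<oplus>\<^bsub>Q\<^esub> Y \<in> carrier Q"
    unfolding quotient_carrier by (auto simp: fibre_add[symmetric])
  have ab: "abelian_group Q"
  proof (rule abelian_groupI)
    fix X assume "X \<in> carrier Q"
    then obtain z where z: "z \<in> carrier M" "X = fibre z" unfolding quotient_carrier by blast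
    show "\<exists>Y\<in>carrier Q. Y \<oplus>\<^bsub>Q\<^esub> X = \<zero>\<^bsub>Q\<^esub>"
      using z by (intro bexI[of _ "fibre (\<ominus>\<^bsub>M\<^esub> z)"])
        (auto simp: quotient_carrier fibre_add[symmetric] fibre_zero M.l_neg)
  qed (auto simp: quotient_carrier fibre_add[symmetric] fibre_zero[symmetric] M.a_ac)
  then interpret Q: abelian_group Q .
  show ?thesis
    by unfold_locales
      (auto simp: quotient_carrier fibre_add[symmetric] fibre_smult[symmetric] smult_closed
        smult_l_distr smult_r_distr smult_assoc1 smult_one)
qed

end

section \<open>Modules with a minuscule crystal basis\<close>

locale crystal_basis = minuscule_crystal n B b0 + crystal_family n t M B y
  for n B b0 t and M :: "(aff_gen falg set, 'v) module" and y +
  assumes basis: "x \<in> carrier M \<Longrightarrow> \<exists>!c. supp c \<subseteq> B \<and> x = lin y c"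
begin

definition "coord x = (THE c. supp c \<subseteq> B \<and> x = lin y c)"

lemma coord: "x \<in> carrier M \<Longrightarrow> supp (coord x) \<subseteq> B" "x \<in> carrier M \<Longrightarrow> lin y (coord x) = x"
  unfolding coord_def using theI'[OF basis, of x] by auto

lemma coord_lin: "supp c \<subseteq> B \<Longrightarrow> coord (lin y c) = c"
  unfolding coord_def using basis[OF lin_closed_B] by (intro the1_equality) auto

lemma coord_zero [simp]: "coord \<zero>\<^bsub>M\<^esub> = 0"
  using coord_lin[of 0] by simp

lemma coord_add: "\<lbrakk>x \<in> carrier M; z \<in> carrier M\<rbrakk> \<Longrightarrow> coord (x \<oplus>\<^bsub>M\<^esub> z) = coord x + coord z"
  using coord_lin[of "coord x + coord z"] coord(1)[of x] coord(1)[of z]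
  by (simp add: lin_add_B coord(2) keys_add_subset)

lemma coord_finsum: "g \<in> K \<rightarrow> carrier M \<Longrightarrow> finite K \<Longrightarrow> coord (\<Oplus>\<^bsub>M\<^esub>k\<in>K. g k) = (\<Sum>k\<in>K. coord (g k))"
proof (induction K rule: infinite_finite_induct)
  case (insert k K)
  then have "g \<in> K \<rightarrow> carrier M" "g k \<in> carrier M" by auto
  then show ?case using insert by (simp add: M.finsum_insert coord_add M.finsum_closed)
qed simp_all

lemma coord_scal_basis: "b \<in> B \<Longrightarrow> coord (scal a (y b)) = Poly_Mapping.single b a"
  using coord_lin[of "Poly_Mapping.single b a"] y_closed by auto

lemma y_nonzero: "b \<in> B \<Longrightarrow> y b \<noteq> \<zero>\<^bsub>M\<^esub>"
proof
  assume b: "b \<in> B" and "y b = \<zero>\<^bsub>M\<^esub>"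
  then have "coord (scal 1 (y b)) = 0" by (simp del: scal_one)
  then have "coef (Poly_Mapping.single b (1::complex)) b = 0"
    using coord_scal_basis[OF b, of 1] by simp
  then show False by simp
qed

lemma separate_weights:
  assumes "\<mu> \<in> weight_lattice n" "\<nu> \<in> weight_lattice n" "\<mu> \<noteq> \<nu>"
  obtains h where "h \<in> cartan_space n" "pairing \<mu> h \<noteq> pairing \<nu> h"
proof -
  obtain k where k: "coef \<mu> k \<noteq> coef \<nu> k"
    using assms(3) poly_mapping_eqI[of \<mu> \<nu>] by auto
  then have "k \<in> supp \<mu> \<union> supp \<nu>" by (auto simp: in_keys_iff)
  then have "k \<in> cartan_indices n" using assms by (auto simp: weight_lattice_def)
  then have "Poly_Mapping.single k 1 \<in> cartan_space n" by (simp add: cartan_space_def)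
  then show ?thesis using that k by (metis pairing_single)
qed

text \<open>
  Induction on the size of the support: if two basis vectors occur, a Cartan element minus its
  eigenvalue at one of them removes this one and keeps the other.
\<close>

lemma submodule_contains_basis_vector:
  assumes N: "left_submodule (Uaff n t) M N"
  shows "\<lbrakk>supp c \<subseteq> B; c \<noteq> 0; lin y c \<in> N\<rbrakk> \<Longrightarrow> \<exists>b\<in>B. y b \<in> N"
proof (induction "card (supp c)" arbitrary: c rule: less_induct)
  case less
  have actN: "act f z \<in> N" if "f \<in> FA" "z \<in> N" for f z
    using N that by (auto simp: left_submodule_def act_def)
  obtain b where b: "b \<in> supp c" using less.prems(2) keys_eq_empty[of c] by blast
  then have bB: "b \<in> B" using less.prems(1) by blast
  show ?case
  proof (cases "supp c = {b}")
    case True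
    let ?a = "coef c b"
    have a: "?a \<noteq> 0" using b by (simp add: in_keys_iff)
    have "c = Poly_Mapping.single b ?a"
      by (rule poly_mapping_eqI) (use True in \<open>auto simp: lookup_single when_def in_keys_iff\<close>)
    from arg_cong[OF this, of "lin y"] have "lin y c = scal ?a (y b)"
      unfolding lin_single[of y b, OF y_closed[OF bB]] .
    then have "scal (1 / ?a) (scal ?a (y b)) \<in> N"
      using actN[of "fscal (1 / ?a)"] less.prems(3) by (simp add: act_scal)
    then have "y b \<in> N" using a y_closed[OF bB] by (simp add: scal_mult[symmetric])
    then show ?thesis using bB by blast
  next
    case False
    then obtain b' where b': "b' \<in> supp c" "b' \<noteq> b" using b by blast
    then have b'B: "b' \<in> B" using less.prems(1) by blast
    have "ywt b' \<noteq> ywt b" using wt_inj b'(2) bB b'B by (auto dest: inj_onD)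
    then obtain h where h: "h \<in> cartan_space n" "pairing (ywt b') h \<noteq> pairing (ywt b) h"
      using separate_weights[OF wt_lattice[OF b'B] wt_lattice[OF bB]] by blast
    let ?f = "fvar (AK h) - fscal (qpow t (pairing (ywt b) h))"
    define g where "g m = qpow t (pairing (ywt m) h) - qpow t (pairing (ywt b) h)" for m
    let ?d = "Poly_Mapping.mapp (\<lambda>m a. g m * a) c"
    have F: "?f \<in> FA" using h(1) by auto
    have "act ?f (y m) = scal (g m) (y m)" if "m \<in> B" for m
    proof -
      have "act ?f (y m) = act (fvar (AK h) + fscal (- qpow t (pairing (ywt b) h))) (y m)"
        by (simp add: fscal_uminus)
      also have "\<dots> = scal (g m) (y m)"
        using h(1) that y_closed[OF that] K_act[OF that h(1)]
        by (simp add: act_add act_scal scal_add[symmetric] g_def)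
      finally show ?thesis .
    qed
    then have "act ?f (lin y c) = lin y ?d"
      using less.prems(1) by (intro act_lin_diagonal[OF F y_sub[OF less.prems(1)]]) auto
    then have "lin y ?d \<in> N" using actN[OF F less.prems(3)] by simp
    moreover have sub: "supp ?d \<subseteq> supp c" by (rule keys_mapp_subset)
    moreover have "b \<notin> supp ?d"
      by (simp add: in_keys_iff lookup_mapp g_def)
    then have "supp ?d \<subset> supp c" using sub b by blast
    then have "card (supp ?d) < card (supp c)"
      by (intro psubset_card_mono) auto
    moreover have "coef ?d b' \<noteq> 0"
      using b'(1) h(2) by (simp add: lookup_mapp g_def qpow_inj in_keys_iff)
    then have "?d \<noteq> 0" by force
    ultimately show ?thesis using less.hyps[of ?d] less.prems(1) by blast
  qed
qed

text \<open>
  The arrows of a minuscule crystal are invertible, so from any basis vector one gets back to the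
  base point and from there everywhere.
\<close>

lemma submodule_eq_carrier:
  assumes N: "left_submodule (Uaff n t) M N" and "b \<in> B" "y b \<in> N"
  shows "N = carrier M"
proof -
  have actN: "act f z \<in> N" if "f \<in> FA" "z \<in> N" for f z
    using N that by (auto simp: left_submodule_def act_def)
  interpret N: additive_subgroup N M using N by (simp add: left_submodule_def)
  have E: "y b' \<in> N" if "b \<in> B" "y b \<in> N" "i \<le> n" "crystal_e n i b = Some b'" for b b' i
    using actN[of "fvar (AX Raising i)" "y b"] E_act[of b i] that by simp
  have F: "y b' \<in> N" if "b \<in> B" "y b \<in> N" "i \<le> n" "crystal_f n i b = Some b'" for b b' i
    using actN[of "fvar (AX Lowering i)" "y b"] F_act[of b i] that by simp
  have to_base: "y b \<in> N \<longrightarrow> y b0 \<in> N" if "b \<in> subcrystal n b0" for b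
    using that
  proof induction
    case (subcrystal_e m i m')
    have m: "m \<in> B" using subcrystal_e(1) subcrystal_subset by blast
    show ?case using e_f[OF m subcrystal_e(2,3)] F[of m' i m] subcrystal_e by blast
  next
    case (subcrystal_f m i m')
    have m: "m \<in> B" using subcrystal_f(1) subcrystal_subset by blast
    show ?case using f_pairing(3,4)[OF m subcrystal_f(2,3)] E[of m' i m] subcrystal_f by blast
  qed simp
  have from_base: "y b \<in> N" if "b \<in> subcrystal n b0" "y b0 \<in> N" for b
    using that
  proof induction
    case (subcrystal_e m i m')
    then show ?case using E[of m i m'] subcrystal_subset by blast
  next
    case (subcrystal_f m i m')
    then show ?case using F[of m i m'] subcrystal_subset by blast
  qed
  have all: "y b' \<in> N" if "b' \<in> B" for b'
    using to_base[of b] from_base[of b'] assms(2,3) that connected by blast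
  have "lin y c \<in> N" if "supp c \<subseteq> B" for c
  proof -
    have "supp c \<subseteq> B \<and> lin y c \<in> N"
    proof (rule poly_mapping_add_induct[OF _ _ _ that])
      fix b and a :: complex assume b: "b \<in> B"
      have "act (fscal a) (y b) \<in> N" by (rule actN[OF fa_fscal all[OF b]])
      then show "supp (Poly_Mapping.single b a) \<subseteq> B \<and> lin y (Poly_Mapping.single b a) \<in> N"
        using b y_closed[OF b] keys_single_subset[OF b] by (simp add: act_scal)
    qed (auto simp: lin_add_B keys_add_subset intro: N.a_closed)
    then show ?thesis by simp
  qed
  then have "lin y (coord x) \<in> N" if "x \<in> carrier M" for x using coord(1)[OF that] by blast
  then have "carrier M \<subseteq> N" using coord(2) by force
  then show ?thesis using N.a_subset by blast
qed

lemma simple: "simple_left_module (Uaff n t) M"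
  unfolding simple_left_module_def
proof (intro conjI allI impI)
  show "left_module (Uaff n t) M" by (rule left_module_axioms)
  show "carrier M \<noteq> {\<zero>\<^bsub>M\<^esub>}" using y_nonzero[OF b0] y_closed[OF b0] by blast
  fix N assume N: "left_submodule (Uaff n t) M N"
  interpret N: additive_subgroup N M using N by (simp add: left_submodule_def)
  show "N = {\<zero>\<^bsub>M\<^esub>} \<or> N = carrier M"
  proof (cases "N = {\<zero>\<^bsub>M\<^esub>}")
    case False
    then obtain x where x: "x \<in> N" "x \<noteq> \<zero>\<^bsub>M\<^esub>" using N.zero_closed by blast
    then have xM: "x \<in> carrier M" using N.a_subset by blast
    have "coord x \<noteq> 0" using coord(2)[OF xM] x(2) by auto
    then obtain b where "b \<in> B" "y b \<in> N"
      using submodule_contains_basis_vector[OF N coord(1)[OF xM]] coord(2)[OF xM] x(1) by auto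
    then show ?thesis using submodule_eq_carrier[OF N] by blast
  qed simp
qed

lemma generated:
  assumes "z \<in> carrier M" shows "\<exists>a\<in>carrier (Uaff n t). a \<odot>\<^bsub>M\<^esub> y b0 = z"
proof -
  let ?N = "{a \<odot>\<^bsub>M\<^esub> y b0 | a. a \<in> carrier (Uaff n t)}"
  note yb = y_closed[OF b0]
  have "left_submodule (Uaff n t) M ?N"
    unfolding left_submodule_def
  proof (intro conjI ballI)
    show "additive_subgroup ?N M"
    proof (rule additive_subgroup.intro, rule M.add.subgroupI)
      show "?N \<subseteq> carrier M" using yb by (auto simp: smult_closed)
      show "?N \<noteq> {}" by auto
      show "\<ominus>\<^bsub>M\<^esub> u \<in> ?N" if u: "u \<in> ?N" for u
      proof -
        obtain a where a: "a \<in> carrier (Uaff n t)" "u = a \<odot>\<^bsub>M\<^esub> y b0" using u by blast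
        have "\<ominus>\<^bsub>M\<^esub> u = (\<ominus>\<^bsub>Uaff n t\<^esub> a) \<odot>\<^bsub>M\<^esub> y b0"
          using smult_l_distr[of "\<ominus>\<^bsub>Uaff n t\<^esub> a" a "y b0"] a yb
          by (intro M.minus_equality) (auto simp: R.l_neg smult_closed)
        then show ?thesis using a by blast
      qed
      show "u \<oplus>\<^bsub>M\<^esub> w \<in> ?N" if "u \<in> ?N" "w \<in> ?N" for u w
        using that yb by (auto simp: smult_l_distr[symmetric])
    qed
    show "a \<odot>\<^bsub>M\<^esub> u \<in> ?N" if "a \<in> carrier (Uaff n t)" "u \<in> ?N" for a u
      using that yb by (auto simp: smult_assoc1[symmetric])
  qed
  moreover have "y b0 \<in> ?N" using yb smult_one by (auto intro!: exI[of _ "\<one>\<^bsub>Uaff n t\<^esub>"])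
  ultimately have "?N = carrier M" using submodule_eq_carrier b0 by blast
  then have "z \<in> ?N" using assms by simp
  then show ?thesis by auto
qed

sublocale cyc: cyclic_module "Uaff n t" M "y b0"
  by unfold_locales (auto simp: y_closed b0 generated)

end

section \<open>Extremality and the universal property\<close>

context crystal_basis
begin

text \<open>
  Comparison of coefficients, as different weights are separated by a Cartan element.
\<close>

lemma weight_space_iff:
  assumes \<mu>: "\<mu> \<in> weight_lattice n" and x: "x \<in> carrier M"
  shows "x \<in> weight_space n t M \<mu> \<longleftrightarrow> (\<forall>b\<in>supp (coord x). ywt b = \<mu>)"
proof
  assume w: "x \<in> weight_space n t M \<mu>"
  show "\<forall>b\<in>supp (coord x). ywt b = \<mu>"
  proof (rule ballI, rule ccontr)
    fix b assume b: "b \<in> supp (coord x)" and ne: "ywt b \<noteq> \<mu>"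
    have bB: "b \<in> B" using b coord(1)[OF x] by blast
    obtain h where h: "h \<in> cartan_space n" "pairing (ywt b) h \<noteq> pairing \<mu> h"
      using separate_weights[OF wt_lattice[OF bB] \<mu> ne] by blast
    have K: "fvar (AK h) \<in> FA" using h(1) by simp
    have kc: "y ` supp (coord x) \<subseteq> carrier M" by (rule y_sub[OF coord(1)[OF x]])
    let ?d = "Poly_Mapping.mapp (\<lambda>m a. qpow t (pairing (ywt m) h) * a) (coord x)"
    let ?e = "Poly_Mapping.mapp (\<lambda>m a. qpow t (pairing \<mu> h) * a) (coord x)"
    have "lin y ?d = act (fvar (AK h)) (lin y (coord x))"
      using coord(1)[OF x] h(1)
      by (intro act_lin_diagonal[OF K kc, symmetric]) (auto intro!: K_act)
    also have "\<dots> = scal (qpow t (pairing \<mu> h)) x"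
      using w h(1) coord(2)[OF x] by (simp add: weight_space_def act_def scal_def)
    also have "\<dots> = act (fscal (qpow t (pairing \<mu> h))) (lin y (coord x))"
      using coord(2)[OF x] by (simp add: act_scal)
    also have "\<dots> = lin y ?e"
      by (intro act_lin_diagonal[OF fa_fscal kc]) (simp add: act_scal)
    finally have "lin y ?d = lin y ?e" .
    moreover have "supp ?d \<subseteq> B" "supp ?e \<subseteq> B"
      by (rule subset_trans[OF keys_mapp_subset coord(1)[OF x]])+
    ultimately have "?d = ?e" using coord_lin by metis
    then have "coef ?d b = coef ?e b" by simp
    then show False using b h(2) by (simp add: lookup_mapp qpow_inj in_keys_iff)
  qed
next
  assume k: "\<forall>b\<in>supp (coord x). ywt b = \<mu>"
  have kc: "y ` supp (coord x) \<subseteq> carrier M" by (rule y_sub[OF coord(1)[OF x]])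
  have "act (fvar (AK h)) x = act (fscal (qpow t (pairing \<mu> h))) x" if h: "h \<in> cartan_space n" for h
  proof -
    let ?e = "Poly_Mapping.mapp (\<lambda>m a. qpow t (pairing \<mu> h) * a) (coord x)"
    have K: "fvar (AK h) \<in> FA" using h by simp
    have e1: "act (fvar (AK h)) (lin y (coord x)) = lin y ?e"
      using coord(1)[OF x] h k by (intro act_lin_diagonal[OF K kc]) (auto simp: K_act)
    have e2: "act (fscal (qpow t (pairing \<mu> h))) (lin y (coord x)) = lin y ?e"
      by (intro act_lin_diagonal[OF fa_fscal kc]) (simp add: act_scal)
    show ?thesis using e1 e2 coord(2)[OF x] by simp
  qed
  then show "x \<in> weight_space n t M \<mu>" using x by (simp add: weight_space_def act_def)
qed

text \<open>
  The weight space of a weight is spanned by the basis vector of this weight, so the components are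
  read off from the coordinates.
\<close>

lemma weight_decomposition:
  assumes x: "x \<in> carrier M"
  shows "\<exists>!c :: weight \<Rightarrow> 'v.
    (\<forall>\<mu>\<in>weight_lattice n. c \<mu> \<in> weight_space n t M \<mu>) \<and>
    (\<forall>\<mu>. \<mu> \<notin> weight_lattice n \<longrightarrow> c \<mu> = \<zero>\<^bsub>M\<^esub>) \<and>
    finite {\<mu>. c \<mu> \<noteq> \<zero>\<^bsub>M\<^esub>} \<and>
    x = (\<Oplus>\<^bsub>M\<^esub>\<mu>\<in>{\<mu>. c \<mu> \<noteq> \<zero>\<^bsub>M\<^esub>}. c \<mu>)"
    (is "\<exists>!c. ?P c")
proof (rule ex_ex1I)
  let ?K = "supp (coord x)"
  have K: "?K \<subseteq> B" by (rule coord(1)[OF x])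
  have injK: "inj_on ywt ?K" by (rule inj_on_subset[OF wt_inj K])
  let ?s = "\<lambda>b. scal (coef (coord x) b) (y b)"
  define c where "c \<mu> = (if \<mu> \<in> ywt ` ?K then ?s (inv_into ?K ywt \<mu>) else \<zero>\<^bsub>M\<^esub>)" for \<mu>
  have c_wt: "c (ywt b) = ?s b" if "b \<in> ?K" for b
    using that injK by (simp add: c_def)
  have c_out: "c \<mu> = \<zero>\<^bsub>M\<^esub>" if "\<mu> \<notin> ywt ` ?K" for \<mu> using that by (simp add: c_def)
  have s_closed: "?s b \<in> carrier M" if "b \<in> ?K" for b using that K y_closed by blast
  have c_closed: "c \<mu> \<in> carrier M" for \<mu>
  proof (cases "\<mu> \<in> ywt ` ?K")
    case True
    then obtain b where "b \<in> ?K" "\<mu> = ywt b" by blast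
    then show ?thesis using c_wt s_closed by simp
  qed (simp add: c_out)
  have sub: "{\<mu>. c \<mu> \<noteq> \<zero>\<^bsub>M\<^esub>} \<subseteq> ywt ` ?K" using c_out by blast
  have "(\<Oplus>\<^bsub>M\<^esub>\<mu>\<in>{\<mu>. c \<mu> \<noteq> \<zero>\<^bsub>M\<^esub>}. c \<mu>) = (\<Oplus>\<^bsub>M\<^esub>\<mu>\<in>ywt ` ?K. c \<mu>)"
    by (rule M.add.finprod_mono_neutral_cong_left) (use sub c_closed in auto)
  also have "\<dots> = (\<Oplus>\<^bsub>M\<^esub>b\<in>?K. c (ywt b))"
    by (rule M.finsum_reindex) (use injK c_closed in auto)
  also have "\<dots> = (\<Oplus>\<^bsub>M\<^esub>b\<in>?K. ?s b)"
    by (rule M.finsum_cong') (use c_wt s_closed in auto)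
  also have "\<dots> = x" using coord(2)[OF x] by (simp add: lin_def)
  finally have sum: "x = (\<Oplus>\<^bsub>M\<^esub>\<mu>\<in>{\<mu>. c \<mu> \<noteq> \<zero>\<^bsub>M\<^esub>}. c \<mu>)" by simp
  have "c \<mu> \<in> weight_space n t M \<mu>" if \<mu>: "\<mu> \<in> weight_lattice n" for \<mu>
  proof (cases "\<mu> \<in> ywt ` ?K")
    case True
    then obtain b where b: "b \<in> ?K" "\<mu> = ywt b" by blast
    then have "coord (c \<mu>) = Poly_Mapping.single b (coef (coord x) b)"
      using c_wt[OF b(1)] coord_scal_basis[OF subsetD[OF K b(1)]] by simp
    then show ?thesis using weight_space_iff[OF \<mu> c_closed] b by auto
  next
    case False
    then show ?thesis using weight_space_iff[OF \<mu>, of "\<zero>\<^bsub>M\<^esub>"] c_out by simp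
  qed
  moreover have "c \<mu> = \<zero>\<^bsub>M\<^esub>" if "\<mu> \<notin> weight_lattice n" for \<mu>
    using that wt_lattice K by (intro c_out) auto
  ultimately have "?P c" using sum finite_subset[OF sub] by simp
  then show "\<exists>c. ?P c" by blast
next
  fix c c' assume P: "?P c" "?P c'"
  have main: "coef (coord (c (ywt b))) b = coef (coord x) b"
    and closed: "c \<mu> \<in> carrier M"
    and wt: "b' \<in> supp (coord (c \<mu>)) \<Longrightarrow> ywt b' = \<mu>"
    if c: "?P c" and b: "b \<in> B" for c b b' \<mu>
  proof -
    have cl: "c \<nu> \<in> carrier M" for \<nu> 
      using c by (cases "\<nu> \<in> weight_lattice n") (auto simp: weight_space_def)
    then show "c \<mu> \<in> carrier M" .
    have wt: "ywt b' = \<nu>" if "b' \<in> supp (coord (c \<nu>))" for \<nu> b'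
    proof (cases "\<nu> \<in> weight_lattice n")
      case True
      then show ?thesis using c that weight_space_iff[OF True cl] by blast
    next
      case False
      then have "c \<nu> = \<zero>\<^bsub>M\<^esub>" using c by blast
      then show ?thesis using that by simp
    qed
    then show "b' \<in> supp (coord (c \<mu>)) \<Longrightarrow> ywt b' = \<mu>" .
    let ?S = "{\<mu>. c \<mu> \<noteq> \<zero>\<^bsub>M\<^esub>}"
    have fin: "finite ?S" and xs: "x = (\<Oplus>\<^bsub>M\<^esub>\<mu>\<in>?S. c \<mu>)" using c by blast+
    have "coord x = (\<Sum>\<mu>\<in>?S. coord (c \<mu>))"
      by (subst xs, rule coord_finsum) (use cl fin in auto)
    then have "coef (coord x) b = (\<Sum>\<mu>\<in>?S. coef (coord (c \<mu>)) b)"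
      by (simp add: lookup_sum)
    also have "\<dots> = (\<Sum>\<mu>\<in>?S. if \<mu> = ywt b then coef (coord (c \<mu>)) b else 0)"
    proof (rule sum.cong[OF refl])
      fix \<nu>
      show "coef (coord (c \<nu>)) b =
          (if \<nu> = ywt b then coef (coord (c \<nu>)) b else 0)"
        using wt[of b \<nu>] by (auto simp: in_keys_iff)
    qed
    also have "\<dots> = (if ywt b \<in> ?S then coef (coord (c (ywt b))) b else 0)"
      using fin by (simp add: sum.delta)
    also have "\<dots> = coef (coord (c (ywt b))) b" by auto
    finally show "coef (coord (c (ywt b))) b = coef (coord x) b" ..
  qed
  show "c = c'"
  proof
    fix \<mu>
    note m = main[OF P(1)] main[OF P(2)] and w = wt[OF P(1) b0] wt[OF P(2) b0]
      and cl = closed[OF P(1) b0] closed[OF P(2) b0]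
    have "coord (c \<mu>) = coord (c' \<mu>)"
    proof (rule poly_mapping_eqI)
      fix b
      show "coef (coord (c \<mu>)) b = coef (coord (c' \<mu>)) b"
      proof (cases "b \<in> B \<and> ywt b = \<mu>")
        case True
        then show ?thesis using m(1)[of b] m(2)[of b] by simp
      next
        case False
        then have "b \<notin> supp (coord (c \<mu>))" "b \<notin> supp (coord (c' \<mu>))"
          using coord(1)[OF cl(1)[of \<mu>]] coord(1)[OF cl(2)[of \<mu>]] w by blast+
        then show ?thesis by (simp add: in_keys_iff)
      qed
    qed
    then show "c \<mu> = c' \<mu>" using coord(2) cl by metis
  qed
qed

text \<open>
  Two arrows of the same colour are never composable.
\<close>

lemma square_zero:
  assumes i: "i \<le> n" and x: "x \<in> carrier M"
  shows "act (fvar (AX p i) * fvar (AX p i)) x = \<zero>\<^bsub>M\<^esub>"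
proof -
  let ?g = "fvar (AX p i)"
  have F: "?g \<in> FA" using i by simp
  have b: "act (?g * ?g) (y b) = scal 0 (y b)" if "b \<in> B" for b
  proof (cases p)
    case Raising
    show ?thesis
    proof (cases "crystal_e n i b")
      case None
      then show ?thesis using E_act[OF that i] F y_closed[OF that] Raising by (simp add: act_mult)
    next
      case (Some b')
      note f = e_f[OF that i Some]
      have "crystal_e n i b' = None" using not_both[OF f(1) i] f(2) by simp
      then show ?thesis using E_act[OF that i] E_act[OF f(1) i] Some F y_closed[OF that] Raising
        by (simp add: act_mult)
    qed
  next
    case Lowering
    show ?thesis
    proof (cases "crystal_f n i b")
      case None
      then show ?thesis using F_act[OF that i] F y_closed[OF that] Lowering by (simp add: act_mult)
    next
      case (Some b')
      note f = f_pairing(3,4)[OF that i Some]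
      have "crystal_f n i b' = None" using not_both[OF f(2) i] f(1) by auto
      then show ?thesis using F_act[OF that i] F_act[OF f(2) i] Some F y_closed[OF that] Lowering
        by (simp add: act_mult)
    qed
  qed
  have "act (?g * ?g) (lin y (coord x)) = lin y (Poly_Mapping.mapp (\<lambda>b a. 0 * a) (coord x))"
  proof (rule act_lin_diagonal)
    show "act (?g * ?g) (y b') = scal 0 (y b')" if "b' \<in> supp (coord x)" for b'
      using b coord(1)[OF x] that by blast
  qed (use F y_sub[OF coord(1)[OF x]] in auto)
  also have "Poly_Mapping.mapp (\<lambda>b a. 0 * a) (coord x) = (0 :: ymonomial \<Rightarrow>\<^sub>0 complex)"
    by (rule poly_mapping_eqI) (simp add: lookup_mapp)
  finally show ?thesis using coord(2)[OF x] by simp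
qed

lemma integrable: "integrable_module n t M"
  unfolding integrable_module_def
proof (intro conjI ballI allI impI weight_decomposition)
  fix p i x assume i: "i \<le> n" and x: "x \<in> carrier M"
  have "aff_class n t (fvar (AX p i)) [^]\<^bsub>Uaff n t\<^esub> (2::nat) \<odot>\<^bsub>M\<^esub> x = \<zero>\<^bsub>M\<^esub>"
    using square_zero[OF i x, of p] i U_cls_power[of "fvar (AX p i)" 2]
    by (simp add: act_def power2_eq_square)
  then show "\<exists>N::nat. aff_class n t (fvar (AX p i)) [^]\<^bsub>Uaff n t\<^esub> N \<odot>\<^bsub>M\<^esub> x = \<zero>\<^bsub>M\<^esub>" by blast
qed

definition orbit_point :: "(weight \<Rightarrow> weight) \<Rightarrow> ymonomial" where
  "orbit_point w = (SOME b. b \<in> B \<and> ywt b = w (ywt b0))"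

lemma orbit_point: "w \<in> weyl_group n \<Longrightarrow> orbit_point w \<in> B \<and> ywt (orbit_point w) = w (ywt b0)"
  unfolding orbit_point_def 
  using someI_ex[of "\<lambda>b. b \<in> B \<and> ywt b = w (ywt b0)"] weyl_orbit[of w] by blast

lemma orbit_point_eq: "\<lbrakk>w \<in> weyl_group n; b \<in> B; ywt b = w (ywt b0)\<rbrakk> \<Longrightarrow> orbit_point w = b"
  using orbit_point[of w] inj_onD[OF wt_inj, of "orbit_point w" b] by simp

text \<open>
  The companion attached to \<open>w\<close> is the basis vector whose weight is the image under \<open>w\<close>.
\<close>

lemma extremal: "extremal_vector n t M (ywt b0) (y b0)"
  unfolding extremal_vector_def
proof (intro conjI exI[of _ "\<lambda>w. y (orbit_point w)"] ballI allI impI)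
  show "left_module (Uaff n t) M" by (rule left_module_axioms)
  show "integrable_module n t M" by (rule integrable)
  show "y b0 \<in> weight_space n t M (ywt b0)"
    using y_closed[OF b0] K_act[OF b0] by (simp add: weight_space_def act_def scal_def)
  show "y (orbit_point w) \<in> carrier M" if "w \<in> weyl_group n" for w
    using that orbit_point y_closed by blast
  show "y (orbit_point id) = y b0" using orbit_point_eq[OF weyl_id b0] by simp
  fix w i assume w: "w \<in> weyl_group n" and i: "i \<le> n"
  define b where "b = orbit_point w"
  have b: "b \<in> B" "ywt b = w (ywt b0)" using orbit_point[OF w] by (auto simp: b_def)
  have sw: "simple_reflection n i \<circ> w \<in> weyl_group n" by (rule weyl_refl[OF w i])
  note yb = y_closed[OF b(1)]
  let ?p = "coef (ywt b) (Hidx i)" and ?sb = "orbit_point (simple_reflection n i \<circ> w)"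
  have fixed: "?sb = b" if "?p = 0"
    using reflection_zero[OF that] b by (intro orbit_point_eq[OF sw]) auto
  have nonneg: "0 \<le> ?p \<longrightarrow> act (fvar (AX Raising i)) (y b) = \<zero>\<^bsub>M\<^esub> \<and>
      divided_power n t Lowering i (nat \<lfloor>?p\<rfloor>) \<odot>\<^bsub>M\<^esub> y b = y ?sb"
    using b(1) i
  proof (cases rule: wt_trichotomy)
    case (up b')
    have "?sb = b'"
      using reflection_f(1)[OF b(1) i up(1)] f_pairing(4)[OF b(1) i up(1)] b(2)
      by (intro orbit_point_eq[OF sw]) auto
    then show ?thesis using up E_act[OF b(1) i] F_act[OF b(1) i] divided_power_1[OF yb i] by simp
  next
    case (down b')
    then show ?thesis by simp
  next
    case zero
    then show ?thesis using fixed E_act[OF b(1) i] divided_power_0[OF yb i] by simp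
  qed
  have nonpos: "?p \<le> 0 \<longrightarrow> act (fvar (AX Lowering i)) (y b) = \<zero>\<^bsub>M\<^esub> \<and>
      divided_power n t Raising i (nat \<lfloor>- ?p\<rfloor>) \<odot>\<^bsub>M\<^esub> y b = y ?sb"
    using b(1) i
  proof (cases rule: wt_trichotomy)
    case (up b')
    then show ?thesis by simp
  next
    case (down b')
    note f = e_f[OF b(1) i down(2)]
    have "?sb = b'"
      using reflection_f(2)[OF f(1) i f(2)] f(1) b(2) by (intro orbit_point_eq[OF sw]) auto
    then show ?thesis using down E_act[OF b(1) i] F_act[OF b(1) i] divided_power_1[OF yb i] by simp
  next
    case zero
    then show ?thesis using fixed F_act[OF b(1) i] divided_power_0[OF yb i] by simp
  qed
  show "aff_class n t (fvar (AX Raising i)) \<odot>\<^bsub>M\<^esub> y (orbit_point w) = \<zero>\<^bsub>M\<^esub>"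
    "divided_power n t Lowering i (nat \<lfloor>pairing (w (ywt b0)) (coroot i)\<rfloor>) \<odot>\<^bsub>M\<^esub> y (orbit_point w) =
      y (orbit_point (simple_reflection n i \<circ> w))"
    if "0 \<le> pairing (w (ywt b0)) (coroot i)"
    using nonneg that unfolding b_def[symmetric] pairing_coroot b(2) act_def by blast+
  show "aff_class n t (fvar (AX Lowering i)) \<odot>\<^bsub>M\<^esub> y (orbit_point w) = \<zero>\<^bsub>M\<^esub>"
    "divided_power n t Raising i (nat \<lfloor>- pairing (w (ywt b0)) (coroot i)\<rfloor>) \<odot>\<^bsub>M\<^esub> y (orbit_point w) =
      y (orbit_point (simple_reflection n i \<circ> w))"
    if "pairing (w (ywt b0)) (coroot i) \<le> 0"
    using nonpos that unfolding b_def[symmetric] pairing_coroot b(2) act_def by blast+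
qed

text \<open>
  Transport of structure. The extremal weight module is defined by ideals, hence extremality is
  needed for the quotient by the annihilator and not only for the module itself.
\<close>

lemma quotient_crystal_basis: "crystal_basis n B b0 t cyc.Q (\<lambda>b. cyc.fibre (y b))"
proof -
  let ?z = "\<lambda>b. cyc.fibre (y b)"
  interpret Q: left_module "Uaff n t" cyc.Q by (rule cyc.quotient_module)
  interpret Q: affine_module n t cyc.Q ..
  have act: "Q.act f (cyc.fibre x) = cyc.fibre (act f x)" if "f \<in> FA" "x \<in> carrier M" for f x
    using that by (simp add: Q.act_def act_def cyc.fibre_smult)
  have scal: "Q.scal a (cyc.fibre x) = cyc.fibre (scal a x)" if "x \<in> carrier M" for a x
    using act[OF fa_fscal that] by (simp add: Q.act_scal act_scal)
  have opt: "opt_vec cyc.Q ?z u = cyc.fibre (opt_vec M y u)" for u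
    by (cases u) (simp_all add: cyc.fibre_zero)
  have closed: "?z b \<in> carrier cyc.Q" if "b \<in> B" for b
    using y_closed[OF that] by (simp add: cyc.quotient_carrier)
  interpret Q: crystal_family n t cyc.Q B ?z
    by unfold_locales (auto simp: closed act scal opt y_closed K_act E_act F_act)
  have lin: "Q.lin ?z c = cyc.fibre (lin y c)" if "supp c \<subseteq> B" for c
  proof -
    have "supp c \<subseteq> B \<and> Q.lin ?z c = cyc.fibre (lin y c)"
    proof (rule poly_mapping_add_induct[OF _ _ _ that])
      fix b and a :: complex assume b: "b \<in> B"
      show "supp (Poly_Mapping.single b a) \<subseteq> B \<and>
          Q.lin ?z (Poly_Mapping.single b a) = cyc.fibre (lin y (Poly_Mapping.single b a))"
        using b closed[OF b] y_closed[OF b]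
        by (simp add: scal Q.lin_single[of ?z b])
    qed (auto simp: lin_add_B Q.lin_add_B keys_add_subset cyc.fibre_add cyc.fibre_zero)
    then show ?thesis by simp
  qed
  show ?thesis
  proof unfold_locales
    fix X assume "X \<in> carrier cyc.Q"
    then obtain x where x: "x \<in> carrier M" "X = cyc.fibre x" by (auto simp: cyc.quotient_carrier)
    have "X = Q.lin ?z c \<longleftrightarrow> x = lin y c" if "supp c \<subseteq> B" for c
      using x lin[OF that] inj_onD[OF cyc.fibre_inj, of x "lin y c"] lin_closed_B[OF that] by auto
    then show "\<exists>!c. supp c \<subseteq> B \<and> X = Q.lin ?z c"
      using basis[OF x(1)] by metis
  qed
qed

text \<open>
  The extremal vector extends to a crystal family, in which an algebra element has the same
  coefficients as in the given module; there they vanish, because the family is a basis.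
\<close>

lemma annihilates_extremal:
  assumes ext: "extremal_vector n t M' (ywt b0) x'" and a: "a \<in> carrier (Uaff n t)"
    and zero: "a \<odot>\<^bsub>M\<^esub> y b0 = \<zero>\<^bsub>M\<^esub>"
  shows "a \<odot>\<^bsub>M'\<^esub> x' = \<zero>\<^bsub>M'\<^esub>"
proof -
  interpret M': left_module "Uaff n t" M' using ext by (simp add: extremal_vector_def)
  interpret M': affine_module n t M' ..
  obtain v where v: "\<forall>w\<in>weyl_group n. v w \<in> carrier M'" "v id = x'" and
    v2: "\<forall>w\<in>weyl_group n. \<forall>i\<le>n.
           (pairing (w (ywt b0)) (coroot i) \<ge> 0 \<longrightarrow>
              aff_class n t (fvar (AX Raising i)) \<odot>\<^bsub>M'\<^esub> v w = \<zero>\<^bsub>M'\<^esub> \<and>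
              divided_power n t Lowering i (nat \<lfloor>pairing (w (ywt b0)) (coroot i)\<rfloor>) \<odot>\<^bsub>M'\<^esub> v w
                = v (simple_reflection n i \<circ> w)) \<and>
           (pairing (w (ywt b0)) (coroot i) \<le> 0 \<longrightarrow>
              aff_class n t (fvar (AX Lowering i)) \<odot>\<^bsub>M'\<^esub> v w = \<zero>\<^bsub>M'\<^esub> \<and>
              divided_power n t Raising i (nat \<lfloor>- pairing (w (ywt b0)) (coroot i)\<rfloor>) \<odot>\<^bsub>M'\<^esub> v w
                = v (simple_reflection n i \<circ> w))"
    using ext unfolding extremal_vector_def by blast
  have weight: "x' \<in> weight_space n t M' (ywt b0)" using ext by (simp add: extremal_vector_def)
  interpret E: minuscule_extremal n B b0 t M' x' v
  proof
    show "M'.act (fvar (AK h)) x' = M'.scal (qpow t (pairing (ywt b0) h)) x'" if "h \<in> cartan_space n" for h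
      using weight that by (simp add: weight_space_def M'.act_def M'.scal_def)
    show "v w \<in> carrier M'" if "w \<in> weyl_group n" for w using v(1) that by blast
    show "v id = x'" by (rule v(2))
    fix w i assume w: "w \<in> weyl_group n" and i: "i \<le> n"
    let ?p = "coef (w (ywt b0)) (Hidx i)"
    note cond = v2[rule_format, OF w i, unfolded pairing_coroot]
    have vw: "v w \<in> carrier M'" using v(1) w by blast
    show "M'.act (fvar (AX Raising i)) (v w) = \<zero>\<^bsub>M'\<^esub>" if "0 \<le> ?p"
      using cond that by (simp add: M'.act_def)
    show "M'.act (fvar (AX Lowering i)) (v w) = \<zero>\<^bsub>M'\<^esub>" if "?p \<le> 0"
      using cond that by (simp add: M'.act_def)
    show "M'.act (fvar (AX Lowering i)) (v w) = v (simple_reflection n i \<circ> w)" if "?p = 1"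
      using cond that M'.divided_power_1[OF vw i] by simp
    show "M'.act (fvar (AX Raising i)) (v w) = v (simple_reflection n i \<circ> w)" if "?p = -1"
      using cond that M'.divided_power_1[OF vw i] by simp
  qed
  obtain f where f: "f \<in> FA" "a = aff_class n t f" using a U_carrier by blast
  have fam: "crystal_family n t M B y" by unfold_locales
  have cs: "crystal_set n B" by unfold_locales
  obtain c where c: "supp c \<subseteq> B" "a \<odot>\<^bsub>M\<^esub> y b0 = lin y c"
    "a \<odot>\<^bsub>M'\<^esub> x' = M'.lin E.vec c"
    using crystal_families_parallel[OF cs fam E.vec_family b0 f(1)] E.vec_b0 f(2) by auto
  have "lin y c = \<zero>\<^bsub>M\<^esub>" using c(2) zero by simp
  then have "c = 0" using coord_lin[OF c(1)] coord_zero by metis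
  then show ?thesis using c(3) by simp
qed

text \<open>
  The annihilator is itself one of the ideals that are intersected, and it is contained in all of
  them. Membership in such an ideal is recovered from the action on the coset of 1.
\<close>

lemma extremal_ideal_eq: "extremal_left_ideal n t (ywt b0) = cyc.ann"
proof
  interpret Q: crystal_basis n B b0 t cyc.Q "\<lambda>b. cyc.fibre (y b)" by (rule quotient_crystal_basis)
  have "cyc.ann +>\<^bsub>Uaff n t\<^esub> \<one>\<^bsub>Uaff n t\<^esub> = cyc.fibre (y b0)"
    using cyc.coset_fibre[of "\<one>\<^bsub>Uaff n t\<^esub>"] smult_one[OF y_closed[OF b0]] by simp
  then have "extremal_vector n t cyc.Q (ywt b0) (cyc.ann +>\<^bsub>Uaff n t\<^esub> \<one>\<^bsub>Uaff n t\<^esub>)"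
    using Q.extremal by simp
  then show "extremal_left_ideal n t (ywt b0) \<subseteq> cyc.ann"
    unfolding extremal_left_ideal_def using cyc.ann_ideal by blast
  show "cyc.ann \<subseteq> extremal_left_ideal n t (ywt b0)"
    unfolding extremal_left_ideal_def
  proof (intro Inter_greatest subsetI)
    fix J a
    assume "J \<in> {J. left_ideal (Uaff n t) J \<and> extremal_vector n t (quotient_left_module (Uaff n t) J)
      (ywt b0) (J +>\<^bsub>Uaff n t\<^esub> \<one>\<^bsub>Uaff n t\<^esub>)}" and a: "a \<in> cyc.ann"
    then have J: "left_ideal (Uaff n t) J" and ext: "extremal_vector n t (quotient_left_module (Uaff n t) J)
      (ywt b0) (J +>\<^bsub>Uaff n t\<^esub> \<one>\<^bsub>Uaff n t\<^esub>)" by auto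
    interpret J: additive_subgroup J "Uaff n t" using J by (simp add: left_ideal_def)
    have aU: "a \<in> carrier (Uaff n t)" "a \<odot>\<^bsub>M\<^esub> y b0 = \<zero>\<^bsub>M\<^esub>" using a by (auto simp: cyc.ann_def)
    from annihilates_extremal[OF ext this]
    have U: "(\<Union>c\<in>J +>\<^bsub>Uaff n t\<^esub> \<one>\<^bsub>Uaff n t\<^esub>. J +>\<^bsub>Uaff n t\<^esub> (a \<otimes>\<^bsub>Uaff n t\<^esub> c)) = J"
      by (simp add: quotient_left_module_def)
    have "\<one>\<^bsub>Uaff n t\<^esub> \<in> J +>\<^bsub>Uaff n t\<^esub> \<one>\<^bsub>Uaff n t\<^esub>"
      using J.zero_closed by (auto simp: a_r_coset_def r_coset_def intro!: bexI[of _ "\<zero>\<^bsub>Uaff n t\<^esub>"])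
    moreover have "a \<in> J +>\<^bsub>Uaff n t\<^esub> (a \<otimes>\<^bsub>Uaff n t\<^esub> \<one>\<^bsub>Uaff n t\<^esub>)"
      using J.zero_closed aU(1) by (auto simp: a_r_coset_def r_coset_def intro!: bexI[of _ "\<zero>\<^bsub>Uaff n t\<^esub>"])
    ultimately show "a \<in> J" using U by blast
  qed
qed

theorem isomorphic_to_extremal_weight_module:
  "isomorphic_left_modules (Uaff n t) M (extremal_weight_module n t (ywt b0))"
  unfolding isomorphic_left_modules_def extremal_weight_module_def extremal_ideal_eq
  using left_module_axioms cyc.quotient_module cyc.fibre_iso by blast

end

section \<open>Monomials with at most one variable per vertex\<close>

lemma yexp_diff: "yexp (b - m) i k = yexp b i k - yexp m i k"
  by (simp add: yexp_def lookup_minus)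

lemma yexp_add: "yexp (b + m) i k = yexp b i k + yexp m i k"
  by (simp add: yexp_def lookup_add)

lemma phi_upto_single:
  assumes "\<And>k. yexp b i k = (if k = a then e else 0)"
  shows "phi_upto i L b = (if a \<le> L then e else 0)"
proof -
  have "{k. k \<in> ysupp b i \<and> k \<le> L} = (if e \<noteq> 0 \<and> a \<le> L then {a} else {})"
    by (auto simp: ysupp_def assms split: if_splits)
  then show ?thesis by (simp add: phi_upto_def assms)
qed

lemma eps_from_single:
  assumes "\<And>k. yexp b i k = (if k = a then e else 0)"
  shows "eps_from i L b = (if L \<le> a then - e else 0)"
proof -
  have "{k. k \<in> ysupp b i \<and> L \<le> k} = (if e \<noteq> 0 \<and> L \<le> a then {a} else {})"
    by (auto simp: ysupp_def assms split: if_splits)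
  then show ?thesis by (simp add: eps_from_def assms)
qed

text \<open>
  The functions whose maxima define the crystal structure are step functions with two values.
\<close>

lemma range_threshold:
  "range (\<lambda>L::int. if a \<le> L then x else y) = {x, y}" "range (\<lambda>L::int. if L \<le> a then x else y) = {x, y}"
proof -
  have "x \<in> range (\<lambda>L::int. if a \<le> L then x else y)" "y \<in> range (\<lambda>L::int. if a \<le> L then x else y)"
    by (rule range_eqI[of _ _ a], simp) (rule range_eqI[of _ _ "a - 1"], simp)
  then show "range (\<lambda>L::int. if a \<le> L then x else y) = {x, y}" by auto
  have "x \<in> range (\<lambda>L::int. if L \<le> a then x else y)" "y \<in> range (\<lambda>L::int. if L \<le> a then x else y)"
    by (rule range_eqI[of _ _ a], simp) (rule range_eqI[of _ _ "a + 1"], simp)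
  then show "range (\<lambda>L::int. if L \<le> a then x else y) = {x, y}" by auto
qed

lemma crystal_phi_single:
  assumes "\<And>k. yexp b i k = (if k = a then e else 0)"
  shows "crystal_phi i b = max e 0"
  unfolding crystal_phi_def phi_upto_single[OF assms] range_threshold by simp

lemma crystal_eps_single:
  assumes "\<And>k. yexp b i k = (if k = a then e else 0)"
  shows "crystal_eps i b = max (- e) 0"
  unfolding crystal_eps_def eps_from_single[OF assms] range_threshold by simp

lemma crystal_plus:
  assumes "\<And>k. yexp b i k = (if k = a then 1 else 0)"
  shows "crystal_f n i b = Some (b - Amon n i (a + 1))" "crystal_e n i b = None"
proof -
  have "crystal_q i b = a"
    unfolding crystal_q_def crystal_phi_single[OF assms] phi_upto_single[OF assms]
    by (rule Least_equality) (auto split: if_splits)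
  then show "crystal_f n i b = Some (b - Amon n i (a + 1))"
    by (simp add: crystal_f_def crystal_phi_single[OF assms])
  show "crystal_e n i b = None" by (simp add: crystal_e_def crystal_eps_single[OF assms])
qed

lemma crystal_minus:
  assumes "\<And>k. yexp b i k = (if k = a then - 1 else 0)"
  shows "crystal_e n i b = Some (b + Amon n i (a - 1))" "crystal_f n i b = None"
proof -
  have "crystal_p i b = a"
    unfolding crystal_p_def crystal_eps_single[OF assms] eps_from_single[OF assms]
    by (rule Greatest_equality) (auto split: if_splits)
  then show "crystal_e n i b = Some (b + Amon n i (a - 1))"
    by (simp add: crystal_e_def crystal_eps_single[OF assms])
  show "crystal_f n i b = None" by (simp add: crystal_f_def crystal_phi_single[OF assms])
qed

lemma crystal_none:
  assumes "\<And>k. yexp b i k = 0"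
  shows "crystal_e n i b = None" "crystal_f n i b = None"
  using crystal_phi_single[of b i 0 0] crystal_eps_single[of b i 0 0] assms
  by (simp_all add: crystal_e_def crystal_f_def)

lemma neighbours:
  fixes i n :: nat
  assumes "2 \<le> n" "i \<le> n"
  shows "(i + 1) mod (n + 1) \<le> n" "(i + n) mod (n + 1) \<le> n"
    "(i + 1) mod (n + 1) \<noteq> i" "(i + n) mod (n + 1) \<noteq> i" "(i + 1) mod (n + 1) \<noteq> (i + n) mod (n + 1)"
    "((i + 1) mod (n + 1) + n) mod (n + 1) = i" "((i + n) mod (n + 1) + 1) mod (n + 1) = i"
proof -
  show s: "(i + 1) mod (n + 1) \<le> n" and p: "(i + n) mod (n + 1) \<le> n"
    unfolding mod_succ[OF assms(2)] mod_pred[OF assms(2)] using assms by auto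
  show "(i + 1) mod (n + 1) \<noteq> i" "(i + n) mod (n + 1) \<noteq> i" "(i + 1) mod (n + 1) \<noteq> (i + n) mod (n + 1)"
    unfolding mod_succ[OF assms(2)] mod_pred[OF assms(2)] using assms by auto
  show "((i + 1) mod (n + 1) + n) mod (n + 1) = i"
    unfolding mod_pred[OF s] unfolding mod_succ[OF assms(2)] using assms by auto
  show "((i + n) mod (n + 1) + 1) mod (n + 1) = i"
    unfolding mod_succ[OF p] unfolding mod_pred[OF assms(2)] using assms by auto
qed

lemma yexp_Amon_self:
  assumes "2 \<le> n" "i \<le> n"
  shows "yexp (Amon n i k) i l = (if l = k - 1 \<or> l = k + 1 then 1 else 0)"
  using neighbours(3,4)[OF assms]
  by (auto simp: yexp_def Amon_def lookup_minus lookup_add lookup_single when_def)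

lemma yexp_Amon_far:
  assumes "i \<le> n" "j \<le> n" "i \<noteq> j" "cartan_matrix n i j = 0"
  shows "yexp (Amon n i k) j l = 0"
  using assms cartan_matrix_cases[OF assms(1,2)]
  by (auto simp: yexp_def Amon_def lookup_minus lookup_add lookup_single when_def split: if_splits)

text \<open>
  The notion is formulated by exponents, so that it can be checked on explicit families. It concerns
  a union of components of the crystal and passes to each component.
\<close>

locale minuscule_monomials =
  fixes n :: nat and B :: "ymonomial set"
  assumes n_ge: "3 \<le> n"
    and single_exponent: "\<lbrakk>b \<in> B; i \<le> n\<rbrakk> \<Longrightarrow> \<exists>a e. (e = 1 \<or> e = -1 \<or> e = 0) \<and>
      coef (ywt b) (Hidx i) = of_int e \<and> (\<forall>k. yexp b i k = (if k = a then e else 0))"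
    and plus_closed: "\<lbrakk>b \<in> B; i \<le> n; yexp b i a = 1\<rbrakk> \<Longrightarrow> b - Amon n i (a + 1) \<in> B"
    and minus_closed: "\<lbrakk>b \<in> B; i \<le> n; yexp b i a = - 1\<rbrakk> \<Longrightarrow> b + Amon n i (a - 1) \<in> B"
    and plus_far: "\<lbrakk>b \<in> B; i \<le> n; j \<le> n; i \<noteq> j; yexp b i a = 1; yexp b j a' = 1\<rbrakk> \<Longrightarrow>
      cartan_matrix n i j = 0"
    and weights: "b \<in> B \<Longrightarrow> supp (ywt b) \<subseteq> cartan_indices n"
    and weights_inj: "inj_on ywt B"
begin

lemma sign_cases:
  assumes "b \<in> B" "i \<le> n"
  obtains (plus) a where "\<And>k. yexp b i k = (if k = a then 1 else 0)"
      "coef (ywt b) (Hidx i) = 1"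
    | (minus) a where "\<And>k. yexp b i k = (if k = a then - 1 else 0)"
      "coef (ywt b) (Hidx i) = - 1"
    | (none) "\<And>k. yexp b i k = 0" "coef (ywt b) (Hidx i) = 0"
proof -
  obtain a e where ae: "e = 1 \<or> e = -1 \<or> e = 0" "coef (ywt b) (Hidx i) = of_int e"
    "\<And>k. yexp b i k = (if k = a then e else 0)"
    using single_exponent[OF assms] by blast
  show ?thesis
    using ae(1)
  proof (elim disjE)
    assume "e = 1" then show ?thesis using plus[of a] ae(2,3) by simp
  next
    assume "e = - 1" then show ?thesis using minus[of a] ae(2,3) by simp
  next
    assume "e = 0" then show ?thesis using none ae(2,3) by simp
  qed
qed

lemma f_SomeD:
  assumes "b \<in> B" "i \<le> n" "crystal_f n i b = Some b'"
  obtains a where "\<And>k. yexp b i k = (if k = a then 1 else 0)" "b' = b - Amon n i (a + 1)"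
    "\<And>k. yexp b' i k = (if k = a + 2 then - 1 else 0)" "b' \<in> B"
  using assms(1,2)
proof (cases rule: sign_cases)
  case (plus a)
  have b': "b' = b - Amon n i (a + 1)" using crystal_plus(1)[of b i a n, OF plus(1)] assms(3) by simp
  have "yexp b' i k = (if k = a + 2 then - 1 else 0)" for k
    unfolding b' yexp_diff using n_ge assms(2) by (simp add: plus(1) yexp_Amon_self)
  moreover have "b' \<in> B" unfolding b' by (rule plus_closed[OF assms(1,2)]) (simp add: plus(1))
  ultimately show ?thesis using that[OF plus(1) b'] by blast
next
  case (minus a)
  then show ?thesis using crystal_minus(2)[of b i a n] assms(3) by simp
next
  case none
  then show ?thesis using crystal_none(2)[of b i n] assms(3) by simp
qed

lemma e_SomeD:
  assumes "b \<in> B" "i \<le> n" "crystal_e n i b = Some b'"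
  obtains a where "\<And>k. yexp b i k = (if k = a then - 1 else 0)" "b' = b + Amon n i (a - 1)"
    "\<And>k. yexp b' i k = (if k = a - 2 then 1 else 0)" "b' \<in> B"
  using assms(1,2)
proof (cases rule: sign_cases)
  case (minus a)
  have b': "b' = b + Amon n i (a - 1)" using crystal_minus(1)[of b i a n, OF minus(1)] assms(3) by simp
  have "yexp b' i k = (if k = a - 2 then 1 else 0)" for k
    unfolding b' yexp_add using n_ge assms(2) by (simp add: minus(1) yexp_Amon_self)
  moreover have "b' \<in> B" unfolding b' by (rule minus_closed[OF assms(1,2)]) (simp add: minus(1))
  ultimately show ?thesis using that[OF minus(1) b'] by blast
next
  case (plus a)
  then show ?thesis using crystal_plus(2)[of b i a n] assms(3) by simp
next
  case none
  then show ?thesis using crystal_none(1)[of b i n] assms(3) by simp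
qed

text \<open>
  Multiplying by \<open>A\<close> at a vertex changes no exponent at a non-adjacent vertex; this gives the squares.
  At the vertex itself it replaces \<open>Y\<close> by the inverse of \<open>Y\<close> two places further, so that raising and
  lowering undo each other.
\<close>

lemma subcrystal_minuscule:
  assumes b0: "b0 \<in> B"
  shows "minuscule_crystal n (subcrystal n b0) b0"
proof -
  have sub: "b \<in> B" if "b \<in> subcrystal n b0" for b
    using that
  proof induction
    case (subcrystal_e m i m')
    then show ?case by (meson e_SomeD)
  next
    case (subcrystal_f m i m')
    then show ?case by (meson f_SomeD)
  qed (rule b0)
  show ?thesis
  proof
    show "b' \<in> subcrystal n b0" if "b \<in> subcrystal n b0" "i \<le> n" "crystal_e n i b = Some b'" for b i b'
      using that by (rule subcrystal.subcrystal_e)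
    show "b' \<in> subcrystal n b0" if "b \<in> subcrystal n b0" "i \<le> n" "crystal_f n i b = Some b'" for b i b'
      using that by (rule subcrystal.subcrystal_f)
    show "3 \<le> n" by (rule n_ge)
    show "b0 \<in> subcrystal n b0" by (rule subcrystal_base)
    show "inj_on ywt (subcrystal n b0)" by (rule inj_on_subset[OF weights_inj]) (use sub in blast)
    fix b i assume bS: "b \<in> subcrystal n b0" 
    have b: "b \<in> B" using sub[OF bS] .
    show "ywt b \<in> weight_lattice n"
      unfolding weight_lattice_def
    proof (intro CollectI conjI allI impI)
      fix i assume "i \<le> n"
      then obtain e where "coef (ywt b) (Hidx i) = of_int e"
        using single_exponent[OF b] by blast
      then show "pairing (ywt b) (coroot i) \<in> \<int>" by (simp add: pairing_coroot)
    qed (rule weights[OF b])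
    fix i assume i: "i \<le> n"
    show "crystal_f n i b = None \<or> crystal_e n i b = None"
      using b i
    proof (cases rule: sign_cases)
      case (plus a)
      then show ?thesis using crystal_plus(2)[of b i a n, OF plus(1)] by simp
    next
      case (minus a)
      then show ?thesis using crystal_minus(2)[of b i a n, OF minus(1)] by simp
    next
      case none
      then show ?thesis using crystal_none(1)[of b i n, OF none(1)] by simp
    qed
    show "coef (ywt b) (Hidx i) =
      (if crystal_f n i b = None then 0 else 1) - (if crystal_e n i b = None then 0 else 1)"
      using b i
    proof (cases rule: sign_cases)
      case (plus a)
      then show ?thesis using crystal_plus[of b i a n, OF plus(1)] by simp
    next
      case (minus a)
      then show ?thesis using crystal_minus[of b i a n, OF minus(1)] by simp
    next
      case none
      then show ?thesis using crystal_none[of b i n, OF none(1)] by simp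
    qed
    show "(crystal_f n i b = Some b') = (crystal_e n i b' = Some b)" if b'S: "b' \<in> subcrystal n b0" for b'
    proof
      assume "crystal_f n i b = Some b'"
      from f_SomeD[OF b i this] obtain a where a: "b' = b - Amon n i (a + 1)"
        "\<And>k. yexp b' i k = (if k = a + 2 then - 1 else 0)" by metis
      show "crystal_e n i b' = Some b"
      proof -
        have "b' + Amon n i (a + 2 - 1) = b" by (simp add: a(1) add.commute)
        then show ?thesis using crystal_minus(1)[of b' i "a + 2" n, OF a(2)] by (simp only:)
      qed
    next
      assume "crystal_e n i b' = Some b"
      from e_SomeD[OF sub[OF b'S] i this] obtain a where a: "b = b' + Amon n i (a - 1)"
        "\<And>k. yexp b i k = (if k = a - 2 then 1 else 0)" by metis
      show "crystal_f n i b = Some b'"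
      proof -
        have "b - Amon n i (a - 2 + 1) = b'" by (simp add: a(1) add.commute)
        then show ?thesis using crystal_plus(1)[of b i "a - 2" n, OF a(2)] by (simp only:)
      qed
    qed
    fix j b1 b2
    assume j: "j \<le> n" and ij: "i \<noteq> j" and f: "crystal_f n i b = Some b1" "crystal_f n j b = Some b2"
    obtain a where a: "\<And>k. yexp b i k = (if k = a then 1 else 0)" "b1 = b - Amon n i (a + 1)"
      using f_SomeD[OF b i f(1)] by metis
    obtain c where c: "\<And>k. yexp b j k = (if k = c then 1 else 0)" "b2 = b - Amon n j (c + 1)"
      using f_SomeD[OF b j f(2)] by metis
    have ij0: "cartan_matrix n i j = 0" and ji0: "cartan_matrix n j i = 0"
      using plus_far[OF b i j ij, of a c] plus_far[OF b j i, of c a] ij by (simp_all add: a(1) c(1))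
    have "yexp b1 j k = (if k = c then 1 else 0)" for k
      unfolding a(2) yexp_diff by (simp add: c(1) yexp_Amon_far[OF i j ij ij0])
    then have f1: "crystal_f n j b1 = Some (b1 - Amon n j (c + 1))" by (rule crystal_plus(1))
    have "yexp b2 i k = (if k = a then 1 else 0)" for k
      unfolding c(2) yexp_diff by (simp add: a(1) yexp_Amon_far[OF j i not_sym[OF ij] ji0])
    then have f2: "crystal_f n i b2 = Some (b2 - Amon n i (a + 1))" by (rule crystal_plus(1))
    have "b1 - Amon n j (c + 1) = b2 - Amon n i (a + 1)" using a(2) c(2) by (simp add: algebra_simps)
    then show "cartan_matrix n i j = 0 \<and> (\<exists>z. crystal_f n j b1 = Some z \<and> crystal_f n i b2 = Some z)"
      using f1 f2 ij0 by simp
  qed auto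
qed

end

section \<open>The crystals of the vector representation and its dual\<close>

text \<open>
  The colour of the arrow entering position \<open>k\<close> of the chain: the cycle is traversed upwards for
  \<open>\<sigma> = 1\<close> (the vector representation) and downwards for \<open>\<sigma> = -1\<close> (its dual).
\<close>

definition rot :: "nat \<Rightarrow> int \<Rightarrow> int \<Rightarrow> nat" where
  "rot n \<sigma> k = nat (\<sigma> * k mod int (n + 1))"

text \<open>
  The value on \<open>d\<close> counts, with a minus sign, the arrows of colour 0 passed on the way from
  position 0.
\<close>

definition chain_mon :: "nat \<Rightarrow> int \<Rightarrow> int \<Rightarrow> ymonomial" where
  "chain_mon n \<sigma> k =
     (fund_weight (rot n \<sigma> (k + 1)) - fund_weight (rot n \<sigma> k)
        - Poly_Mapping.single Didx (of_int (k div int (n + 1))),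
      Poly_Mapping.single (rot n \<sigma> (k + 1), k) 1 - Poly_Mapping.single (rot n \<sigma> k, k + 1) 1)"

lemma int_rot: "int (rot n \<sigma> k) = \<sigma> * k mod int (n + 1)"
  by (simp add: rot_def)

lemma rot_le: "rot n \<sigma> k \<le> n"
proof -
  have "\<sigma> * k mod int (n + 1) < int (n + 1)" by (rule pos_mod_bound) simp
  then show ?thesis using int_rot[of n \<sigma> k] by linarith
qed

lemma rot_succ_pos: "rot n 1 (k + 1) = (rot n 1 k + 1) mod (n + 1)"
  by (rule int_int_eq[THEN iffD1]) (simp add: int_rot zmod_int mod_simps add.commute)

lemma rot_succ_neg: "rot n (- 1) k = (rot n (- 1) (k + 1) + 1) mod (n + 1)"
proof (rule int_int_eq[THEN iffD1])
  have "int ((rot n (- 1) (k + 1) + 1) mod (n + 1)) = (- (k + 1) mod int (n + 1) + 1) mod int (n + 1)"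
    by (simp only: zmod_int of_nat_add int_rot of_nat_1) simp
  also have "\<dots> = (- (k + 1) + 1) mod int (n + 1)" by (rule mod_add_left_eq)
  finally show "int (rot n (- 1) k) = int ((rot n (- 1) (k + 1) + 1) mod (n + 1))"
    by (simp add: int_rot)
qed

lemma rot_neighbours:
  fixes k :: int
  assumes "\<sigma> = 1 \<or> \<sigma> = - 1" "2 \<le> n"
  defines "i \<equiv> rot n \<sigma> (k + 1)"
  shows "rot n \<sigma> k = (i + n) mod (n + 1) \<and> rot n \<sigma> (k + 2) = (i + 1) mod (n + 1) \<or>
    rot n \<sigma> k = (i + 1) mod (n + 1) \<and> rot n \<sigma> (k + 2) = (i + n) mod (n + 1)"
  using assms(1)
proof
  assume s: "\<sigma> = 1"
  have "i = (rot n \<sigma> k + 1) mod (n + 1)" unfolding i_def s by (rule rot_succ_pos)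
  then have "rot n \<sigma> k = (i + n) mod (n + 1)" using neighbours(6)[OF assms(2) rot_le[of n \<sigma> k]] by simp
  moreover have "rot n \<sigma> (k + 2) = (i + 1) mod (n + 1)"
    using rot_succ_pos[of n "k + 1"] unfolding i_def s by (simp add: add.assoc)
  ultimately show ?thesis by blast
next
  assume s: "\<sigma> = - 1"
  have "i = (rot n \<sigma> (k + 2) + 1) mod (n + 1)"
    using rot_succ_neg[of n "k + 1"] unfolding i_def s by (simp add: add.assoc)
  then have "rot n \<sigma> (k + 2) = (i + n) mod (n + 1)"
    using neighbours(6)[OF assms(2) rot_le[of n \<sigma> "k + 2"]] by simp
  moreover have "rot n \<sigma> k = (i + 1) mod (n + 1)" unfolding i_def s by (rule rot_succ_neg)
  ultimately show ?thesis by blast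
qed

lemma rot_distinct:
  assumes "\<sigma> = 1 \<or> \<sigma> = - 1" "2 \<le> n"
  shows "rot n \<sigma> k \<noteq> rot n \<sigma> (k + 1)"
  using rot_neighbours[OF assms, of k] neighbours(3,4)[OF assms(2) rot_le[of n \<sigma> "k + 1"]] by metis

lemma rot_zero_iff:
  assumes "\<sigma> = 1 \<or> \<sigma> = - 1"
  shows "rot n \<sigma> k = 0 \<longleftrightarrow> int (n + 1) dvd k"
proof -
  have "rot n \<sigma> k = 0 \<longleftrightarrow> int (rot n \<sigma> k) = 0" by simp
  also have "\<dots> \<longleftrightarrow> int (n + 1) dvd \<sigma> * k" unfolding int_rot by (simp add: dvd_eq_mod_eq_0)
  also have "\<dots> \<longleftrightarrow> int (n + 1) dvd k" using assms by auto
  finally show ?thesis .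
qed

lemma div_succ:
  fixes N k :: int assumes "N > 0"
  shows "(k + 1) div N = k div N + (if N dvd k + 1 then 1 else 0)"
proof (cases "N dvd k + 1")
  case True
  then obtain q where q: "k + 1 = N * q" by (auto simp: dvd_def)
  then have "k = N * (q - 1) + (N - 1)" by (simp add: algebra_simps)
  then have "k div N = q - 1" using assms by (intro int_div_pos_eq[of _ _ _ "N - 1"]) auto
  then show ?thesis using q True assms by simp
next
  case False
  have b: "0 \<le> k mod N" "k mod N < N" using assms by simp_all
  have "k mod N + 1 \<noteq> N"
  proof
    assume "k mod N + 1 = N"
    moreover have "k = N * (k div N) + k mod N" by simp
    ultimately have "k + 1 = N * (k div N) + N" by linarith
    then have "k + 1 = N * (k div N + 1)" by (simp add: distrib_left)
    then show False using False by (metis dvd_triv_left)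
  qed
  then have "k mod N + 1 < N" using b by linarith
  moreover have "k + 1 = N * (k div N) + (k mod N + 1)" by simp
  ultimately have "(k + 1) div N = k div N" using b by (intro int_div_pos_eq) auto
  then show ?thesis using False by simp
qed

text \<open>
  One of the neighbours of the vertex is the previous vertex of the chain and the other one is the
  next, whatever the direction; of the four variables in \<open>A\<close>, two cancel.
\<close>

lemma chain_step:
  assumes s: "\<sigma> = 1 \<or> \<sigma> = - 1" and n: "2 \<le> n"
  shows "chain_mon n \<sigma> k - Amon n (rot n \<sigma> (k + 1)) (k + 1) = chain_mon n \<sigma> (k + 1)"
proof (rule prod_eqI)
  let ?i = "rot n \<sigma> (k + 1)" and ?p = "rot n \<sigma> k" and ?s = "rot n \<sigma> (k + 2)"
  let ?P = "(?i + n) mod (n + 1)" and ?S = "(?i + 1) mod (n + 1)"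
  have nb: "?p = ?P \<and> ?s = ?S \<or> ?p = ?S \<and> ?s = ?P" by (rule rot_neighbours[OF s n])
  have i: "?i \<le> n" by (rule rot_le)
  note ds = neighbours(1-5)[OF n i]
  have two: "k + 1 + 1 = k + 2" by simp
  show "snd (chain_mon n \<sigma> k - Amon n ?i (k + 1)) = snd (chain_mon n \<sigma> (k + 1))"
    using nb unfolding chain_mon_def Amon_def two by (auto simp: algebra_simps)
  have root: "simple_root n ?i = fund_weight ?i + fund_weight ?i - fund_weight ?p - fund_weight ?s
      + Poly_Mapping.single Didx (if ?i = 0 then 1 else 0)"
  proof (rule poly_mapping_eqI)
    fix x
    show "coef (simple_root n ?i) x = coef (fund_weight ?i + fund_weight ?i
        - fund_weight ?p - fund_weight ?s + Poly_Mapping.single Didx (if ?i = 0 then 1 else 0)) x"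
    proof (cases x)
      case (Hidx j)
      have "cartan_matrix n j ?i = cartan_matrix n ?i j" by (auto simp: cartan_matrix_def)
      then show ?thesis
        using nb ds i cartan_matrix_cases[OF i, of j]
        by (cases "j \<le> n") (auto simp: Hidx lookup_simple_root_H fund_weight_def lookup_add lookup_minus lookup_single when_def)
    next
      case Didx
      then show ?thesis
        by (simp add: lookup_simple_root_D fund_weight_def lookup_add lookup_minus lookup_single when_def)
    qed
  qed
  have dv: "(k + 1) div int (n + 1) = k div int (n + 1) + (if ?i = 0 then 1 else 0)"
    using div_succ[of "int (n + 1)" k] rot_zero_iff[OF s, of n "k + 1"] by simp
  show "fst (chain_mon n \<sigma> k - Amon n ?i (k + 1)) = fst (chain_mon n \<sigma> (k + 1))"
    unfolding chain_mon_def Amon_def two dv fst_diff fst_conv root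
    by (cases "?i = 0") (simp_all add: single_add)
qed

lemma yexp_chain:
  "yexp (chain_mon n \<sigma> k) j l =
    (if j = rot n \<sigma> (k + 1) \<and> l = k then 1 else 0) - (if j = rot n \<sigma> k \<and> l = k + 1 then 1 else 0)"
  by (auto simp: yexp_def chain_mon_def lookup_minus lookup_single when_def)

lemma ywt_chain_H:
  "coef (ywt (chain_mon n \<sigma> k)) (Hidx j) =
    (if j = rot n \<sigma> (k + 1) then 1 else 0) - (if j = rot n \<sigma> k then 1 else 0)"
  by (auto simp: ywt_def chain_mon_def fund_weight_def lookup_minus lookup_single when_def)

lemma ywt_chain_D:
  "coef (ywt (chain_mon n \<sigma> k)) Didx = - of_int (k div int (n + 1))"
  by (simp add: ywt_def chain_mon_def fund_weight_def lookup_minus lookup_single when_def)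

text \<open>
  The weight determines the position modulo \<open>n + 1\<close> by its values on the coroots and the number of
  full turns by its value on \<open>d\<close>.
\<close>

lemma chain_wt_inj:
  assumes s: "\<sigma> = 1 \<or> \<sigma> = - 1" and n: "2 \<le> n"
    and eq: "ywt (chain_mon n \<sigma> k) = ywt (chain_mon n \<sigma> k')"
  shows "k = k'"
proof -
  let ?N = "int (n + 1)"
  have d: "k div ?N = k' div ?N"
    using arg_cong[OF eq, of "\<lambda>m. coef m Didx"] by (simp add: ywt_chain_D)
  have "rot n \<sigma> (k + 1) = rot n \<sigma> (k' + 1)"
    using arg_cong[OF eq, of "\<lambda>m. coef m (Hidx (rot n \<sigma> (k + 1)))"]
      rot_distinct[OF s n, of k]
    by (auto simp: ywt_chain_H split: if_splits)
  then have "\<sigma> * (k + 1) mod ?N = \<sigma> * (k' + 1) mod ?N" by (metis int_rot)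
  then have "?N dvd \<sigma> * (k + 1) - \<sigma> * (k' + 1)" by (simp only: mod_eq_dvd_iff)
  then have "?N dvd k - k'"
    using s
  proof (elim disjE)
    assume "\<sigma> = - 1" "?N dvd \<sigma> * (k + 1) - \<sigma> * (k' + 1)"
    then have "?N dvd - (k - k')" by simp
    then show ?thesis by (simp only: dvd_minus_iff)
  qed simp
  then have "k mod ?N = k' mod ?N" by (simp only: mod_eq_dvd_iff)
  then show ?thesis using d by (metis div_mult_mod_eq)
qed

lemma chain_minuscule:
  assumes s: "\<sigma> = 1 \<or> \<sigma> = - 1" and n: "3 \<le> n"
  shows "minuscule_monomials n (range (chain_mon n \<sigma>))"
proof
  have n2: "2 \<le> n" using n by simp
  note ne = rot_distinct[OF s n2]
  show "3 \<le> n" by (rule n)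
  show "inj_on ywt (range (chain_mon n \<sigma>))"
  proof (rule inj_onI)
    fix x x' assume "x \<in> range (chain_mon n \<sigma>)" "x' \<in> range (chain_mon n \<sigma>)" and eq: "ywt x = ywt x'"
    then obtain k k' where x: "x = chain_mon n \<sigma> k" "x' = chain_mon n \<sigma> k'" by blast
    have "k = k'" by (rule chain_wt_inj[OF s n2 eq[unfolded x]])
    then show "x = x'" using x by simp
  qed
  fix b assume "b \<in> range (chain_mon n \<sigma>)"
  then obtain k where k: "b = chain_mon n \<sigma> k" by blast
  show "supp (ywt b) \<subseteq> cartan_indices n"
  proof
    fix x assume x: "x \<in> supp (ywt b)"
    show "x \<in> cartan_indices n"
    proof (cases x)
      case (Hidx j)
      then have "j = rot n \<sigma> (k + 1) \<or> j = rot n \<sigma> k"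
        using x unfolding k by (auto simp: in_keys_iff ywt_chain_H split: if_splits)
      then show ?thesis using Hidx rot_le by (auto simp: cartan_indices_def)
    qed (simp add: cartan_indices_def)
  qed
  fix i assume i: "i \<le> n"
  show "\<exists>a e. (e = 1 \<or> e = -1 \<or> e = 0) \<and>
      coef (ywt b) (Hidx i) = of_int e \<and> (\<forall>k. yexp b i k = (if k = a then e else 0))"
  proof -
    consider "i = rot n \<sigma> (k + 1)" | "i = rot n \<sigma> k" | "i \<noteq> rot n \<sigma> (k + 1)" "i \<noteq> rot n \<sigma> k" by blast
    then show ?thesis
    proof cases
      case 1
      then show ?thesis using ne[of k] by (intro exI[of _ k] exI[of _ 1]) (auto simp: k yexp_chain ywt_chain_H)
    next
      case 2
      then show ?thesis using ne[of k] by (intro exI[of _ "k + 1"] exI[of _ "- 1"]) (auto simp: k yexp_chain ywt_chain_H)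
    next
      case 3
      then show ?thesis by (intro exI[of _ k] exI[of _ 0]) (auto simp: k yexp_chain ywt_chain_H)
    qed
  qed
  fix a
  show "b - Amon n i (a + 1) \<in> range (chain_mon n \<sigma>)" if "yexp b i a = 1"
  proof -
    have "i = rot n \<sigma> (k + 1)" "a = k" using that unfolding k yexp_chain by (auto split: if_splits)
    then show ?thesis using chain_step[OF s n2, of k] k by auto
  qed
  show "b + Amon n i (a - 1) \<in> range (chain_mon n \<sigma>)" if "yexp b i a = - 1"
  proof -
    have ia: "i = rot n \<sigma> k" "a = k + 1" using that unfolding k yexp_chain by (auto split: if_splits)
    have "chain_mon n \<sigma> (k - 1) - Amon n (rot n \<sigma> k) k = chain_mon n \<sigma> k"
      using chain_step[OF s n2, of "k - 1"] by simp
    then have "b + Amon n i (a - 1) = chain_mon n \<sigma> (k - 1)" unfolding k ia by (simp add: algebra_simps)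
    then show ?thesis by simp
  qed
  fix j a'
  assume "i \<noteq> j" "yexp b i a = 1" "yexp b j a' = 1"
  then show "cartan_matrix n i j = 0" unfolding k yexp_chain by (auto split: if_splits)
qed

lemma fund_monomial_chain:
  assumes "3 \<le> n"
  shows "fund_monomial n 1 = chain_mon n 1 0" "fund_monomial n n = chain_mon n (- 1) 0"
proof -
  have r: "rot n 1 1 = 1" "rot n 1 0 = 0" "rot n (-1) 0 = 0"
    using assms by (simp_all add: rot_def)
  have "- 1 mod int (n + 1) = int n" using assms by (simp add: zmod_minus1)
  then have r': "rot n (-1) 1 = n" by (simp add: rot_def)
  have m: "min 1 (n + 1 - 1) = 1" "min n (n + 1 - n) = 1" using assms by auto
  show "fund_monomial n 1 = chain_mon n 1 0" "fund_monomial n n = chain_mon n (- 1) 0"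
    unfolding fund_monomial_def chain_mon_def varpi_def m using r r' by simp_all
qed

section \<open>The crystal of the middle fundamental representation\<close>

text \<open>
  Half of the discrete Laplacian: 1 at local minima, -1 at local maxima, and 0 elsewhere.
\<close>

definition curv :: "nat \<Rightarrow> (nat \<Rightarrow> int) \<Rightarrow> nat \<Rightarrow> int" where
  "curv n H i = (H ((i + 1) mod (n + 1)) + H ((i + n) mod (n + 1)) - 2 * H i) div 2"

definition heights :: "nat \<Rightarrow> (nat \<Rightarrow> int) \<Rightarrow> bool" where
  "heights n H \<longleftrightarrow> (\<forall>i\<le>n. \<bar>H ((i + 1) mod (n + 1)) - H i\<bar> = 1)"

text \<open>
  The value on \<open>d\<close> only has to decrease by 1 when the height at 0 grows by 2; the constant \<open>c\<close>
  fixes the base point.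
\<close>

definition height_mon :: "nat \<Rightarrow> int \<Rightarrow> (nat \<Rightarrow> int) \<Rightarrow> ymonomial" where
  "height_mon n c H =
     ((\<Sum>i\<in>{0..n}. Poly_Mapping.single (Hidx i) (of_int (curv n H i)))
        + Poly_Mapping.single Didx (of_int (c - H 0) / 2),
      \<Sum>i\<in>{0..n}. Poly_Mapping.single (i, H i) (curv n H i))"

lemma lookup_height_mon:
  "coef (ywt (height_mon n c H)) (Hidx j) = (if j \<le> n then of_int (curv n H j) else 0)"
  "coef (ywt (height_mon n c H)) Didx = of_int (c - H 0) / 2"
  by (simp_all add: ywt_def height_mon_def lookup_add lookup_sum lookup_single when_def)

lemma yexp_height_mon:
  "yexp (height_mon n c H) j k = (if j \<le> n \<and> k = H j then curv n H j else 0)"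
proof -
  have "yexp (height_mon n c H) j k = (\<Sum>i\<in>{0..n}. if i = j then (if k = H j then curv n H j else 0) else 0)"
    unfolding yexp_def height_mon_def snd_conv lookup_sum
    by (rule sum.cong) (auto simp: lookup_single when_def)
  then show ?thesis by simp
qed

lemma heights_cases:
  assumes "heights n H" "2 \<le> n" "i \<le> n"
  obtains "H ((i + 1) mod (n + 1)) = H i + 1" "H ((i + n) mod (n + 1)) = H i + 1" "curv n H i = 1"
  | "H ((i + 1) mod (n + 1)) = H i - 1" "H ((i + n) mod (n + 1)) = H i - 1" "curv n H i = - 1"
  | "H ((i + 1) mod (n + 1)) + H ((i + n) mod (n + 1)) = 2 * H i" "curv n H i = 0"
proof -
  have a: "\<bar>H ((i + 1) mod (n + 1)) - H i\<bar> = 1" using assms(1,3) unfolding heights_def by blast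
  have "\<bar>H (((i + n) mod (n + 1) + 1) mod (n + 1)) - H ((i + n) mod (n + 1))\<bar> = 1"
    using assms(1) neighbours(2)[OF assms(2,3)] unfolding heights_def by blast
  then have b: "\<bar>H i - H ((i + n) mod (n + 1))\<bar> = 1" unfolding neighbours(7)[OF assms(2,3)] .
  define x where "x = H ((i + 1) mod (n + 1))"
  define y where "y = H ((i + n) mod (n + 1))"
  have "x = H i + 1 \<and> y = H i + 1 \<or> x = H i - 1 \<and> y = H i - 1 \<or> x + y = 2 * H i"
    using a b unfolding x_def[symmetric] y_def[symmetric] by linarith
  then show ?thesis
    using that unfolding curv_def x_def[symmetric] y_def[symmetric] by fastforce
qed

lemma curv_even:
  assumes "heights n H" "2 \<le> n" "i \<le> n"
  shows "2 * curv n H i = H ((i + 1) mod (n + 1)) + H ((i + n) mod (n + 1)) - 2 * H i"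
  using heights_cases[OF assms] by (cases rule: heights_cases[OF assms]) auto

text \<open>
  Flipping a local minimum: both neighbours are one step higher, so they are again one step away
  afterwards, and their curvature increases by 1.
\<close>

lemma height_step:
  assumes H: "heights n H" and n: "2 \<le> n" and i: "i \<le> n" and c1: "curv n H i = 1"
  defines "H' \<equiv> H(i := H i + 2)"
  shows "heights n H'" "height_mon n c H - Amon n i (H i + 1) = height_mon n c H'"
proof -
  let ?s = "(i + 1) mod (n + 1)" and ?p = "(i + n) mod (n + 1)"
  note nb = neighbours[OF n i]
  have nbH: "H ?s = H i + 1" "H ?p = H i + 1"
    by (rule heights_cases[OF H n i]; use c1 in simp)+
  have succ_eq: "(j + 1) mod (n + 1) = i \<longleftrightarrow> j = ?p" if "j \<le> n" for j
    using neighbours(6)[OF n that] nb(7) by auto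
  have pred_eq: "(j + n) mod (n + 1) = i \<longleftrightarrow> j = ?s" if "j \<le> n" for j
    using neighbours(7)[OF n that] nb(6) by auto
  show "heights n H'"
    unfolding heights_def
  proof (intro allI impI)
    fix j assume j: "j \<le> n"
    have old: "\<bar>H ((j + 1) mod (n + 1)) - H j\<bar> = 1" using H j unfolding heights_def by blast
    consider "j = i" | "j = ?p" | "j \<noteq> i" "j \<noteq> ?p" by blast
    then show "\<bar>H' ((j + 1) mod (n + 1)) - H' j\<bar> = 1"
    proof cases
      case 1
      have "H' ?s = H i + 1" "H' i = H i + 2" using nb(3) nbH by (simp_all add: H'_def)
      then show ?thesis unfolding 1 by simp
    next
      case 2
      have "H' ?p = H i + 1" "H' i = H i + 2" using nb(4) nbH by (simp_all add: H'_def)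
      then show ?thesis unfolding 2 nb(7) by simp
    next
      case 3
      then have "(j + 1) mod (n + 1) \<noteq> i" using succ_eq[OF j] by blast
      then show ?thesis using old 3 by (simp add: H'_def)
    qed
  qed
  have curv': "curv n H' j = curv n H j - (if j = i then 2 else if j = ?s \<or> j = ?p then -1 else 0)"
    if j: "j \<le> n" for j
  proof -
    consider (i) "j = i" | (s) "j = ?s" | (p) "j = ?p" | (far) "j \<noteq> i" "j \<noteq> ?s" "j \<noteq> ?p" by blast
    then show ?thesis
    proof cases
      case i
      have "H' ?s = H i + 1" "H' ?p = H i + 1" "H' i = H i + 2" using nb(3,4) nbH by (simp_all add: H'_def)
      then show ?thesis unfolding i c1 by (simp add: curv_def)
    next
      case s
      have "(j + n) mod (n + 1) = i" "(j + 1) mod (n + 1) \<noteq> i" "j \<noteq> i" "j \<noteq> ?p"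
        using nb succ_eq[OF j] unfolding s by auto
      then have "curv n H' j = (H ((j + 1) mod (n + 1)) + (H i + 2) - 2 * H j) div 2"
        by (simp add: curv_def H'_def)
      also have "\<dots> = curv n H j + 1" unfolding curv_def using \<open>(j + n) mod (n + 1) = i\<close> by simp
      finally show ?thesis using \<open>j \<noteq> i\<close> s by simp
    next
      case p
      have "(j + 1) mod (n + 1) = i" "(j + n) mod (n + 1) \<noteq> i" "j \<noteq> i" "j \<noteq> ?s"
        using nb pred_eq[OF j] unfolding p by auto
      then have "curv n H' j = ((H i + 2) + H ((j + n) mod (n + 1)) - 2 * H j) div 2"
        by (simp add: curv_def H'_def)
      also have "\<dots> = curv n H j + 1" unfolding curv_def using \<open>(j + 1) mod (n + 1) = i\<close> by simp
      finally show ?thesis using \<open>j \<noteq> i\<close> p by simp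
    next
      case far
      then have "(j + 1) mod (n + 1) \<noteq> i" "(j + n) mod (n + 1) \<noteq> i"
        using succ_eq[OF j] pred_eq[OF j] by auto
      then show ?thesis using far by (simp add: curv_def H'_def)
    qed
  qed
  show "height_mon n c H - Amon n i (H i + 1) = height_mon n c H'"
  proof (rule prod_eqI)
    show "fst (height_mon n c H - Amon n i (H i + 1)) = fst (height_mon n c H')"
    proof (rule poly_mapping_eqI)
      fix x
      have "coef (fst (height_mon n c H - Amon n i (H i + 1))) x =
          coef (ywt (height_mon n c H)) x - coef (simple_root n i) x"
        by (simp add: ywt_def lookup_minus Amon_def)
      also have "\<dots> = coef (ywt (height_mon n c H')) x"
      proof (cases x)
        case (Hidx j)
        have "cartan_matrix n j i = cartan_matrix n i j" by (auto simp: cartan_matrix_def)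
        then show ?thesis
          using curv'[of j] cartan_matrix_cases[OF i, of j] nb(3,4)
          by (auto simp: Hidx lookup_height_mon lookup_simple_root_H)
      next
        case Didx
        then show ?thesis by (simp add: lookup_height_mon lookup_simple_root_D H'_def field_simps)
      qed
      finally show "coef (fst (height_mon n c H - Amon n i (H i + 1))) x =
          coef (fst (height_mon n c H')) x" by (simp add: ywt_def)
    qed
    have "yexp (height_mon n c H - Amon n i (H i + 1)) j k = yexp (height_mon n c H') j k" for j k
    proof -
      have A: "yexp (Amon n i (H i + 1)) j k =
        (if j = i \<and> (k = H i \<or> k = H i + 2) then 1 else 0) - (if j = ?p \<and> k = H i + 1 then 1 else 0)
          - (if j = ?s \<and> k = H i + 1 then 1 else 0)"
        using nb by (auto simp: yexp_def Amon_def lookup_minus lookup_add lookup_single when_def)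
      show ?thesis
      proof (cases "j \<le> n")
        case True
        consider (i) "j = i" | (s) "j = ?s" | (p) "j = ?p" | (far) "j \<noteq> i" "j \<noteq> ?s" "j \<noteq> ?p" by blast
        then show ?thesis
        proof cases
          case i
          then show ?thesis
            using nb(3,4) True curv'[OF True] c1 unfolding yexp_diff A yexp_height_mon by (auto simp: H'_def)
        next
          case s
          have "j \<noteq> i" "j \<noteq> ?p" "H j = H i + 1" using s nb nbH by auto
          then show ?thesis
            using s True curv'[OF True] unfolding yexp_diff A yexp_height_mon by (simp add: H'_def)
        next
          case p
          have "j \<noteq> i" "j \<noteq> ?s" "H j = H i + 1" using p nb nbH by auto
          then show ?thesis
            using p True curv'[OF True] unfolding yexp_diff A yexp_height_mon by (simp add: H'_def)
        next
          case far
          then show ?thesis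
            using True curv'[OF True] unfolding yexp_diff A yexp_height_mon by (simp add: H'_def)
        qed
      next
        case False
        then have "j \<noteq> i" "j \<noteq> ?s" "j \<noteq> ?p" using nb(1,2) i by auto
        then show ?thesis using False unfolding yexp_diff A yexp_height_mon by simp
      qed
    qed
    then show "snd (height_mon n c H - Amon n i (H i + 1)) = snd (height_mon n c H')"
      by (intro poly_mapping_eqI) (auto simp: yexp_def)
  qed
qed

text \<open>
  Reduced to the upward flip, applied to the negated function for admissibility and to the flipped
  function for the monomial.
\<close>

lemma height_step_down:
  assumes H: "heights n H" and n: "2 \<le> n" and i: "i \<le> n" and c1: "curv n H i = - 1"
  defines "H' \<equiv> H(i := H i - 2)"
  shows "heights n H'" "height_mon n c H + Amon n i (H i - 1) = height_mon n c H'"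
proof -
  have neg: "heights n (\<lambda>j. - G j) \<longleftrightarrow> heights n G" for G
    by (auto simp: heights_def abs_minus_commute)
  note nb = neighbours[OF n i]
  have nbH: "H ((i + 1) mod (n + 1)) = H i - 1" "H ((i + n) mod (n + 1)) = H i - 1"
    by (rule heights_cases[OF H n i]; use c1 in simp)+
  have "curv n (\<lambda>j. - H j) i = 1" unfolding curv_def nbH by simp
  from height_step(1)[OF neg[THEN iffD2, OF H] n i this]
  have "heights n ((\<lambda>j. - H j)(i := - H i + 2))" .
  also have "(\<lambda>j. - H j)(i := - H i + 2) = (\<lambda>j. - H' j)" by (auto simp: H'_def)
  finally show H': "heights n H'" by (simp only: neg)
  have "curv n H' i = 1" unfolding curv_def using nb(3,4) nbH by (simp add: H'_def)
  from height_step(2)[OF H' n i this, of c]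
  have "height_mon n c H' - Amon n i (H' i + 1) = height_mon n c (H'(i := H' i + 2))" .
  moreover have "H'(i := H' i + 2) = H" "H' i + 1 = H i - 1" by (auto simp: H'_def)
  ultimately have eq: "height_mon n c H = height_mon n c H' - Amon n i (H i - 1)" by (simp only:)
  show "height_mon n c H + Amon n i (H i - 1) = height_mon n c H'" unfolding eq by (rule diff_add_cancel)
qed

lemma doubled_difference:
  fixes a b x x' z z' h h' :: int
  assumes "2 * a = x + z - 2 * h" "2 * b = x' + z' - 2 * h'" "a = b"
  shows "2 * (h - h') = (x - x') + (z - z')"
proof -
  have "2 * a = 2 * b" using assms(3) by simp
  then have "x + z - 2 * h = x' + z' - 2 * h'" unfolding assms(1,2) .
  then show ?thesis by simp
qed

text \<open>
  The weight determines the Laplacian of the heights, hence the heights up to a constant, and the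
  value on \<open>d\<close> determines the height at 0.
\<close>

lemma height_mon_inj:
  assumes H: "heights n H" "heights n K" and n: "2 \<le> n"
    and eq: "ywt (height_mon n c H) = ywt (height_mon n c K)"
  shows "height_mon n c H = height_mon n c K"
proof -
  define d :: "nat \<Rightarrow> rat" where "d i = of_int (H i - K i)" for i
  have cv: "curv n H i = curv n K i" if "i \<le> n" for i
    using arg_cong[OF eq, of "\<lambda>m. coef m (Hidx i)"] that by (simp add: lookup_height_mon)
  have "2 * d i = d ((i + 1) mod (n + 1)) + d ((i + n) mod (n + 1))" if "i \<le> n" for i
  proof -
    have "2 * (H i - K i) = (H ((i + 1) mod (n + 1)) - K ((i + 1) mod (n + 1)))
        + (H ((i + n) mod (n + 1)) - K ((i + n) mod (n + 1)))"
      by (rule doubled_difference[OF curv_even[OF H(1) n that] curv_even[OF H(2) n that] cv[OF that]])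
    then have "(of_int (2 * (H i - K i)) :: rat) = of_int ((H ((i + 1) mod (n + 1)) - K ((i + 1) mod (n + 1)))
        + (H ((i + n) mod (n + 1)) - K ((i + n) mod (n + 1))))" by (simp only:)
    then show ?thesis unfolding d_def by (simp only: of_int_mult of_int_add of_int_numeral)
  qed
  then have "d i = d 0" if "i \<le> n" for i using cyclic_harmonic_const[of n d i] that by blast
  moreover have "d 0 = 0"
    using arg_cong[OF eq, of "\<lambda>m. coef m Didx"] by (simp add: lookup_height_mon d_def)
  ultimately have d0: "d i = 0" if "i \<le> n" for i using that by metis
  have HK: "H i = K i" if "i \<le> n" for i using d0[OF that] by (simp add: d_def)
  have "H 0 = K 0" by (rule HK) simp
  moreover have "(\<Sum>i\<in>{0..n}. Poly_Mapping.single (Hidx i) (of_int (curv n H i) :: rat)) =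
      (\<Sum>i\<in>{0..n}. Poly_Mapping.single (Hidx i) (of_int (curv n K i)))"
    by (rule sum.cong) (simp_all add: cv)
  moreover have "(\<Sum>i\<in>{0..n}. Poly_Mapping.single (i, H i) (curv n H i)) =
      (\<Sum>i\<in>{0..n}. Poly_Mapping.single (i, K i) (curv n K i))"
    by (rule sum.cong) (simp_all add: cv HK)
  ultimately show ?thesis unfolding height_mon_def by simp
qed

lemma height_minuscule:
  assumes n: "3 \<le> n"
  shows "minuscule_monomials n (height_mon n c ` {H. heights n H})"
proof
  have n2: "2 \<le> n" using n by simp
  show "3 \<le> n" by (rule n)
  show "inj_on ywt (height_mon n c ` {H. heights n H})"
  proof (rule inj_onI)
    fix x x'
    assume "x \<in> height_mon n c ` {H. heights n H}" "x' \<in> height_mon n c ` {H. heights n H}"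
      and eq: "ywt x = ywt x'"
    then obtain H K where x: "heights n H" "heights n K" "x = height_mon n c H" "x' = height_mon n c K"
      by blast
    show "x = x'" unfolding x(3,4) by (rule height_mon_inj[OF x(1,2) n2 eq[unfolded x(3,4)]])
  qed
  fix b assume "b \<in> height_mon n c ` {H. heights n H}"
  then obtain H where H: "heights n H" and b: "b = height_mon n c H" by blast
  show "supp (ywt b) \<subseteq> cartan_indices n"
  proof
    fix x assume x: "x \<in> supp (ywt b)"
    show "x \<in> cartan_indices n"
      using x unfolding b
      by (cases x) (auto simp: in_keys_iff lookup_height_mon cartan_indices_def split: if_splits)
  qed
  fix i assume i: "i \<le> n"
  have cc: "curv n H i = 1 \<or> curv n H i = - 1 \<or> curv n H i = 0"
    by (rule heights_cases[OF H n2 i]) auto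
  show "\<exists>a e. (e = 1 \<or> e = -1 \<or> e = 0) \<and>
      coef (ywt b) (Hidx i) = of_int e \<and> (\<forall>k. yexp b i k = (if k = a then e else 0))"
    using cc i by (intro exI[of _ "H i"] exI[of _ "curv n H i"]) (simp add: b lookup_height_mon yexp_height_mon)
  fix a
  show "b - Amon n i (a + 1) \<in> height_mon n c ` {H. heights n H}" if "yexp b i a = 1"
  proof -
    have a: "a = H i" "curv n H i = 1" using that unfolding b yexp_height_mon by (auto split: if_splits)
    show ?thesis unfolding b a(1) height_step(2)[OF H n2 i a(2)]
      using height_step(1)[OF H n2 i a(2)] by blast
  qed
  show "b + Amon n i (a - 1) \<in> height_mon n c ` {H. heights n H}" if "yexp b i a = - 1"
  proof -
    have a: "a = H i" "curv n H i = - 1" using that unfolding b yexp_height_mon by (auto split: if_splits)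
    show ?thesis unfolding b a(1) height_step_down(2)[OF H n2 i a(2)]
      using height_step_down(1)[OF H n2 i a(2)] by blast
  qed
  fix j a'
  assume j: "j \<le> n" and ij: "i \<noteq> j" and ones: "yexp b i a = 1" "yexp b j a' = 1"
  have ci: "curv n H i = 1" and cj: "curv n H j = 1"
    using ones unfolding b yexp_height_mon by (auto split: if_splits)
  have Hi: "H ((i + 1) mod (n + 1)) = H i + 1" "H ((i + n) mod (n + 1)) = H i + 1"
    by (rule heights_cases[OF H n2 i]; use ci in simp)+
  have Hj: "H ((j + 1) mod (n + 1)) = H j + 1" "H ((j + n) mod (n + 1)) = H j + 1"
    by (rule heights_cases[OF H n2 j]; use cj in simp)+
  have "j \<noteq> (i + 1) mod (n + 1)" using Hi(1) Hj(2) neighbours(6)[OF n2 i] by auto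
  moreover have "j \<noteq> (i + n) mod (n + 1)" using Hi(2) Hj(1) neighbours(7)[OF n2 i] by auto
  ultimately show "cartan_matrix n i j = 0" using ij by (simp only: cartan_matrix_cases[OF i j]) simp
qed

text \<open>
  The base point is the distance to the vertex \<open>r + 1\<close>, with a single local minimum there and a
  single local maximum at the opposite vertex 0.
\<close>

lemma fund_monomial_heights:
  assumes "r \<ge> 1" "n = 2 * r + 1"
  defines "H \<equiv> \<lambda>i. \<bar>int i - int (r + 1)\<bar>"
  shows "heights n H" "fund_monomial n (r + 1) = height_mon n (int (r + 1)) H"
proof -
  show "heights n H"
    unfolding heights_def
  proof (intro allI impI)
    fix i assume i: "i \<le> n"
    show "\<bar>H ((i + 1) mod (n + 1)) - H i\<bar> = 1"
      unfolding H_def mod_succ[OF i] using i assms(1,2) by auto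
  qed
  have cv: "curv n H i = (if i = r + 1 then 1 else if i = 0 then - 1 else 0)" if "i \<le> n" for i
    unfolding curv_def H_def mod_succ[OF that] mod_pred[OF that] using that assms(1,2) by auto
  have H: "H 0 = int (r + 1)" "H (r + 1) = 0" by (simp_all add: H_def)
  have m: "int (min (r + 1) (n + 1 - (r + 1))) = int (r + 1)" using assms(2) by simp
  have le: "r + 1 \<le> n" "(0::nat) \<le> n" using assms(2) by auto
  show "fund_monomial n (r + 1) = height_mon n (int (r + 1)) H"
  proof (rule prod_eqI)
    show "fst (fund_monomial n (r + 1)) = fst (height_mon n (int (r + 1)) H)"
    proof (rule poly_mapping_eqI)
      fix x
      have "coef (fst (fund_monomial n (r + 1))) x = coef (ywt (height_mon n (int (r + 1)) H)) x"
        using le by (cases x) (auto simp: lookup_height_mon cv H fund_monomial_def varpi_def fund_weight_def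
          lookup_minus lookup_single when_def)
      then show "coef (fst (fund_monomial n (r + 1))) x =
          coef (fst (height_mon n (int (r + 1)) H)) x" by (simp add: ywt_def)
    qed
    have "yexp (fund_monomial n (r + 1)) j k = yexp (height_mon n (int (r + 1)) H) j k" for j k
    proof -
      have "yexp (fund_monomial n (r + 1)) j k =
          (if j = r + 1 \<and> k = 0 then 1 else 0) - (if j = 0 \<and> k = int (r + 1) then 1 else 0)"
        unfolding yexp_def fund_monomial_def snd_conv m
        by (auto simp: lookup_minus lookup_single when_def)
      also have "\<dots> = yexp (height_mon n (int (r + 1)) H) j k"
        using le H unfolding yexp_height_mon by (auto simp: cv)
      finally show ?thesis .
    qed
    then show "snd (fund_monomial n (r + 1)) = snd (height_mon n (int (r + 1)) H)"
      by (intro poly_mapping_eqI) (auto simp: yexp_def)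
  qed
qed

section \<open>Restriction to the horizontal subalgebra\<close>

lemma pullback_simps [simp]:
  "carrier (pullback_module f M) = carrier M" "zero (pullback_module f M) = zero M"
  "add (pullback_module f M) = add M" "smult (pullback_module f M) a x = f a \<odot>\<^bsub>M\<^esub> x"
  by (simp_all add: pullback_module_def)

lemma pullback_abelian_group:
  assumes "abelian_group M" shows "abelian_group (pullback_module f M)"
proof -
  interpret M: abelian_group M by fact
  show ?thesis
  proof (rule abelian_groupI)
    fix x assume "x \<in> carrier (pullback_module f M)"
    then show "\<exists>y\<in>carrier (pullback_module f M).
        y \<oplus>\<^bsub>pullback_module f M\<^esub> x = \<zero>\<^bsub>pullback_module f M\<^esub>"
      by (intro bexI[of _ "\<ominus>\<^bsub>M\<^esub> x"]) (simp_all add: M.l_neg)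
    next
    fix x y assume "x \<in> carrier (pullback_module f M)" "y \<in> carrier (pullback_module f M)"
    then show "x \<oplus>\<^bsub>pullback_module f M\<^esub> y = y \<oplus>\<^bsub>pullback_module f M\<^esub> x"
      by (simp add: M.a_comm)
  qed (simp_all add: M.a_assoc)
qed

text \<open>
  The two modules have the same addition but different record types, so that their iterated sums are
  not instances of the same term.
\<close>

lemma pullback_finsum:
  assumes "abelian_group M" "g \<in> K \<rightarrow> carrier M"
  shows "finsum (pullback_module f M) g K = finsum M g K"
proof -
  interpret M: abelian_group M by fact
  interpret P: abelian_group "pullback_module f M" by (rule pullback_abelian_group[OF assms(1)])
  show ?thesis
    using assms(2)
  proof (induction K rule: infinite_finite_induct)
    case (insert k K)
    then have "g \<in> K \<rightarrow> carrier M" "g k \<in> carrier M" by auto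
    then show ?case using insert by (simp add: M.finsum_insert P.finsum_insert)
  qed simp_all
qed

lemma pullback_left_module:
  assumes h: "ring_hom_ring A A' f" and M: "left_module A' M"
  shows "left_module A (pullback_module f M)"
proof -
  interpret h: ring_hom_ring A A' f by fact
  interpret M: left_module A' M by fact
  interpret P: abelian_group "pullback_module f M" by (rule pullback_abelian_group) unfold_locales
  show ?thesis
    by unfold_locales
      (auto simp: M.smult_closed M.smult_l_distr M.smult_r_distr M.smult_assoc1 M.smult_one)
qed

lemma left_submodule_pullback:
  "left_submodule A (pullback_module f M) N \<longleftrightarrow> additive_subgroup N M \<and> (\<forall>a\<in>carrier A. \<forall>x\<in>N. f a \<odot>\<^bsub>M\<^esub> x \<in> N)"
  by (simp add: left_submodule_def additive_subgroup_def subgroup_def m_inv_def)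

context affine_data
begin

lemma Uhor_ring: "ring (Uhor n t)"
proof -
  interpret h: ring_hom_ring "Uaff n t" "Utor n t" "horizontal_map n t" by (rule horizontal_hom)
  have "subring (horizontal_map n t ` carrier (Uaff n t)) (Utor n t)"
  proof (rule h.S.subringI)
    show "\<one>\<^bsub>Utor n t\<^esub> \<in> horizontal_map n t ` carrier (Uaff n t)"
      by (rule image_eqI[of _ _ "\<one>\<^bsub>Uaff n t\<^esub>"]) simp_all
    fix a assume "a \<in> horizontal_map n t ` carrier (Uaff n t)"
    then obtain a' where a: "a' \<in> carrier (Uaff n t)" "a = horizontal_map n t a'" by blast
    show "\<ominus>\<^bsub>Utor n t\<^esub> a \<in> horizontal_map n t ` carrier (Uaff n t)"
      using a(1) by (intro image_eqI[of _ _ "\<ominus>\<^bsub>Uaff n t\<^esub> a'"]) (simp_all add: a(2))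
    fix b assume "b \<in> horizontal_map n t ` carrier (Uaff n t)"
    then obtain b' where b: "b' \<in> carrier (Uaff n t)" "b = horizontal_map n t b'" by blast
    show "a \<otimes>\<^bsub>Utor n t\<^esub> b \<in> horizontal_map n t ` carrier (Uaff n t)"
      using a(1) b(1) by (intro image_eqI[of _ _ "a' \<otimes>\<^bsub>Uaff n t\<^esub> b'"]) (simp_all add: a(2) b(2))
    show "a \<oplus>\<^bsub>Utor n t\<^esub> b \<in> horizontal_map n t ` carrier (Uaff n t)"
      using a(1) b(1) by (intro image_eqI[of _ _ "a' \<oplus>\<^bsub>Uaff n t\<^esub> b'"]) (simp_all add: a(2) b(2))
  qed auto
  then show ?thesis unfolding Uhor_def by (rule h.S.subring_is_ring)
qed

lemma Uhor_left_module:
  assumes "left_module (Utor n t) V" shows "left_module (Uhor n t) V"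
proof -
  interpret V: left_module "Utor n t" V by fact
  interpret h: ring_hom_ring "Uaff n t" "Utor n t" "horizontal_map n t" by (rule horizontal_hom)
  interpret H: ring "Uhor n t" by (rule Uhor_ring)
  have sub: "a \<in> carrier (Uhor n t) \<Longrightarrow> a \<in> carrier (Utor n t)" for a
    by (auto simp: Uhor_def)
  have ops: "add (Uhor n t) = add (Utor n t)" "mult (Uhor n t) = mult (Utor n t)" "one (Uhor n t) = one (Utor n t)"
    by (simp_all add: Uhor_def)
  show ?thesis
    by unfold_locales
      (auto simp: ops sub V.smult_closed V.smult_l_distr V.smult_r_distr V.smult_assoc1 V.smult_one)
qed

text \<open>
  A submodule for a larger algebra is one for the horizontal image.
\<close>

lemma simple_from_restriction:
  assumes V: "left_module (Utor n t) V"
    and simple: "simple_left_module (Uaff n t) (pullback_module (horizontal_map n t) V)"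
  shows "simple_left_module (Utor n t) V" "simple_left_module (Uhor n t) V"
proof -
  interpret h: ring_hom_ring "Uaff n t" "Utor n t" "horizontal_map n t" by (rule horizontal_hom)
  have ne: "carrier V \<noteq> {\<zero>\<^bsub>V\<^esub>}" using simple by (simp add: simple_left_module_def)
  have key: "N = {\<zero>\<^bsub>V\<^esub>} \<or> N = carrier V"
    if "additive_subgroup N V" "\<And>a x. \<lbrakk>a \<in> carrier (Uaff n t); x \<in> N\<rbrakk> \<Longrightarrow> horizontal_map n t a \<odot>\<^bsub>V\<^esub> x \<in> N" for N
  proof -
    have "left_submodule (Uaff n t) (pullback_module (horizontal_map n t) V) N"
      using that by (simp add: left_submodule_pullback)
    then show ?thesis using simple unfolding simple_left_module_def by simp
  qed
  show "simple_left_module (Utor n t) V"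
    unfolding simple_left_module_def
  proof (intro conjI allI impI V ne)
    fix N assume "left_submodule (Utor n t) V N"
    then show "N = {\<zero>\<^bsub>V\<^esub>} \<or> N = carrier V"
      by (intro key) (auto simp: left_submodule_def)
  qed
  show "simple_left_module (Uhor n t) V"
    unfolding simple_left_module_def
  proof (intro conjI allI impI Uhor_left_module[OF V] ne)
    fix N assume "left_submodule (Uhor n t) V N"
    then show "N = {\<zero>\<^bsub>V\<^esub>} \<or> N = carrier V"
      by (intro key) (auto simp: left_submodule_def Uhor_def)
  qed
qed

lemma monomial_module_crystal_basis:
  assumes M: "is_monomial_module n t b0 V v" and B: "minuscule_crystal n (subcrystal n b0) b0"
  shows "crystal_basis n (subcrystal n b0) b0 t (pullback_module (horizontal_map n t) V) v"
proof -
  let ?P = "pullback_module (horizontal_map n t) V" and ?B = "subcrystal n b0"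
  note M' = M[unfolded is_monomial_module_def]
  have V: "left_module (Utor n t) V" using M' by (elim conjE)
  have basis: "is_basis n t V ?B v" using M' by (elim conjE)
  have K: "tor_class n t (fK h) \<odot>\<^bsub>V\<^esub> v m = tor_class n t (fscal (qpow t (pairing (ywt m) h))) \<odot>\<^bsub>V\<^esub> v m"
    if "m \<in> ?B" "h \<in> cartan_space n" for m h
    using M'[THEN conjunct2, THEN conjunct2, THEN bspec, OF that(1), THEN conjunct1] that(2) by (rule bspec)
  note X = M'[THEN conjunct2, THEN conjunct2, THEN bspec, THEN conjunct2, THEN spec, THEN mp, THEN conjunct2]
  interpret B: minuscule_crystal n ?B b0 by (rule B)
  interpret P: left_module "Uaff n t" ?P by (rule pullback_left_module[OF horizontal_hom V])
  interpret P: affine_module n t ?P ..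
  have act_P: "P.act f x = tor_class n t (hor f) \<odot>\<^bsub>V\<^esub> x" if "f \<in> FA" for f x
    using that by (simp add: P.act_def horizontal_map_class)
  have scal_P: "P.scal a x = tor_class n t (fscal a) \<odot>\<^bsub>V\<^esub> x" for a x
    using act_P[OF fa_fscal] by (simp add: P.act_scal)
  have opt: "crystal_vector V v u = opt_vec ?P v u" for u
    by (cases u) (simp_all add: crystal_vector_def)
  have closed: "v b \<in> carrier V" if "b \<in> ?B" for b using basis that by (auto simp: is_basis_def)
  interpret P: crystal_family n t ?P ?B v
  proof
    fix b assume b: "b \<in> ?B"
    show "v b \<in> carrier ?P" using closed[OF b] by simp
    show "P.act (fvar (AK h)) (v b) = P.scal (qpow t (pairing (ywt b) h)) (v b)" if "h \<in> cartan_space n" for h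
      using K[OF b that] that by (simp add: act_P scal_P)
    fix i assume i: "i \<le> n"
    show "P.act (fvar (AX Raising i)) (v b) = opt_vec ?P v (crystal_e n i b)"
      using X[OF b i, THEN conjunct1] i by (simp add: act_P opt)
    show "P.act (fvar (AX Lowering i)) (v b) = opt_vec ?P v (crystal_f n i b)"
      using X[OF b i, THEN conjunct2] i by (simp add: act_P opt)
  qed
  have lin: "P.lin v c = (\<Oplus>\<^bsub>V\<^esub>m\<in>supp c. tor_class n t (fscal (coef c m)) \<odot>\<^bsub>V\<^esub> v m)"
    if c: "supp c \<subseteq> ?B" for c
  proof -
    interpret V: left_module "Utor n t" V by (rule V)
    have "P.scal a (v m) \<in> carrier V" if "m \<in> supp c" for a m
      using P.scal_closed[of "v m" a] closed[of m] c that by auto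
    then show ?thesis
      unfolding P.lin_def scal_P by (intro pullback_finsum) (auto intro: V.abelian_group_axioms)
  qed
  show ?thesis
  proof unfold_locales
    fix x assume "x \<in> carrier ?P"
    then show "\<exists>!c. supp c \<subseteq> ?B \<and> x = P.lin v c"
    proof -
      have "(supp c \<subseteq> ?B \<and> x = P.lin v c) \<longleftrightarrow> (supp c \<subseteq> ?B \<and>
          x = (\<Oplus>\<^bsub>V\<^esub>m\<in>supp c. tor_class n t (fscal (coef c m)) \<odot>\<^bsub>V\<^esub> v m))" for c
        using lin[of c] by (rule conj_cong[OF refl arg_cong])
      moreover have "x \<in> carrier V" using \<open>x \<in> carrier ?P\<close> by (simp only: pullback_simps)
      ultimately show ?thesis
        by (simp only: basis[unfolded is_basis_def, THEN conjunct2, THEN bspec])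
    qed
  qed
qed

end

theorem proposition4p10:
  fixes r n l :: nat
    and t :: complex
    and s :: "nat \<Rightarrow> int"
    and V :: "(tor_gen falg set, 'v) module"
    and v :: "ymonomial \<Rightarrow> 'v"
  assumes "r \<ge> 1"
    and "n = 2 * r + 1"
    and "l \<in> {1, r + 1, n}"
    and not_root_of_unity: "\<forall>k::nat. k > 0 \<longrightarrow> exp t ^ k \<noteq> 1"
    and "parity_function n s"
    and "fund_monomial n l \<in> monomial_group n s"
    and "is_monomial_module n t (fund_monomial n l) V v"
  shows "simple_left_module (Utor n t) V \<and>
    simple_left_module (Uhor n t) V \<and>
    isomorphic_left_modules (Uaff n t)
      (pullback_module (horizontal_map n t) V)
      (extremal_weight_module n t (varpi l))"
proof -
  have n3: "3 \<le> n" using assms(1,2) by simp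
  interpret affine_data n t by standard (use n3 not_root_of_unity in auto)
  obtain B where "minuscule_monomials n B" "fund_monomial n l \<in> B"
  proof -
    consider "l = 1" | "l = n" | "l = r + 1" using assms(3) by blast
    then show thesis
    proof cases
      case 1
      then show ?thesis using that[OF chain_minuscule[of 1, OF _ n3]] fund_monomial_chain(1)[OF n3] by auto
    next
      case 2
      then show ?thesis using that[OF chain_minuscule[of "- 1", OF _ n3]] fund_monomial_chain(2)[OF n3] by auto
    next
      case 3
      then show ?thesis
        using that[OF height_minuscule[OF n3]] fund_monomial_heights[OF assms(1,2)] by blast
    qed
  qed
  then have "minuscule_crystal n (subcrystal n (fund_monomial n l)) (fund_monomial n l)"
    by (rule minuscule_monomials.subcrystal_minuscule)
  from monomial_module_crystal_basis[OF assms(7) this]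
  interpret V: crystal_basis n "subcrystal n (fund_monomial n l)" "fund_monomial n l" t
    "pullback_module (horizontal_map n t) V" v .
  have "left_module (Utor n t) V" using assms(7) by (simp add: is_monomial_module_def)
  moreover have "ywt (fund_monomial n l) = varpi l" by (simp add: ywt_def fund_monomial_def)
  ultimately show ?thesis
    using simple_from_restriction[OF _ V.simple] V.isomorphic_to_extremal_weight_module by simp
qed

end
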